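(* For any connected conjunctive query $Q$ without self-joins with $|\mathrm{attr}(Q)\setminus\mathrm{head}(Q)|=1$, $\mathrm{SWP}$ is $O(\log N)$-approximable, where $N$ is the input size of the database.
   Context: A conjunctive query (CQ) without self-joins is $Q(\mathbf{A}) :- R_1(\mathbb{A}_1), \ldots, R_m(\mathbb{A}_m)$ with pairwise distinct relation symbols, $\mathrm{attr}(R_i)=\mathbb{A}_i$, $\mathrm{attr}(Q)=\bigcup_i\mathbb{A}_i$, output attributes $\mathrm{head}(Q)=\mathbf{A}$. A database $D$ gives each $R_i$ a finite set of tuples over $\mathbb{A}_i$; $N=|D|$; $Q(D)$ is the projection onto $\mathrm{head}(Q)$ of the natural join. $\mathrm{SWP}(Q,D)$ asks for $D'\subseteq D$ with $Q(D')=Q(D)$ and $|D'|$ minimum. For fixed $Q$, $\mathrm{SWP}$ is $\theta$-approximable if there is an algorithm running in time polynomial in $|D|$ that for every database $D$ outputs $D'\subseteq D$ with $Q(D')=Q(D)$ and $|D'|\le\theta\cdot|D^*|$, $D^*$ a solution to $\mathrm{SWP}(Q,D)$. $Q$ is connected if the graph on its relations with edges between relations sharing an attribute is connected. *)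

theory Defs
  imports Complex_Main
begin

section \<open>Conjunctive queries without self-joins\<close>

text \<open>A CQ without self-joins is given by a list of atoms; atom i is the relation
  symbol R_i (distinct indices give pairwise distinct symbols), and the list
  atoms ! i enumerates attr(R_i) (without repetitions).  Attributes and data
  values are natural numbers.  head is the set of output attributes.\<close>

definition qattrs :: "nat list list \<Rightarrow> nat set" where
  "qattrs atoms = (\<Union>A\<in>set atoms. set A)"

definition cq_edges :: "nat list list \<Rightarrow> (nat \<times> nat) set" where
  "cq_edges atoms = {(i, j). i < length atoms \<and> j < length atoms \<and>
                       set (atoms ! i) \<inter> set (atoms ! j) \<noteq> {}}"

definition connected_cq :: "nat list list \<Rightarrow> bool" where
  "connected_cq atoms =
     (\<forall>i < length atoms. \<forall>j < length atoms. (i, j) \<in> (cq_edges atoms)\<^sup>*)"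

text \<open>A fact (i, vs) is a tuple of relation R_i; vs ! p is the value of attribute
  atoms ! i ! p.\<close>

type_synonym fact = "nat \<times> nat list"

definition wf_fact :: "nat list list \<Rightarrow> fact \<Rightarrow> bool" where
  "wf_fact atoms f = (fst f < length atoms \<and> length (snd f) = length (atoms ! fst f))"

definition wf_db :: "nat list list \<Rightarrow> fact set \<Rightarrow> bool" where
  "wf_db atoms D = (finite D \<and> (\<forall>f\<in>D. wf_fact atoms f))"

text \<open>Q(D): projections onto head(Q) of the assignments satisfying all atoms.\<close>

definition cq_eval :: "nat list list \<Rightarrow> nat set \<Rightarrow> fact set \<Rightarrow> (nat \<Rightarrow> nat option) set" where
  "cq_eval atoms head D =
     {(\<lambda>a. if a \<in> head then Some (h a) else None) | h.
        \<forall>i < length atoms. (i, map h (atoms ! i)) \<in> D}"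

definition swp_feasible :: "nat list list \<Rightarrow> nat set \<Rightarrow> fact set \<Rightarrow> fact set \<Rightarrow> bool" where
  "swp_feasible atoms head D D' = (D' \<subseteq> D \<and> cq_eval atoms head D' = cq_eval atoms head D)"

text \<open>Size |D*| of an optimal solution of SWP(Q,D).\<close>

definition swp_opt :: "nat list list \<Rightarrow> nat set \<Rightarrow> fact set \<Rightarrow> nat" where
  "swp_opt atoms head D = Min (card ` {D'. swp_feasible atoms head D D'})"

section \<open>Machine model: unit-cost RAM with addition/subtraction and indirect addressing\<close>

datatype instr =
    LoadC nat nat        (* r := constant *)
  | Add nat nat nat      (* r := r1 + r2 *)
  | Sub nat nat nat      (* r := r1 - r2 (truncated) *)
  | Load nat nat         (* r := mem[mem[a]] *)
  | Store nat nat        (* mem[mem[a]] := mem[b] *)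
  | Jz nat nat           (* if mem[a] = 0 goto l *)
  | Halt

type_synonym config = "nat \<times> (nat \<Rightarrow> nat)"

fun exec_instr :: "instr \<Rightarrow> config \<Rightarrow> config" where
  "exec_instr (LoadC r n) (pc, m) = (Suc pc, m(r := n))"
| "exec_instr (Add r a b) (pc, m) = (Suc pc, m(r := m a + m b))"
| "exec_instr (Sub r a b) (pc, m) = (Suc pc, m(r := m a - m b))"
| "exec_instr (Load r a) (pc, m) = (Suc pc, m(r := m (m a)))"
| "exec_instr (Store a b) (pc, m) = (Suc pc, m(m a := m b))"
| "exec_instr (Jz a l) (pc, m) = (if m a = 0 then (l, m) else (Suc pc, m))"
| "exec_instr Halt (pc, m) = (pc, m)"

definition ram_step :: "instr list \<Rightarrow> config \<Rightarrow> config" where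
  "ram_step prog c = (if fst c < length prog then exec_instr (prog ! fst c) c else c)"

definition ram_halted :: "instr list \<Rightarrow> config \<Rightarrow> bool" where
  "ram_halted prog c = (fst c \<ge> length prog \<or> prog ! fst c = Halt)"

definition ram_init :: "nat list \<Rightarrow> config" where
  "ram_init xs = (0, (\<lambda>i. if i < length xs then xs ! i else 0))"

text \<open>Output convention: mem[0] is the output length, mem[1..] the output words.\<close>

definition ram_output :: "(nat \<Rightarrow> nat) \<Rightarrow> nat list" where
  "ram_output m = map (\<lambda>i. m (Suc i)) [0..<m 0]"

definition ram_computes_within :: "instr list \<Rightarrow> nat list \<Rightarrow> nat \<Rightarrow> nat list \<Rightarrow> bool" where
  "ram_computes_within prog xs t ys =
     (\<exists>n \<le> t. ram_halted prog ((ram_step prog ^^ n) (ram_init xs)) \<and>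
              ram_output (snd ((ram_step prog ^^ n) (ram_init xs))) = ys)"

text \<open>Encoding of a database given as a list of its facts.\<close>

definition encode_db :: "fact list \<Rightarrow> nat list" where
  "encode_db fs = length fs # concat (map (\<lambda>(i, vs). i # vs) fs)"

end

theory Submission
  imports Defs
begin

text \<open>
  Let x be the only attribute outside the head and m the number of atoms. A fact of an atom
  without x that takes part in some join is determined by the output tuple it serves, so every
  solution contains it. The other facts are the vertices of a hypergraph whose edges are the
  joins; the key of an edge is its output tuple, and each edge lies inside one group, the facts
  sharing an x-value. A solution is a vertex set containing an edge of every key. For d from the
  number of edges down to 1 and every group, select the largest set in which every vertex lies on
  at least d edges with uncovered key (found by peeling off vertices of smaller degree). An edge
  has at most m vertices and a group determines an edge from its key, so such a set C covers at
  least d |C| / m new keys; and if no such set is left for d + 1, a solution A contains at most d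
  |A| edges with uncovered key, so at most d |A| keys are uncovered. Hence each new key costs at
  most m |A| / u while u keys are uncovered, and m |A| (1 + 1/2 + ... + 1/T) in total for T keys,
  where T is at most the m-th power of the number of facts.

  To run this on the RAM, it is written in a language in which every loop runs exactly N times;
  any program of this language takes polynomially many steps.
\<close>

text \<open>Covering greedily in the usual way would ask for the set with the best ratio of new keys
  to selected vertices, a choice among exponentially many sets. Minimum degree is a local
  substitute: it is decided by peeling and loses only the factor m, the largest edge size. The
  choice stays inside one group because elsewhere many edges of a dense set could share a key, and
  high degrees would not yield many keys. The bound for a solution A is the edge bound of degenerate
  hypergraphs; the threshold d occurs in both estimates and cancels. The final constant is m * m:
  one m is the edge size, the other comes from ln (n ^ m), where n is the number of facts. On the
  machine there is no multiplication, the input lies where registers are needed, and only n is at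
  hand at the start. Hence every address and the loop bound N are n times a power of two, reached by
  doubling. The query is fixed, so m, the arities and the positions of attributes are constants of
  the code, and quantifiers over joins become m nested sums.\<close>

section \<open>A loop language and its compilation to RAM code\<close>

text \<open>The array Raw consists of the cells between the registers and N, which initially hold most of the
  input and finally most of the output.\<close>

datatype arr = Raw | Inp | Ptr | Sel | Alive | Nf | Thr | Out

text \<open>There are no conditionals: truth values are numbers, with every nonzero number true, and
  \<open>Sgm\<close> serves for counting as well as for existential quantification.\<close>

datatype exp = Cst nat | Var nat | Bnd | Rd arr exp | Pls exp exp | Mns exp exp | Dbl exp | Sgm nat exp

datatype com = Skip | Wr arr exp exp | Seq com com | For nat com

type_synonym heap = "arr \<Rightarrow> nat \<Rightarrow> nat"

text \<open>Clipping the indices of Raw at its last cell L keeps it apart from the other arrays, so that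
  programs need no side conditions.\<close>

definition clip :: "nat \<Rightarrow> arr \<Rightarrow> nat \<Rightarrow> nat" where
  "clip L a i = (if a = Raw then min i L else i)"

fun eval :: "nat \<Rightarrow> nat \<Rightarrow> (nat \<Rightarrow> nat) \<Rightarrow> heap \<Rightarrow> exp \<Rightarrow> nat" where
  "eval N L env h (Cst c) = c"
| "eval N L env h (Var r) = env r"
| "eval N L env h Bnd = N"
| "eval N L env h (Rd a e) = h a (clip L a (eval N L env h e))"
| "eval N L env h (Pls e f) = eval N L env h e + eval N L env h f"
| "eval N L env h (Mns e f) = eval N L env h e - eval N L env h f"
| "eval N L env h (Dbl e) = 2 * eval N L env h e"
| "eval N L env h (Sgm r e) = (\<Sum>i<N. eval N L (env(r := i)) h e)"

fun exec :: "nat \<Rightarrow> nat \<Rightarrow> (nat \<Rightarrow> nat) \<Rightarrow> com \<Rightarrow> heap \<Rightarrow> heap" where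
  "exec N L env Skip h = h"
| "exec N L env (Wr a e f) h = h(a := (h a)(clip L a (eval N L env h e) := eval N L env h f))"
| "exec N L env (Seq c d) h = exec N L env d (exec N L env c h)"
| "exec N L env (For r c) h = fold (\<lambda>i. exec N L (env(r := i)) c) [0..<N] h"

fun slot :: "arr \<Rightarrow> nat" where
  "slot Raw = 7" | "slot Inp = 0" | "slot Ptr = 1" | "slot Sel = 2" | "slot Alive = 3"
| "slot Nf = 4" | "slot Thr = 5" | "slot Out = 6"

text \<open>Cell 0 holds N, the cells below R hold variables and temporaries, and the arrays other than Raw
  are interleaved from N on.\<close>

definition adr :: "nat \<Rightarrow> nat \<Rightarrow> arr \<Rightarrow> nat \<Rightarrow> nat" where
  "adr R N a i = (if a = Raw then R + i else N + (8 * i + slot a))"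

text \<open>With truncated subtraction, \<open>min i L\<close> is \<open>i - (i - L)\<close>, where
  \<open>L = N - 1 - R\<close>; the factor 8 of the interleaved arrays is three doublings.\<close>

definition adr_code :: "nat \<Rightarrow> nat \<Rightarrow> arr \<Rightarrow> instr list" where
  "adr_code R t a = (if a = Raw
     then [LoadC (t+1) (R+1), Sub (t+1) 0 (t+1), Sub (t+2) t (t+1), Sub t t (t+2), LoadC (t+1) R, Add t t (t+1)]
     else [Add t t t, Add t t t, Add t t t, LoadC (t+1) (slot a), Add t t (t+1), Add t t 0])"

text \<open>Jump targets are absolute, so code lengths must be available before the code is
  generated, independently of its position.\<close>

fun elen :: "exp \<Rightarrow> nat" where
  "elen (Cst c) = 1"
| "elen (Var r) = 2"
| "elen Bnd = 2"
| "elen (Rd a e) = elen e + 7"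
| "elen (Pls e f) = elen e + elen f + 1"
| "elen (Mns e f) = elen e + elen f + 1"
| "elen (Dbl e) = elen e + 1"
| "elen (Sgm r e) = elen e + 12"

text \<open>The value ends up in cell \<open>t\<close>, and the cells from \<open>t\<close> up to
  \<open>R\<close> are scratch. Copying is addition of 0, an unconditional jump tests a fresh 0. A
  sum accumulates in \<open>t\<close> and keeps the previous value of its loop variable in
  \<open>t+1\<close>, so that variables can be reused by nested binders.\<close>

fun ecode :: "nat \<Rightarrow> nat \<Rightarrow> nat \<Rightarrow> exp \<Rightarrow> instr list" where
  "ecode R t pc (Cst c) = [LoadC t c]"
| "ecode R t pc (Var r) = [LoadC t 0, Add t (Suc r) t]"
| "ecode R t pc Bnd = [LoadC t 0, Add t 0 t]"
| "ecode R t pc (Rd a e) = ecode R t pc e @ adr_code R t a @ [Load t t]"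
| "ecode R t pc (Pls e f) = ecode R t pc e @ ecode R (t+1) (pc + elen e) f @ [Add t t (t+1)]"
| "ecode R t pc (Mns e f) = ecode R t pc e @ ecode R (t+1) (pc + elen e) f @ [Sub t t (t+1)]"
| "ecode R t pc (Dbl e) = ecode R t pc e @ [Add t t t]"
| "ecode R t pc (Sgm r e) =
     [LoadC t 0, Add (t+1) (Suc r) t, LoadC (Suc r) 0, Sub (t+2) 0 (Suc r), Jz (t+2) (pc + elen e + 10)] @
     ecode R (t+2) (pc + 5) e @
     [Add t t (t+2), LoadC (t+2) 1, Add (Suc r) (Suc r) (t+2), LoadC (t+2) 0, Jz (t+2) (pc + 3),
      LoadC (t+2) 0, Add (Suc r) (t+1) (t+2)]"

fun clen :: "com \<Rightarrow> nat" where
  "clen Skip = 0"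
| "clen (Wr a e f) = elen e + elen f + 7"
| "clen (Seq c d) = clen c + clen d"
| "clen (For r c) = clen c + 11"

fun ccode :: "nat \<Rightarrow> nat \<Rightarrow> nat \<Rightarrow> com \<Rightarrow> instr list" where
  "ccode R t pc Skip = []"
| "ccode R t pc (Wr a e f) = ecode R t pc e @ adr_code R t a @ ecode R (t+1) (pc + elen e + 6) f @ [Store t (t+1)]"
| "ccode R t pc (Seq c d) = ccode R t pc c @ ccode R t (pc + clen c) d"
| "ccode R t pc (For r c) =
     [LoadC (t+1) 0, Add t (Suc r) (t+1), LoadC (Suc r) 0, Sub (t+1) 0 (Suc r), Jz (t+1) (pc + clen c + 9)] @
     ccode R (t+1) (pc + 5) c @
     [LoadC (t+1) 1, Add (Suc r) (Suc r) (t+1), LoadC (t+1) 0, Jz (t+1) (pc + 3),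
      LoadC (t+1) 0, Add (Suc r) t (t+1)]"

lemma length_adr_code [simp]: "length (adr_code R t a) = 6"
  by (simp add: adr_code_def)

lemma length_ecode [simp]: "length (ecode R t pc e) = elen e"
  by (induction e arbitrary: t pc) auto

lemma length_ccode [simp]: "length (ccode R t pc c) = clen c"
  by (induction c arbitrary: t pc) auto

section \<open>Static bounds on the temporaries, the variables and the running time of compiled
  code\<close>

fun etemps :: "exp \<Rightarrow> nat" where
  "etemps (Rd a e) = max (etemps e) 3"
| "etemps (Pls e f) = max (etemps e) (etemps f + 1)"
| "etemps (Mns e f) = max (etemps e) (etemps f + 1)"
| "etemps (Dbl e) = etemps e"
| "etemps (Sgm r e) = etemps e + 3"
| "etemps _ = 1"

fun ctemps :: "com \<Rightarrow> nat" where
  "ctemps Skip = 0"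
| "ctemps (Wr a e f) = etemps e + etemps f + 3"
| "ctemps (Seq c d) = max (ctemps c) (ctemps d)"
| "ctemps (For r c) = ctemps c + 2"

fun evars :: "exp \<Rightarrow> nat" where
  "evars (Var r) = Suc r"
| "evars (Rd a e) = evars e"
| "evars (Pls e f) = max (evars e) (evars f)"
| "evars (Mns e f) = max (evars e) (evars f)"
| "evars (Dbl e) = evars e"
| "evars (Sgm r e) = max (Suc r) (evars e)"
| "evars _ = 0"

fun cvars :: "com \<Rightarrow> nat" where
  "cvars Skip = 0"
| "cvars (Wr a e f) = max (evars e) (evars f)"
| "cvars (Seq c d) = max (cvars c) (cvars d)"
| "cvars (For r c) = max (Suc r) (cvars c)"

fun ecost :: "nat \<Rightarrow> exp \<Rightarrow> nat" where
  "ecost N (Rd a e) = ecost N e + 7"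
| "ecost N (Pls e f) = ecost N e + ecost N f + 1"
| "ecost N (Mns e f) = ecost N e + ecost N f + 1"
| "ecost N (Dbl e) = ecost N e + 1"
| "ecost N (Sgm r e) = N * (ecost N e + 7) + 7"
| "ecost N _ = 2"

fun ccost :: "nat \<Rightarrow> com \<Rightarrow> nat" where
  "ccost N Skip = 0"
| "ccost N (Wr a e f) = ecost N e + ecost N f + 7"
| "ccost N (Seq c d) = ccost N c + ccost N d"
| "ccost N (For r c) = N * (ccost N c + 6) + 7"

definition poly_bounded :: "(nat \<Rightarrow> nat) \<Rightarrow> bool" where
  "poly_bounded f = (\<exists>K k. \<forall>N. f N \<le> K * (N + 1) ^ k)"

lemma poly_bounded_const [simp, intro]: "poly_bounded (\<lambda>N. c)"
  unfolding poly_bounded_def by (rule exI[of _ c], rule exI[of _ 0]) auto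

lemma poly_bounded_add [intro]:
  assumes "poly_bounded f" "poly_bounded g" shows "poly_bounded (\<lambda>N. f N + g N)"
proof -
  from assms obtain K k K' k' where *: "\<And>N. f N \<le> K * (N + 1) ^ k" "\<And>N. g N \<le> K' * (N + 1) ^ k'"
    unfolding poly_bounded_def by blast
  have "f N + g N \<le> (K + K') * (N + 1) ^ (k + k')" for N
  proof -
    have "(N + 1) ^ k \<le> (N + 1) ^ (k + k')" "(N + 1) ^ k' \<le> (N + 1) ^ (k + k')"
      by (intro power_increasing; simp)+
    then have "K * (N + 1) ^ k \<le> K * (N + 1) ^ (k + k')" "K' * (N + 1) ^ k' \<le> K' * (N + 1) ^ (k + k')"
      by (intro mult_left_mono; simp)+
    then show ?thesis using *[of N] by (simp only: distrib_right)
  qed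
  then show ?thesis unfolding poly_bounded_def by blast
qed

lemma poly_bounded_times [intro]:
  assumes "poly_bounded f" shows "poly_bounded (\<lambda>N. N * f N)"
proof -
  from assms obtain K k where *: "\<And>N. f N \<le> K * (N + 1) ^ k"
    unfolding poly_bounded_def by blast
  have "N * f N \<le> K * (N + 1) ^ Suc k" for N
  proof -
    have "N * f N \<le> (N + 1) * (K * (N + 1) ^ k)" by (intro mult_mono *) auto
    then show ?thesis by (simp add: algebra_simps)
  qed
  then show ?thesis unfolding poly_bounded_def by blast
qed

lemma poly_bounded_Suc [intro]: "poly_bounded f \<Longrightarrow> poly_bounded (\<lambda>N. Suc (f N))"
  using poly_bounded_add[of f "\<lambda>_. 1"] by simp

lemma poly_bounded_ecost [intro, simp]: "poly_bounded (\<lambda>N. ecost N e)"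
  by (induction e) (auto intro!: poly_bounded_add poly_bounded_times poly_bounded_Suc)

lemma poly_bounded_ccost: "poly_bounded (\<lambda>N. ccost N c)"
  by (induction c) (auto intro!: poly_bounded_add poly_bounded_times poly_bounded_Suc)

section \<open>Execution of code fragments inside a larger program\<close>

definition code_at :: "instr list \<Rightarrow> nat \<Rightarrow> instr list \<Rightarrow> bool" where
  "code_at prog pc c = (\<forall>i<length c. pc + i < length prog \<and> prog ! (pc + i) = c ! i)"

lemma code_at_Nil [simp]: "code_at prog pc []"
  by (simp add: code_at_def)

lemma code_at_Cons [simp]:
  "code_at prog pc (x # xs) \<longleftrightarrow> pc < length prog \<and> prog ! pc = x \<and> code_at prog (Suc pc) xs"
  by (fastforce simp: code_at_def All_less_Suc2)

lemma code_at_append [simp]: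
  "code_at prog pc (xs @ ys) \<longleftrightarrow> code_at prog pc xs \<and> code_at prog (pc + length xs) ys"
  by (induction xs arbitrary: pc) auto

lemma code_at_infix: "code_at (xs @ c @ ys) (length xs) c"
  by (auto simp: code_at_def nth_append)

definition runs :: "instr list \<Rightarrow> config \<Rightarrow> config \<Rightarrow> nat \<Rightarrow> bool" where
  "runs prog c c' k = (\<exists>j\<le>k. (ram_step prog ^^ j) c = c')"

lemma runs_refl [simp]: "runs prog c c k"
  unfolding runs_def by (rule exI[of _ 0]) auto

lemma runs_trans:
  assumes "runs prog c c' k" "runs prog c' c'' l" "k + l \<le> n"
  shows "runs prog c c'' n"
proof -
  from assms obtain j j' where *: "j \<le> k" "(ram_step prog ^^ j) c = c'" "j' \<le> l" "(ram_step prog ^^ j') c' = c''"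
    unfolding runs_def by blast
  then have "(ram_step prog ^^ (j' + j)) c = c''" by (simp add: funpow_add)
  moreover have "j' + j \<le> n" using * assms by linarith
  ultimately show ?thesis unfolding runs_def by blast
qed

lemma runs_step:
  assumes "pc < length prog" "runs prog (exec_instr (prog ! pc) (pc, m)) c' k"
  shows "runs prog (pc, m) c' (Suc k)"
proof -
  have "runs prog (pc, m) (exec_instr (prog ! pc) (pc, m)) 1"
    unfolding runs_def using assms by (intro exI[of _ 1]) (auto simp: ram_step_def)
  then show ?thesis using assms(2) by (rule runs_trans) simp
qed

fun straight :: "instr \<Rightarrow> bool" where
  "straight (Jz a l) = False" | "straight Halt = False" | "straight _ = True"

lemma runs_straight:
  assumes "code_at prog pc is" "\<forall>i\<in>set is. straight i"
  shows "runs prog (pc, m) (pc + length is, fold (\<lambda>i m. snd (exec_instr i (0, m))) is m) (length is)"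
  using assms
proof (induction "is" arbitrary: pc m)
  case (Cons i "is")
  have "exec_instr i (pc, m) = (Suc pc, snd (exec_instr i (0, m)))"
    using Cons.prems by (cases i) auto
  then show ?case
    using Cons runs_step[of pc prog m _ "length is"] by fastforce
qed simp


lemma runs_straight_eq:
  assumes "code_at prog pc is" "\<forall>i\<in>set is. straight i" "pc' = pc + length is" "length is \<le> k"
    "m' = fold (\<lambda>i m. snd (exec_instr i (0, m))) is m"
  shows "runs prog (pc, m) (pc', m') k"
  using runs_trans[OF runs_straight[OF assms(1,2)] runs_refl[of _ _ 0]] assms(3-) by simp

lemma runs_straight_ex:
  assumes "code_at prog pc is" "\<forall>i\<in>set is. straight i" "pc' = pc + length is" "length is \<le> k"
    "Q (fold (\<lambda>i m. snd (exec_instr i (0, m))) is m)"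
  shows "\<exists>m'. runs prog (pc, m) (pc', m') k \<and> Q m'"
  using runs_straight_eq[OF assms(1-4) refl] assms(5) by blast

section \<open>Correctness of the compiler\<close>

definition rep :: "nat \<Rightarrow> nat \<Rightarrow> nat \<Rightarrow> (nat \<Rightarrow> nat) \<Rightarrow> heap \<Rightarrow> (nat \<Rightarrow> nat) \<Rightarrow> bool" where
  "rep R N nv env h m \<longleftrightarrow> m 0 = N \<and> (\<forall>r<nv. m (Suc r) = env r) \<and>
     (\<forall>a i. (a = Raw \<longrightarrow> i \<le> N - 1 - R) \<longrightarrow> m (adr R N a i) = h a i)"

lemma adr_ge: "R < N \<Longrightarrow> R \<le> adr R N a i"
  by (simp add: adr_def)

lemma slot_less: "slot a < 8"
  by (cases a) auto

lemma slot_inj: "slot a = slot b \<Longrightarrow> a = b"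
  by (cases a; cases b) auto

lemma adr_inj:
  assumes "adr R N a i = adr R N b j" "a = Raw \<longrightarrow> i \<le> N - 1 - R" "b = Raw \<longrightarrow> j \<le> N - 1 - R" "R < N"
  shows "a = b \<and> i = j"
proof -
  have *: "a = b \<and> i = j" if "8 * i + slot a = 8 * j + slot b"
  proof -
    have "(8 * i + slot a) mod 8 = slot a" "(8 * j + slot b) mod 8 = slot b"
      using slot_less by simp_all
    then have "a = b" using that slot_inj by metis
    then show ?thesis using that by simp
  qed
  show ?thesis using assms * unfolding adr_def by (auto split: if_splits)
qed

definition agree :: "nat \<Rightarrow> nat \<Rightarrow> (nat \<Rightarrow> nat) \<Rightarrow> (nat \<Rightarrow> nat) \<Rightarrow> bool" where
  "agree t R m m' = (\<forall>x. x < t \<or> R \<le> x \<longrightarrow> m' x = m x)"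

lemma rep_cong:
  assumes "rep R N nv env h m" "agree t R m m'" "nv < t" "R < N"
  shows "rep R N nv env h m'"
  using assms adr_ge[OF assms(4)] unfolding rep_def agree_def by auto

lemma adr_code_correct:
  assumes code: "code_at prog pc (adr_code R t a)" and m: "m 0 = N" and "0 < t" "t + 3 \<le> R" "R < N"
  shows "\<exists>m'. runs prog (pc, m) (pc + 6, m') 6 \<and> m' t = adr R N a (clip (N - 1 - R) a (m t)) \<and>
           agree t R m m'"
  by (rule runs_straight_ex[OF code]) (use assms in \<open>auto simp: adr_code_def adr_def clip_def agree_def\<close>)

lemma add_max_le_iff [simp]: "t + max a b \<le> (R::nat) \<longleftrightarrow> t + a \<le> R \<and> t + b \<le> R"
  by auto

lemma etemps_pos: "0 < etemps e"
  by (induction e) auto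

text \<open>The cell of the loop variable is exempt from the comparison of the two memories. This
  covers entering a loop, incrementing its variable and restoring the old value afterwards.\<close>

lemma rep_env_upd:
  assumes rep: "rep R N nv env h m" and same: "\<And>x. x < t \<or> R \<le> x \<Longrightarrow> x \<noteq> Suc r \<Longrightarrow> m' x = m x"
    and "m' (Suc r) = i" "Suc r < t" "nv < t" "t \<le> R" "R < N"
  shows "rep R N nv (env(r := i)) h m'"
proof -
  have "m' (adr R N a j) = m (adr R N a j)" for a j
    using same[of "adr R N a j"] adr_ge[OF assms(7), of a j] assms by simp
  moreover have "m' 0 = m 0" "\<forall>r'<nv. r' \<noteq> r \<longrightarrow> m' (Suc r') = m (Suc r')"
    using same assms(4-) by auto
  ultimately show ?thesis using assms unfolding rep_def by auto
qed

text \<open>The frame condition \<open>agree\<close> is what makes the induction work: a first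
  operand in \<open>t\<close> survives the evaluation of the second one, which touches only cells
  from \<open>t+1\<close> on.\<close>

lemma ecode_correct:
  assumes "code_at prog pc (ecode R t pc e)" "rep R N nv env h m"
    "evars e \<le> nv" "nv < t" "t + etemps e \<le> R" "R < N"
  shows "\<exists>m'. runs prog (pc, m) (pc + elen e, m') (ecost N e) \<and> m' t = eval N (N - 1 - R) env h e \<and>
           agree t R m m'"
  using assms
proof (induction e arbitrary: t pc env m)
  case (Cst c)
  show ?case
    by (rule runs_straight_ex[OF Cst.prems(1)]) (use Cst.prems in \<open>auto simp: agree_def\<close>)
next
  case (Var r)
  show ?case
    by (rule runs_straight_ex[OF Var.prems(1)]) (use Var.prems in \<open>auto simp: rep_def agree_def\<close>)
next
  case Bnd
  show ?case
    by (rule runs_straight_ex[OF Bnd.prems(1)]) (use Bnd.prems in \<open>auto simp: rep_def agree_def\<close>)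
next
  case (Rd a e)
  note prems = Rd.prems
  obtain m1 where m1: "runs prog (pc, m) (pc + elen e, m1) (ecost N e)"
    "m1 t = eval N (N - 1 - R) env h e" "agree t R m m1"
    using Rd.IH[of pc t env m] prems by auto
  have rep1: "rep R N nv env h m1" using rep_cong m1(3) prems by blast
  obtain m2 where m2: "runs prog (pc + elen e, m1) (pc + elen e + 6, m2) 6"
    "m2 t = adr R N a (clip (N - 1 - R) a (m1 t))" "agree t R m1 m2"
    using adr_code_correct[of prog "pc + elen e" R t a m1 N] prems rep1 by (auto simp: rep_def)
  have rep2: "rep R N nv env h m2" using rep_cong[OF rep1] m2(3) prems by blast
  have 3: "runs prog (pc + elen e + 6, m2) (pc + elen (Rd a e), m2(t := m2 (m2 t))) 1"
    by (rule runs_straight_eq[of _ _ "[Load t t]"]) (use prems in auto)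
  have 4: "runs prog (pc, m) (pc + elen (Rd a e), m2(t := m2 (m2 t))) (ecost N (Rd a e))"
    by (rule runs_trans[OF m1(1) runs_trans[OF m2(1) 3]]) auto
  have "m2 (m2 t) = h a (clip (N - 1 - R) a (m1 t))"
    using rep2 m2(2) unfolding rep_def by (auto simp: clip_def)
  then show ?case using m1 m2 3 prems
    by (intro exI[of _ "m2(t := m2 (m2 t))"] conjI 4) (auto simp: agree_def)
next
  case (Pls e f)
  note prems = Pls.prems
  obtain m1 where m1: "runs prog (pc, m) (pc + elen e, m1) (ecost N e)"
    "m1 t = eval N (N - 1 - R) env h e" "agree t R m m1"
    using Pls.IH(1)[of pc t env m] prems by auto
  have rep1: "rep R N nv env h m1" using rep_cong m1(3) prems by blast
  obtain m2 where m2: "runs prog (pc + elen e, m1) (pc + elen e + elen f, m2) (ecost N f)"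
    "m2 (t+1) = eval N (N - 1 - R) env h f" "agree (t+1) R m1 m2"
    using Pls.IH(2)[of "pc + elen e" "t+1" env m1] prems rep1 by auto
  have 3: "runs prog (pc + elen e + elen f, m2) (pc + elen (Pls e f), m2(t := m2 t + m2 (t+1))) 1"
    by (rule runs_straight_eq[of _ _ "[Add t t (t+1)]"]) (use prems in auto)
  have 4: "runs prog (pc, m) (pc + elen (Pls e f), m2(t := m2 t + m2 (t+1))) (ecost N (Pls e f))"
    by (rule runs_trans[OF m1(1) runs_trans[OF m2(1) 3]]) auto
  show ?case using m1 m2 prems etemps_pos[of e]
    by (intro exI[of _ "m2(t := m2 t + m2 (t+1))"] conjI 4) (auto simp: agree_def)
next
  case (Mns e f)
  note prems = Mns.prems
  obtain m1 where m1: "runs prog (pc, m) (pc + elen e, m1) (ecost N e)"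
    "m1 t = eval N (N - 1 - R) env h e" "agree t R m m1"
    using Mns.IH(1)[of pc t env m] prems by auto
  have rep1: "rep R N nv env h m1" using rep_cong m1(3) prems by blast
  obtain m2 where m2: "runs prog (pc + elen e, m1) (pc + elen e + elen f, m2) (ecost N f)"
    "m2 (t+1) = eval N (N - 1 - R) env h f" "agree (t+1) R m1 m2"
    using Mns.IH(2)[of "pc + elen e" "t+1" env m1] prems rep1 by auto
  have 3: "runs prog (pc + elen e + elen f, m2) (pc + elen (Mns e f), m2(t := m2 t - m2 (t+1))) 1"
    by (rule runs_straight_eq[of _ _ "[Sub t t (t+1)]"]) (use prems in auto)
  have 4: "runs prog (pc, m) (pc + elen (Mns e f), m2(t := m2 t - m2 (t+1))) (ecost N (Mns e f))"
    by (rule runs_trans[OF m1(1) runs_trans[OF m2(1) 3]]) auto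
  show ?case using m1 m2 prems etemps_pos[of e]
    by (intro exI[of _ "m2(t := m2 t - m2 (t+1))"] conjI 4) (auto simp: agree_def)
next
  case (Dbl e)
  note prems = Dbl.prems
  obtain m1 where m1: "runs prog (pc, m) (pc + elen e, m1) (ecost N e)"
    "m1 t = eval N (N - 1 - R) env h e" "agree t R m m1"
    using Dbl.IH[of pc t env m] prems by auto
  have 3: "runs prog (pc + elen e, m1) (pc + elen (Dbl e), m1(t := m1 t + m1 t)) 1"
    by (rule runs_straight_eq[of _ _ "[Add t t t]"]) (use prems in auto)
  have 4: "runs prog (pc, m) (pc + elen (Dbl e), m1(t := m1 t + m1 t)) (ecost N (Dbl e))"
    by (rule runs_trans[OF m1(1) 3]) auto
  show ?case using m1 prems etemps_pos[of e]
    by (intro exI[of _ "m1(t := m1 t + m1 t)"] conjI 4) (auto simp: agree_def)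
next
  case (Sgm r e)
  note prems = Sgm.prems
  let ?L = "N - 1 - R"
  \<comment> \<open>The state at the loop head \<open>pc + 3\<close> after \<open>i\<close>
    iterations; the original value of the loop variable waits in \<open>t+1\<close>.\<close>
  define inv where "inv i m' \<longleftrightarrow> m' (Suc r) = i \<and> m' t = (\<Sum>j<i. eval N ?L (env(r := j)) h e) \<and> m' (t+1) = m (Suc r) \<and>
    (\<forall>x. (x < t \<or> R \<le> x) \<and> x \<noteq> Suc r \<longrightarrow> m' x = m x)" for i m'
  have r: "Suc r < t" using prems by auto
  have code: "code_at prog pc [LoadC t 0, Add (t+1) (Suc r) t, LoadC (Suc r) 0]"
    "code_at prog (pc + 3) [Sub (t+2) 0 (Suc r), Jz (t+2) (pc + elen e + 10)]"
    "code_at prog (pc + 5) (ecode R (t+2) (pc + 5) e)"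
    "code_at prog (pc + 5 + elen e) [Add t t (t+2), LoadC (t+2) 1, Add (Suc r) (Suc r) (t+2), LoadC (t+2) 0]"
    "code_at prog (pc + 9 + elen e) [Jz (t+2) (pc + 3)]"
    "code_at prog (pc + elen e + 10) [LoadC (t+2) 0, Add (Suc r) (t+1) (t+2)]"
    using prems(1) by (simp_all add: eval_nat_numeral)
  have start: "\<exists>m'. runs prog (pc, m) (pc + 3, m') 3 \<and> inv 0 m'"
    by (rule runs_straight_ex[OF code(1)]) (use r prems in \<open>auto simp: inv_def\<close>)
  have head: "\<exists>m''. runs prog (pc + 3, m') (if i < N then pc + 5 else pc + elen e + 10, m'') 2 \<and> inv i m''"
    if inv: "inv i m'" for i m'
  proof -
    have m0: "m' 0 = N" using inv r prems(2,4) unfolding rep_def inv_def by auto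
    let ?m = "m'(t+2 := N - i)"
    have 1: "runs prog (pc + 3, m') (pc + 4, ?m) 1"
      by (rule runs_straight_eq[of _ _ "[Sub (t+2) 0 (Suc r)]"]) (use code(2) m0 inv in \<open>auto simp: inv_def\<close>)
    have 2: "runs prog (pc + 4, ?m) (if i < N then pc + 5 else pc + elen e + 10, ?m) 1"
      using runs_step[of "pc + 4" prog ?m _ 0] code(2) by (simp add: eval_nat_numeral)
    have "runs prog (pc + 3, m') (if i < N then pc + 5 else pc + elen e + 10, ?m) 2"
      by (rule runs_trans[OF 1 2]) simp
    moreover have "inv i ?m" using inv r prems by (auto simp: inv_def)
    ultimately show ?thesis by blast
  qed
  have loop: "\<exists>m'. runs prog (pc + 3, m1) (pc + 3, m') (i * (ecost N e + 7)) \<and> inv i m'"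
    if inv: "inv 0 m1" "i \<le> N" for i m1
    using that(2)
  proof (induction i)
    case 0
    then show ?case using inv by (intro exI[of _ m1]) auto
  next
    case (Suc i)
    then obtain m2 where m2: "runs prog (pc + 3, m1) (pc + 3, m2) (i * (ecost N e + 7))" "inv i m2" by auto
    obtain m3 where m3: "runs prog (pc + 3, m2) (pc + 5, m3) 2" "inv i m3"
      using head[OF m2(2)] Suc.prems by auto
    have rep3: "rep R N nv (env(r := i)) h m3"
      using m3(2) r prems by (intro rep_env_upd[OF prems(2), of t]) (auto simp: inv_def)
    obtain m4 where m4: "runs prog (pc + 5, m3) (pc + 5 + elen e, m4) (ecost N e)"
       "m4 (t+2) = eval N ?L (env(r := i)) h e" "agree (t+2) R m3 m4"
      using Sgm.IH[OF code(3) rep3] prems by fastforce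
    let ?m5 = "m4(t := m4 t + m4 (t+2), Suc r := Suc i, t+2 := 0)"
    have 5: "runs prog (pc + 5 + elen e, m4) (pc + 9 + elen e, ?m5) 4"
      by (rule runs_straight_eq[OF code(4)])
        (use m4(3) m3(2) r in \<open>auto simp: fun_upd_twist fun_eq_iff agree_def inv_def\<close>)
    have 6: "runs prog (pc + 9 + elen e, ?m5) (pc + 3, ?m5) 1"
      using runs_step[of "pc + 9 + elen e" prog ?m5 _ 0] code(5) by simp
    have "runs prog (pc + 3, m1) (pc + 3, ?m5) (Suc i * (ecost N e + 7))"
      by (rule runs_trans[OF m2(1) runs_trans[OF m3(1) runs_trans[OF m4(1) runs_trans[OF 5 6]]]]) auto
    moreover have "inv (Suc i) ?m5" using m3(2) m4 r prems by (auto simp: agree_def inv_def)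
    ultimately show ?case by blast
  qed
  obtain m1 where m1: "runs prog (pc, m) (pc + 3, m1) 3" "inv 0 m1" using start by blast
  obtain m2 where m2: "runs prog (pc + 3, m1) (pc + 3, m2) (N * (ecost N e + 7))" "inv N m2"
    using loop[OF m1(2), of N] by blast
  obtain m3 where m3: "runs prog (pc + 3, m2) (pc + elen e + 10, m3) 2" "inv N m3"
    using head[OF m2(2)] by auto
  let ?m4 = "m3(t+2 := 0, Suc r := m3 (t+1))"
  have 4: "runs prog (pc + elen e + 10, m3) (pc + elen (Sgm r e), ?m4) 2"
    by (rule runs_straight_eq[OF code(6)]) (use r m3(2) in \<open>auto simp: fun_eq_iff inv_def\<close>)
  have "runs prog (pc, m) (pc + elen (Sgm r e), ?m4) (ecost N (Sgm r e))"
    by (rule runs_trans[OF m1(1) runs_trans[OF m2(1) runs_trans[OF m3(1) 4]]]) auto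
  moreover have "?m4 t = eval N ?L env h (Sgm r e)" using m3(2) r by (auto simp: inv_def)
  moreover have "agree t R m ?m4" using m3(2) r prems by (auto simp: agree_def inv_def)
  ultimately show ?case by blast
qed


lemma rep_heap_upd:
  assumes rep: "rep R N nv env h m" and i: "a = Raw \<longrightarrow> i \<le> N - 1 - R" and "nv < R" "R < N"
  shows "rep R N nv env (h(a := (h a)(i := v))) (m(adr R N a i := v))"
proof -
  have "(m(adr R N a i := v)) (adr R N b j) = (h(a := (h a)(i := v))) b j"
    if "b = Raw \<longrightarrow> j \<le> N - 1 - R" for b j
  proof (cases "adr R N b j = adr R N a i")
    case True
    then show ?thesis using adr_inj[OF True that i] assms(4) by simp
  next
    case False
    then show ?thesis using rep that unfolding rep_def by auto
  qed
  moreover have "adr R N a i \<noteq> 0" "\<forall>r<nv. Suc r \<noteq> adr R N a i"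
    using adr_ge[of R N a i] assms by auto
  ultimately show ?thesis using rep unfolding rep_def by auto
qed

lemma ccode_correct:
  assumes "code_at prog pc (ccode R t pc c)" "rep R N nv env h m"
    "cvars c \<le> nv" "nv < t" "t + ctemps c \<le> R" "R < N"
  shows "\<exists>m'. runs prog (pc, m) (pc + clen c, m') (ccost N c) \<and>
           rep R N nv env (exec N (N - 1 - R) env c h) m' \<and> (\<forall>x<t. m' x = m x)"
  using assms
proof (induction c arbitrary: t pc env m h)
  case Skip
  then show ?case by (intro exI[of _ m]) auto
next
  case (Wr a e f)
  note prems = Wr.prems
  let ?L = "N - 1 - R"
  have codes: "code_at prog pc (ecode R t pc e)" "code_at prog (pc + elen e) (adr_code R t a)"
    "code_at prog (pc + elen e + 6) (ecode R (t+1) (pc + elen e + 6) f)"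
    "code_at prog (pc + elen e + 6 + elen f) [Store t (t+1)]"
    using prems(1) by (simp_all add: ac_simps)
  obtain m1 where m1: "runs prog (pc, m) (pc + elen e, m1) (ecost N e)"
    "m1 t = eval N ?L env h e" "agree t R m m1"
    using ecode_correct[OF codes(1) prems(2)] prems by auto
  have rep1: "rep R N nv env h m1" using rep_cong m1(3) prems by blast
  obtain m2 where m2: "runs prog (pc + elen e, m1) (pc + elen e + 6, m2) 6"
    "m2 t = adr R N a (clip ?L a (m1 t))" "agree t R m1 m2"
    using adr_code_correct[OF codes(2), of m1 N] prems rep1 by (auto simp: rep_def)
  have rep2: "rep R N nv env h m2" using rep_cong[OF rep1] m2(3) prems by blast
  obtain m3 where m3: "runs prog (pc + elen e + 6, m2) (pc + elen e + 6 + elen f, m3) (ecost N f)"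
    "m3 (t+1) = eval N ?L env h f" "agree (t+1) R m2 m3"
    using ecode_correct[OF codes(3) rep2] prems by auto
  have rep3: "rep R N nv env h m3" using rep_cong[OF rep2 m3(3)] prems by auto
  let ?m4 = "m3(m3 t := m3 (t+1))"
  have 4: "runs prog (pc + elen e + 6 + elen f, m3) (pc + clen (Wr a e f), ?m4) 1"
    by (rule runs_straight_eq[OF codes(4)]) auto
  have 5: "runs prog (pc, m) (pc + clen (Wr a e f), ?m4) (ccost N (Wr a e f))"
    by (rule runs_trans[OF m1(1) runs_trans[OF m2(1) runs_trans[OF m3(1) 4]]]) auto
  have m3t: "m3 t = adr R N a (clip ?L a (eval N ?L env h e))"
    using m3(3) m2(2) m1(2) by (auto simp: agree_def)
  have 6: "rep R N nv env (exec N ?L env (Wr a e f) h) ?m4"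
    using rep_heap_upd[OF rep3, of a "clip ?L a (eval N ?L env h e)" "m3 (t+1)"] prems m3(2)
    by (simp add: m3t clip_def)
  have 7: "\<forall>x<t. ?m4 x = m x"
    using m1(3) m2(3) m3(3) m3t adr_ge[OF prems(6), of a "clip ?L a (eval N ?L env h e)"] prems by (auto simp: agree_def)
  show ?case using 5 6 7 by blast
next
  case (Seq c d)
  note prems = Seq.prems
  let ?h = "exec N (N - 1 - R) env c h"
  obtain m1 where m1: "runs prog (pc, m) (pc + clen c, m1) (ccost N c)"
    "rep R N nv env ?h m1" "\<forall>x<t. m1 x = m x"
    using Seq.IH(1)[of pc t env h m] prems by auto
  obtain m2 where m2: "runs prog (pc + clen c, m1) (pc + clen c + clen d, m2) (ccost N d)"
    "rep R N nv env (exec N (N - 1 - R) env d ?h) m2" "\<forall>x<t. m2 x = m1 x"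
    using Seq.IH(2)[of "pc + clen c" t env ?h m1] prems m1 by auto
  have "runs prog (pc, m) (pc + clen (Seq c d), m2) (ccost N (Seq c d))"
    using runs_trans[OF m1(1) m2(1) order_refl] by (simp add: ac_simps)
  then show ?case using m1 m2 by (intro exI[of _ m2]) auto
next
  case (For r c)
  note prems = For.prems
  let ?L = "N - 1 - R"
  define hh where "hh i = fold (\<lambda>i. exec N ?L (env(r := i)) c) [0..<i] h" for i
  \<comment> \<open>As for sums, but the heap changes too: \<open>hh i\<close> is the heap after
    \<open>i\<close> iterations, and the old value of the loop variable waits in
    \<open>t\<close>.\<close>
  define inv where "inv i m' \<longleftrightarrow> rep R N nv (env(r := i)) (hh i) m' \<and> m' t = m (Suc r) \<and>
    (\<forall>x<t. x \<noteq> Suc r \<longrightarrow> m' x = m x)" for i m'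
  have r: "Suc r < t" "r < nv" using prems by auto
  have inv_r: "m' (Suc r) = i \<and> m' 0 = N" if "inv i m'" for i m'
    using that r unfolding inv_def rep_def by auto
  have inv_upd: "inv i (m'(t+1 := v))" if "inv i m'" for i m' v
    using that prems rep_cong[of R N nv "env(r := i)" "hh i" m' "t+1" "m'(t+1 := v)"] r
    unfolding inv_def by (auto simp: agree_def)
  have codes: "code_at prog pc [LoadC (t+1) 0, Add t (Suc r) (t+1), LoadC (Suc r) 0]"
    "code_at prog (pc + 3) [Sub (t+1) 0 (Suc r), Jz (t+1) (pc + clen c + 9)]"
    "code_at prog (pc + 5) (ccode R (t+1) (pc + 5) c)"
    "code_at prog (pc + 5 + clen c) [LoadC (t+1) 1, Add (Suc r) (Suc r) (t+1), LoadC (t+1) 0]"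
    "code_at prog (pc + 8 + clen c) [Jz (t+1) (pc + 3)]"
    "code_at prog (pc + clen c + 9) [LoadC (t+1) 0, Add (Suc r) t (t+1)]"
    using prems(1) by (simp_all add: eval_nat_numeral)
  have start: "\<exists>m'. runs prog (pc, m) (pc + 3, m') 3 \<and> inv 0 m'"
  proof (rule runs_straight_ex[OF codes(1)])
    let ?m = "m(t+1 := 0, t := m (Suc r), Suc r := 0)"
    have "rep R N nv (env(r := 0)) h ?m"
      by (rule rep_env_upd[OF prems(2), of t]) (use r prems in auto)
    then show "inv 0 (fold (\<lambda>i m. snd (exec_instr i (0, m))) [LoadC (t+1) 0, Add t (Suc r) (t+1), LoadC (Suc r) 0] m)"
      using r by (auto simp: inv_def hh_def)
  qed auto
  have head: "\<exists>m''. runs prog (pc + 3, m') (if i < N then pc + 5 else pc + clen c + 9, m'') 2 \<and> inv i m''"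
    if inv: "inv i m'" for i m'
  proof -
    let ?m = "m'(t+1 := N - i)"
    have 1: "runs prog (pc + 3, m') (pc + 4, ?m) 1"
      by (rule runs_straight_eq[of _ _ "[Sub (t+1) 0 (Suc r)]"]) (use codes(2) inv_r[OF inv] in auto)
    have 2: "runs prog (pc + 4, ?m) (if i < N then pc + 5 else pc + clen c + 9, ?m) 1"
      using runs_step[of "pc + 4" prog ?m _ 0] codes(2) by (simp add: eval_nat_numeral)
    have "runs prog (pc + 3, m') (if i < N then pc + 5 else pc + clen c + 9, ?m) 2"
      by (rule runs_trans[OF 1 2]) simp
    then show ?thesis using inv_upd[OF inv] by blast
  qed
  have loop: "\<exists>m'. runs prog (pc + 3, m1) (pc + 3, m') (i * (ccost N c + 6)) \<and> inv i m'"
    if inv: "inv 0 m1" "i \<le> N" for i m1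
    using that(2)
  proof (induction i)
    case 0
    then show ?case using inv by (intro exI[of _ m1]) auto
  next
    case (Suc i)
    then obtain m2 where m2: "runs prog (pc + 3, m1) (pc + 3, m2) (i * (ccost N c + 6))" "inv i m2" by auto
    obtain m3 where m3: "runs prog (pc + 3, m2) (pc + 5, m3) 2" "inv i m3"
      using head[OF m2(2)] Suc.prems by auto
    have rep3: "rep R N nv (env(r := i)) (hh i) m3" using m3(2) by (simp add: inv_def)
    obtain m4 where m4: "runs prog (pc + 5, m3) (pc + 5 + clen c, m4) (ccost N c)"
       "rep R N nv (env(r := i)) (hh (Suc i)) m4" "\<forall>x<t+1. m4 x = m3 x"
      using For.IH[OF codes(3) rep3] prems by (fastforce simp: hh_def)
    let ?m5 = "m4(Suc r := Suc i, t+1 := 0)"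
    have 5: "runs prog (pc + 5 + clen c, m4) (pc + 8 + clen c, ?m5) 3"
      by (rule runs_straight_eq[OF codes(4)])
        (use m4(3) inv_r[OF m3(2)] r in \<open>auto simp: fun_upd_twist fun_eq_iff\<close>)
    have 6: "runs prog (pc + 8 + clen c, ?m5) (pc + 3, ?m5) 1"
      using runs_step[of "pc + 8 + clen c" prog ?m5 _ 0] codes(5) by simp
    have "runs prog (pc + 3, m1) (pc + 3, ?m5) (Suc i * (ccost N c + 6))"
      by (rule runs_trans[OF m2(1) runs_trans[OF m3(1) runs_trans[OF m4(1) runs_trans[OF 5 6]]]]) auto
    moreover have "rep R N nv ((env(r := i))(r := Suc i)) (hh (Suc i)) ?m5"
      by (rule rep_env_upd[OF m4(2), of t]) (use r prems in auto)
    then have "inv (Suc i) ?m5" using m3(2) m4(3) r prems by (auto simp: inv_def)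
    ultimately show ?case by blast
  qed
  obtain m1 where m1: "runs prog (pc, m) (pc + 3, m1) 3" "inv 0 m1" using start by blast
  obtain m2 where m2: "runs prog (pc + 3, m1) (pc + 3, m2) (N * (ccost N c + 6))" "inv N m2"
    using loop[OF m1(2), of N] by blast
  obtain m3 where m3: "runs prog (pc + 3, m2) (pc + clen c + 9, m3) 2" "inv N m3"
    using head[OF m2(2)] by auto
  let ?m4 = "m3(t+1 := 0, Suc r := m (Suc r))"
  have 4: "runs prog (pc + clen c + 9, m3) (pc + clen (For r c), ?m4) 2"
    by (rule runs_straight_eq[OF codes(6)]) (use r m3(2) in \<open>auto simp: fun_eq_iff inv_def\<close>)
  have 5: "runs prog (pc, m) (pc + clen (For r c), ?m4) (ccost N (For r c))"
    by (rule runs_trans[OF m1(1) runs_trans[OF m2(1) runs_trans[OF m3(1) 4]]]) auto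
  have "rep R N nv ((env(r := N))(r := env r)) (hh N) ?m4"
    by (rule rep_env_upd[of _ _ _ _ _ m3 t]) (use r prems m3(2) in \<open>auto simp: inv_def rep_def\<close>)
  then have 6: "rep R N nv env (exec N ?L env (For r c) h) ?m4"
    by (simp add: hh_def)
  have 7: "\<forall>x<t. ?m4 x = m x" using m3(2) r by (auto simp: inv_def)
  show ?case using 5 6 7 by blast
qed

section \<open>Thresholded greedy covering in hypergraphs\<close>

definition harmonic :: "nat \<Rightarrow> real" where
  "harmonic n = (\<Sum>k=1..n. 1 / real k)"

lemma harmonic_le_ln: "n \<ge> 1 \<Longrightarrow> harmonic n \<le> 1 + ln (real n)"
proof (induction n rule: dec_induct)
  case base
  show ?case by (simp add: harmonic_def)
next
  case (step n)
  have "ln (real n / (real n + 1)) \<le> real n / (real n + 1) - 1"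
    by (rule ln_le_minus_one) (use step in auto)
  then have "1 / (real n + 1) \<le> ln (real n + 1) - ln (real n)"
    using step by (simp add: ln_div field_simps)
  then show ?case using step by (simp add: harmonic_def add.commute)
qed

text \<open>The difference consists of \<open>a - b\<close> terms, each at least
  \<open>1 / a\<close>.\<close>

lemma harmonic_diff_ge:
  assumes "b \<le> a" shows "(real a - real b) / real a \<le> harmonic a - harmonic b"
proof -
  have "harmonic a - harmonic b = (\<Sum>k=b+1..a. 1 / real k)"
    using assms by (induction a rule: dec_induct) (auto simp: harmonic_def)
  also have "\<dots> \<ge> (\<Sum>k=b+1..a. 1 / real a)"
    by (intro sum_mono divide_left_mono) auto
  also have "(\<Sum>k=b+1..a. 1 / real a) = (real a - real b) / real a"
    using assms by (simp add: of_nat_diff)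
  finally show ?thesis .
qed

locale keyed_hypergraph =
  fixes V :: "'v set" and E :: "'e set" and F :: "'e \<Rightarrow> 'v set" and key :: "'e \<Rightarrow> 'k"
    and gr :: "'v \<Rightarrow> 'g" and p :: nat
  assumes finite_V: "finite V" and finite_E: "finite E"
    and F_subset: "e \<in> E \<Longrightarrow> F e \<subseteq> V" and F_nonempty: "e \<in> E \<Longrightarrow> F e \<noteq> {}"
    and card_F: "e \<in> E \<Longrightarrow> card (F e) \<le> p"
    and gr_eq: "e \<in> E \<Longrightarrow> v \<in> F e \<Longrightarrow> w \<in> F e \<Longrightarrow> gr v = gr w"
    and key_inj: "e \<in> E \<Longrightarrow> e' \<in> E \<Longrightarrow> key e = key e' \<Longrightarrow> v \<in> F e \<Longrightarrow> v' \<in> F e' \<Longrightarrow> gr v = gr v' \<Longrightarrow> e = e'"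
begin

definition cov :: "'v set \<Rightarrow> 'k set" where
  "cov S = key ` {e \<in> E. F e \<subseteq> S}"

definition uncov :: "'v set \<Rightarrow> 'k set" where
  "uncov S = key ` E - cov S"

definition edges :: "'v set \<Rightarrow> 'v set \<Rightarrow> 'e set" where
  "edges S A = {e \<in> E. F e \<subseteq> A \<and> key e \<notin> cov S}"

definition deg :: "'v set \<Rightarrow> 'v set \<Rightarrow> 'v \<Rightarrow> nat" where
  "deg S A v = card {e \<in> edges S A. v \<in> F e}"

text \<open>Degeneracy of the hypergraph of edges with uncovered key: its d-core inside
  \<open>W\<close>, in the sense of \<open>is_core\<close>, is empty.\<close>

definition sparse :: "'v set \<Rightarrow> nat \<Rightarrow> 'v set \<Rightarrow> bool" where
  "sparse W d S = (\<forall>A\<subseteq>W. A \<noteq> {} \<longrightarrow> (\<exists>v\<in>A. deg S A v < d))"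

definition is_core :: "nat \<Rightarrow> 'v set \<Rightarrow> 'v set \<Rightarrow> 'v set \<Rightarrow> bool" where
  "is_core d S W C \<longleftrightarrow> C \<subseteq> W \<and> (\<forall>v\<in>C. d \<le> deg S C v) \<and>
     (\<forall>A\<subseteq>W. (\<forall>v\<in>A. d \<le> deg S A v) \<longrightarrow> A \<subseteq> C)"

definition grp :: "'g \<Rightarrow> 'v set" where
  "grp g = {v \<in> V. gr v = g}"

lemma finite_edges [simp]: "finite (edges S A)"
  using finite_E by (simp add: edges_def)

lemma finite_uncov [simp]: "finite (uncov S)"
  using finite_E by (simp add: uncov_def)

lemma cov_mono: "S \<subseteq> S' \<Longrightarrow> cov S \<subseteq> cov S'"
  by (auto simp: cov_def)

lemma deg_mono: "A \<subseteq> A' \<Longrightarrow> S' \<subseteq> S \<Longrightarrow> deg S A v \<le> deg S' A' v"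
  unfolding deg_def using cov_mono[of S' S]
  by (intro card_mono) (auto simp: edges_def intro: finite_subset[OF _ finite_E])

text \<open>Covering more keys only deletes edges. Groups treated earlier in a round therefore stay
  sparse while later ones are treated.\<close>

lemma sparse_mono: "sparse W d S \<Longrightarrow> S \<subseteq> S' \<Longrightarrow> sparse W d S'"
  unfolding sparse_def using deg_mono[OF order_refl] by (meson le_less_trans)

lemma sparse_card:
  assumes "card E \<le> d" shows "sparse W (Suc d) S"
proof -
  have "deg S A v \<le> card E" for A v
    unfolding deg_def by (intro card_mono finite_E) (auto simp: edges_def)
  then have "deg S A v < Suc d" for A v
    using assms by (meson le_imp_less_Suc le_trans)
  then show ?thesis unfolding sparse_def by blast
qed

text \<open>A set \<open>A\<close> of minimum degree \<open>d\<close> after adding \<open>C\<close>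
  had it before, so \<open>A\<close> lies in \<open>C\<close> by maximality. But then
  \<open>C\<close> covers the key of every edge inside \<open>A\<close>, and all degrees are
  0.\<close>

lemma sparse_after_core:
  assumes "is_core d S W C" "1 \<le> d"
  shows "sparse W d (S \<union> C)"
  unfolding sparse_def
proof (intro allI impI, rule ccontr)
  fix A assume A: "A \<subseteq> W" "A \<noteq> {}" "\<not> (\<exists>v\<in>A. deg (S \<union> C) A v < d)"
  then have deg: "d \<le> deg (S \<union> C) A v" if "v \<in> A" for v using that by force
  then have "d \<le> deg S A v" if "v \<in> A" for v
    using deg_mono[OF order_refl, of S "S \<union> C" A v] that by force
  then have "A \<subseteq> C" using assms A(1) unfolding is_core_def by blast
  then have "edges (S \<union> C) A = {}" by (auto simp: edges_def cov_def)
  then have "deg (S \<union> C) A v = 0" for v by (simp add: deg_def)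
  then show False using A(2) deg assms(2) by fastforce
qed

text \<open>All edges through a vertex stay in its group, so restricting a set to that group does
  not change the degree of the vertex.\<close>

lemma sparse_groups:
  assumes "\<And>v. v \<in> V \<Longrightarrow> sparse (grp (gr v)) d S"
  shows "sparse V d S"
  unfolding sparse_def
proof (intro allI impI)
  fix A assume A: "A \<subseteq> V" "A \<noteq> {}"
  then obtain w where w: "w \<in> A" by blast
  define A' where "A' = A \<inter> grp (gr w)"
  have "w \<in> A'" using A w by (auto simp: A'_def grp_def)
  then obtain v where v: "v \<in> A'" "deg S A' v < d"
    using assms[of w] A w unfolding sparse_def A'_def by blast
  have "{e \<in> edges S A. v \<in> F e} = {e \<in> edges S A'. v \<in> F e}"
  proof (intro Collect_cong iffI)
    fix e assume "e \<in> edges S A \<and> v \<in> F e"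
    then have e: "e \<in> edges S A" "v \<in> F e" by auto
    have "x \<in> A'" if "x \<in> F e" for x
      using gr_eq[of e v x] F_subset[of e] v(1) e that by (auto simp: edges_def A'_def grp_def)
    then show "e \<in> edges S A' \<and> v \<in> F e" using e by (auto simp: edges_def)
  qed (auto simp: edges_def A'_def)
  then have "deg S A v = deg S A' v" by (simp add: deg_def)
  then show "\<exists>v\<in>A. deg S A v < d" using v unfolding A'_def by force
qed

text \<open>Vertices of degree at most \<open>d\<close> are removed one at a time; each removal
  destroys at most \<open>d\<close> edges, and sparseness provides the next such vertex.\<close>

lemma card_edges_le:
  assumes "sparse V (Suc d) S" "A \<subseteq> V"
  shows "card (edges S A) \<le> d * card A"
  using finite_subset[OF assms(2) finite_V] assms(2)
proof (induction A rule: finite_remove_induct)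
  case empty
  have "edges S {} = {}" using F_nonempty by (auto simp: edges_def)
  then show ?case by simp
next
  case (remove A)
  obtain v where v: "v \<in> A" "deg S A v \<le> d"
  proof -
    have "\<exists>v\<in>A. deg S A v < Suc d" using assms(1) remove.prems remove.hyps(2) unfolding sparse_def by simp
    then show ?thesis using that by (auto simp: less_Suc_eq_le)
  qed
  have "edges S A \<subseteq> edges S (A - {v}) \<union> {e \<in> edges S A. v \<in> F e}" by (auto simp: edges_def)
  then have "card (edges S A) \<le> card (edges S (A - {v}) \<union> {e \<in> edges S A. v \<in> F e})"
    by (rule card_mono[rotated]) simp
  also have "\<dots> \<le> card (edges S (A - {v})) + deg S A v"
    unfolding deg_def by (rule card_Un_le)
  also have "card (edges S (A - {v})) \<le> d * card (A - {v})"
    using remove v by auto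
  also have "d * card (A - {v}) + deg S A v \<le> d * card A"
    using v remove(1) by (cases "card A") (auto simp: card_Diff_singleton)
  finally show ?case by simp
qed

text \<open>A solution \<open>A\<close> contains an edge for every key, in particular for each
  uncovered one, so the edge count bounds the uncovered keys. This is the only place where the
  optimum enters.\<close>

lemma card_uncov_le:
  assumes "sparse V (Suc d) S" "A \<subseteq> V" "cov A = key ` E"
  shows "card (uncov S) \<le> d * card A"
proof -
  have "uncov S \<subseteq> key ` edges S A"
  proof
    fix k assume k: "k \<in> uncov S"
    then have "k \<in> cov A" using assms(3) by (auto simp: uncov_def)
    then show "k \<in> key ` edges S A" using k by (auto simp: cov_def[of A] uncov_def edges_def)
  qed
  then have "card (uncov S) \<le> card (edges S A)"
    by (meson card_image_le card_mono finite_edges finite_imageI le_trans)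
  then show ?thesis using card_edges_le[OF assms(1,2)] by linarith
qed

text \<open>Double counting of incidences; an edge is counted once for each of its at most
  \<open>p\<close> vertices.\<close>

lemma sum_deg_le:
  assumes "A \<subseteq> V" shows "(\<Sum>v\<in>A. deg S A v) \<le> p * card (edges S A)"
proof -
  have fin: "finite A" using assms finite_V finite_subset by blast
  have "(\<Sum>v\<in>A. deg S A v) = (\<Sum>v\<in>A. \<Sum>e\<in>edges S A. if v \<in> F e then 1 else 0)"
    unfolding deg_def by (intro sum.cong refl) (subst card_eq_sum, rule sum.inter_filter, simp)
  also have "\<dots> = (\<Sum>e\<in>edges S A. \<Sum>v\<in>A. if v \<in> F e then 1 else 0)"
    by (rule sum.swap)
  also have "\<dots> \<le> (\<Sum>e\<in>edges S A. p)"
  proof (rule sum_mono)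
    fix e assume "e \<in> edges S A"
    then have e: "e \<in> E" "F e \<subseteq> A" by (auto simp: edges_def)
    have "(\<Sum>v\<in>A. if v \<in> F e then 1 else 0) = card {v \<in> A. v \<in> F e}"
      by (subst card_eq_sum, rule sum.inter_filter[symmetric], rule fin)
    also have "{v \<in> A. v \<in> F e} = F e" using e(2) by blast
    also have "card (F e) \<le> p" by (rule card_F[OF e(1)])
    finally show "(\<Sum>v\<in>A. if v \<in> F e then 1 else 0) \<le> p" .
  qed
  finally show ?thesis by (simp add: mult.commute)
qed

text \<open>Within one group distinct edges have distinct keys, so a core pays for as many keys as it has edges.\<close>

lemma core_cost:
  assumes "is_core d S (grp g) C"
  shows "d * card C + p * card (uncov (S \<union> C)) \<le> p * card (uncov S)"
proof -
  have C: "C \<subseteq> V" "\<And>v. v \<in> C \<Longrightarrow> gr v = g" using assms by (auto simp: is_core_def grp_def)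
  have "d * card C \<le> (\<Sum>v\<in>C. deg S C v)"
    using assms sum_mono[of C "\<lambda>_. d" "deg S C"] by (auto simp: is_core_def mult.commute)
  also have "\<dots> \<le> p * card (edges S C)" by (rule sum_deg_le[OF C(1)])
  also have "card (edges S C) = card (key ` edges S C)"
  proof (rule card_image[symmetric], rule inj_onI)
    fix e e' assume e: "e \<in> edges S C" "e' \<in> edges S C" "key e = key e'"
    then obtain v v' where "v \<in> F e" "v' \<in> F e'" using F_nonempty unfolding edges_def by blast
    then show "e = e'" using e C key_inj[of e e' v v'] unfolding edges_def by (metis (mono_tags, lifting) mem_Collect_eq subsetD)
  qed
  finally have *: "d * card C \<le> p * card (key ` edges S C)" .
  have "key ` edges S C \<inter> uncov (S \<union> C) = {}"
    by (auto simp: edges_def uncov_def cov_def)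
  then have "card (key ` edges S C) + card (uncov (S \<union> C)) = card (key ` edges S C \<union> uncov (S \<union> C))"
    by (simp add: card_Un_disjoint)
  also have "\<dots> \<le> card (uncov S)"
    using cov_mono[of S "S \<union> C"] by (intro card_mono) (auto simp: edges_def uncov_def finite_E)
  finally have "p * card (key ` edges S C) + p * card (uncov (S \<union> C)) \<le> p * card (uncov S)"
    unfolding distrib_left[symmetric] by (rule mult_le_mono2)
  then show ?thesis using * by linarith
qed

text \<open>Here \<open>d\<close> is the threshold still to be used: cores for larger thresholds are
  empty. The difference of harmonic numbers is the potential spent so far, and the bound is kept for
  all solutions \<open>A\<close> at once, since the optimal one is unknown to the algorithm.\<close>

definition greedy_inv :: "nat \<Rightarrow> 'v set \<Rightarrow> bool" where
  "greedy_inv d S \<longleftrightarrow> S \<subseteq> V \<and> sparse V (Suc d) S \<and>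
     (\<forall>A\<subseteq>V. cov A = key ` E \<longrightarrow>
        real (card S) \<le> real p * real (card A) * (harmonic (card (key ` E)) - harmonic (card (uncov S))))"

lemma greedy_inv_init:
  assumes "card E \<le> d" shows "greedy_inv d {}"
proof -
  have "uncov {} = key ` E" using F_nonempty by (auto simp: uncov_def cov_def)
  then show ?thesis by (simp add: greedy_inv_def sparse_card[OF assms])
qed

text \<open>With \<open>u\<close> and \<open>u'\<close> uncovered keys before and after,
  \<open>d * card C\<close> is at most \<open>p * (u - u')\<close> and \<open>u\<close> is at most
  \<open>d * card A\<close>. Together, \<open>card C\<close> is at most
  \<open>p * card A * (u - u') / u\<close>, which the drop of the harmonic numbers pays for.\<close>

lemma greedy_inv_step:
  assumes inv: "greedy_inv d S" and "1 \<le> d" and core: "is_core d S (grp g) C"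
  shows "greedy_inv d (S \<union> C)"
  unfolding greedy_inv_def
proof (intro conjI allI impI)
  show "S \<union> C \<subseteq> V" using inv core by (auto simp: greedy_inv_def is_core_def grp_def)
  show "sparse V (Suc d) (S \<union> C)" using inv sparse_mono by (auto simp: greedy_inv_def)
  fix A assume A: "A \<subseteq> V" "cov A = key ` E"
  let ?u = "card (uncov S)" and ?u' = "card (uncov (S \<union> C))"
  have cost: "d * card C + p * ?u' \<le> p * ?u" by (rule core_cost[OF core])
  have u: "?u \<le> d * card A" using inv A card_uncov_le by (auto simp: greedy_inv_def)
  have u': "?u' \<le> ?u"
    using cov_mono[of S "S \<union> C"] by (intro card_mono) (auto simp: uncov_def finite_E)
  have "real (card C) \<le> real p * real (card A) * ((real ?u - real ?u') / real ?u)"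
  proof (cases "?u = 0")
    case True
    then have "card C = 0" using cost \<open>1 \<le> d\<close> by simp
    then show ?thesis using True by simp
  next
    case False
    have c: "real d * real (card C) \<le> real p * (real ?u - real ?u')"
      using of_nat_mono[OF cost, where 'a=real] by (simp add: algebra_simps)
    have u2: "real ?u \<le> real d * real (card A)"
      using of_nat_mono[OF u, where 'a=real] by simp
    \<comment> \<open>Multiplying the two estimates instead of dividing them leaves the positive
      factor \<open>d\<close> on both sides, where it cancels.\<close>
    have "(real d * real (card C)) * real ?u \<le> (real p * (real ?u - real ?u')) * (real d * real (card A))"
      by (rule mult_mono[OF c u2]) (use u' in auto)
    then have "real d * (real (card C) * real ?u) \<le> real d * (real p * real (card A) * (real ?u - real ?u'))"
      by (simp add: ac_simps)
    then have "real (card C) * real ?u \<le> real p * real (card A) * (real ?u - real ?u')"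
      using \<open>1 \<le> d\<close> by (simp add: mult_le_cancel_left_pos)
    then show ?thesis
      using False unfolding times_divide_eq_right by (subst pos_le_divide_eq) auto
  qed
  also have "\<dots> \<le> real p * real (card A) * (harmonic ?u - harmonic ?u')"
    by (intro mult_left_mono harmonic_diff_ge u') auto
  finally have "real (card S) + real (card C) \<le>
      real p * real (card A) * (harmonic (card (key ` E)) - harmonic ?u) + real p * real (card A) * (harmonic ?u - harmonic ?u')"
    using inv A by (intro add_mono) (auto simp: greedy_inv_def)
  also have "\<dots> = real p * real (card A) * (harmonic (card (key ` E)) - harmonic ?u')"
    by (simp add: algebra_simps)
  finally show "real (card (S \<union> C)) \<le> real p * real (card A) * (harmonic (card (key ` E)) - harmonic ?u')"
    using card_Un_le[of S C] by linarith
qed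

text \<open>At threshold 0 the bound on the number of uncovered keys reads
  \<open>0 * card V\<close>, with \<open>V\<close> itself taken as the solution.\<close>

lemma greedy_inv_final:
  assumes "greedy_inv 0 S"
  shows "cov S = key ` E"
    and "A \<subseteq> V \<Longrightarrow> cov A = key ` E \<Longrightarrow> real (card S) \<le> real p * real (card A) * harmonic (card (key ` E))"
proof -
  have "cov V = key ` E" using F_subset by (auto simp: cov_def)
  then have "card (uncov S) = 0"
    using card_uncov_le[of 0 S V] assms by (auto simp: greedy_inv_def)
  then have un: "uncov S = {}" by simp
  then show "cov S = key ` E" by (auto simp: uncov_def cov_def)
  show "real (card S) \<le> real p * real (card A) * harmonic (card (key ` E))"
    if "A \<subseteq> V" "cov A = key ` E"
    using assms that un by (auto simp: greedy_inv_def harmonic_def)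
qed

section \<open>Computing cores by repeated passes\<close>

definition peel :: "nat \<Rightarrow> 'v set \<Rightarrow> 'v \<Rightarrow> 'v set \<Rightarrow> 'v set" where
  "peel d S v A = (if v \<in> A \<and> deg S A v < d then A - {v} else A)"

lemma peel_subset: "peel d S v A \<subseteq> A"
  by (auto simp: peel_def)

lemma fold_peel_subset: "fold (peel d S) vs A \<subseteq> A"
  using peel_subset by (induction vs arbitrary: A) (auto, blast)

text \<open>In a pass that changes nothing overall, no intermediate step changes anything either, so
  each degree was tested with respect to \<open>A\<close> itself.\<close>

lemma fold_peel_fixed:
  assumes "fold (peel d S) vs A = A" "v \<in> set vs" "v \<in> A"
  shows "d \<le> deg S A v"
  using assms
proof (induction vs)
  case (Cons w vs)
  have "A \<subseteq> peel d S w A"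
    using fold_peel_subset[of d S vs "peel d S w A"] Cons.prems(1) by simp
  then have "peel d S w A = A" using peel_subset by blast
  then show ?case using Cons by (auto simp: peel_def split: if_splits)
qed simp

text \<open>Degrees in a superset of \<open>B\<close> are at least those in \<open>B\<close>, so a
  vertex of \<open>B\<close> never falls below \<open>d\<close> as long as all of \<open>B\<close>
  is present.\<close>

lemma fold_peel_core:
  assumes "B \<subseteq> A" "\<forall>v\<in>B. d \<le> deg S B v"
  shows "B \<subseteq> fold (peel d S) vs A"
  using assms(1)
proof (induction vs arbitrary: A)
  case (Cons w vs)
  have "B \<subseteq> peel d S w A"
    using Cons.prems assms(2) deg_mono[OF Cons.prems order_refl, of S w] by (fastforce simp: peel_def)
  then show ?case using Cons.IH by simp
qed simp

text \<open>A pass that changes the set removes a vertex. After \<open>k\<close> passes, a set that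
  still changes would have lost all of its at most \<open>k\<close> vertices, but the empty set is
  stable.\<close>

lemma is_core_peel:
  assumes "finite W" "W \<subseteq> set vs" "card W \<le> k"
  shows "is_core d S W ((fold (peel d S) vs ^^ k) W)"
proof -
  let ?f = "fold (peel d S) vs"
  have sub: "(?f ^^ i) W \<subseteq> W" for i
    by (induction i) (use fold_peel_subset in auto, blast)
  have fixed: "?f ((?f ^^ i) W) = (?f ^^ i) W \<or> card ((?f ^^ i) W) + i \<le> card W" for i
  proof (induction i)
    case (Suc i)
    show ?case
    proof (cases "?f ((?f ^^ i) W) = (?f ^^ i) W")
      case False
      then have "?f ((?f ^^ i) W) \<subset> (?f ^^ i) W" using fold_peel_subset by blast
      then have "card (?f ((?f ^^ i) W)) < card ((?f ^^ i) W)"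
        using psubset_card_mono finite_subset[OF sub assms(1)] by blast
      then show ?thesis using False Suc.IH by auto
    qed simp
  qed simp
  have fix_k: "?f ((?f ^^ k) W) = (?f ^^ k) W"
  proof (rule ccontr)
    assume *: "\<not> ?thesis"
    then have "card ((?f ^^ k) W) = 0" using fixed[of k] assms(3) by simp
    then have "(?f ^^ k) W = {}" using finite_subset[OF sub assms(1)] by auto
    then show False using * fold_peel_subset[of d S vs "{}"] by auto
  qed
  have "B \<subseteq> (?f ^^ i) W" if "B \<subseteq> W" "\<forall>v\<in>B. d \<le> deg S B v" for B i
    by (induction i) (use that fold_peel_core[of B] in auto)
  moreover have "d \<le> deg S ((?f ^^ k) W) v" if "v \<in> (?f ^^ k) W" for v
    by (rule fold_peel_fixed[OF fix_k _ that]) (use sub[of k] assms(2) that in blast)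
  ultimately show ?thesis unfolding is_core_def using sub[of k] by simp
qed

end

section \<open>The query as a program\<close>

text \<open>Truncated subtraction from 1 turns any number into the truth value 0 or 1 of its
  negation; conjunction follows by De Morgan, and equality says that both truncated differences
  vanish.\<close>

definition Nt :: "exp \<Rightarrow> exp" where "Nt e = Mns (Cst 1) e"
definition And :: "exp \<Rightarrow> exp \<Rightarrow> exp" where "And e f = Nt (Pls (Nt e) (Nt f))"
definition Eq :: "exp \<Rightarrow> exp \<Rightarrow> exp" where "Eq e f = Nt (Pls (Mns e f) (Mns f e))"
definition Ands :: "exp list \<Rightarrow> exp" where "Ands es = foldr And es (Cst 1)"
definition Plss :: "exp list \<Rightarrow> exp" where "Plss es = foldr Pls es (Cst 0)"
definition Dbls :: "nat \<Rightarrow> exp \<Rightarrow> exp" where "Dbls k e = (Dbl ^^ k) e"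
definition Seqs :: "com list \<Rightarrow> com" where "Seqs cs = foldr Seq cs Skip"

fun Sgms :: "nat \<Rightarrow> nat \<Rightarrow> exp \<Rightarrow> exp" where
  "Sgms b 0 e = e"
| "Sgms b (Suc k) e = Sgm b (Sgms (Suc b) k e)"

fun Fors :: "nat \<Rightarrow> nat \<Rightarrow> com \<Rightarrow> com" where
  "Fors b 0 c = c"
| "Fors b (Suc k) c = For b (Fors (Suc b) k c)"

lemma eval_Nt [simp]: "eval N L env h (Nt e) = of_bool (eval N L env h e = 0)"
  by (simp add: Nt_def)

lemma eval_And [simp]:
  "eval N L env h (And e f) = of_bool (eval N L env h e \<noteq> 0 \<and> eval N L env h f \<noteq> 0)"
  by (simp add: And_def)

lemma eval_Eq [simp]: "eval N L env h (Eq e f) = of_bool (eval N L env h e = eval N L env h f)"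
  by (auto simp: Eq_def)

lemma eval_Ands [simp]: "eval N L env h (Ands es) = of_bool (\<forall>e\<in>set es. eval N L env h e \<noteq> 0)"
  by (induction es) (auto simp: Ands_def)

lemma eval_Plss [simp]: "eval N L env h (Plss es) = (\<Sum>e\<leftarrow>es. eval N L env h e)"
  by (induction es) (auto simp: Plss_def)

lemma eval_Dbls [simp]: "eval N L env h (Dbls k e) = 2 ^ k * eval N L env h e"
  by (induction k) (auto simp: Dbls_def)

definition updl :: "(nat \<Rightarrow> nat) \<Rightarrow> nat \<Rightarrow> nat list \<Rightarrow> nat \<Rightarrow> nat" where
  "updl env b xs r = (if b \<le> r \<and> r < b + length xs then xs ! (r - b) else env r)"

definition tuples :: "nat \<Rightarrow> nat \<Rightarrow> nat list set" where
  "tuples N k = {xs. length xs = k \<and> set xs \<subseteq> {..<N}}"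

lemma finite_tuples [simp]: "finite (tuples N k)"
  using finite_lists_length_eq[of "{..<N}" k] by (simp add: tuples_def conj_commute)

lemma card_tuples: "card (tuples N k) = N ^ k"
  using card_lists_length_eq[of "{..<N}" k] by (simp add: tuples_def conj_commute)

lemma tuples_0 [simp]: "tuples N 0 = {[]}"
  by (auto simp: tuples_def)

lemma tuples_nth: "xs \<in> tuples N k \<Longrightarrow> i < k \<Longrightarrow> xs ! i < N"
  using nth_mem[of i xs] by (auto simp: tuples_def simp del: nth_mem)

lemma sum_tuples_Suc: "(\<Sum>xs\<in>tuples N (Suc k). f xs) = (\<Sum>i<N. \<Sum>xs\<in>tuples N k. f (i # xs))"
proof -
  have "tuples N (Suc k) = (\<lambda>(i, xs). i # xs) ` ({..<N} \<times> tuples N k)"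
    by (auto simp: tuples_def length_Suc_conv image_iff)
  then have "(\<Sum>xs\<in>tuples N (Suc k). f xs) = (\<Sum>(i, xs)\<in>{..<N} \<times> tuples N k. f (i # xs))"
    by (simp add: sum.reindex inj_on_def case_prod_unfold)
  then show ?thesis by (simp add: sum.cartesian_product)
qed

lemma eval_Sgms [simp]:
  "eval N L env h (Sgms b k e) = (\<Sum>xs\<in>tuples N k. eval N L (updl env b xs) h e)"
proof (induction k arbitrary: b env)
  case 0
  have "updl env b [] = env" by (auto simp: updl_def)
  then show ?case by simp
next
  case (Suc k)
  have "updl (env(b := i)) (Suc b) xs = updl env b (i # xs)" for i xs
    by (auto simp: updl_def fun_eq_iff nth_Cons' Suc_diff_Suc)
  then show ?case by (simp only: Sgms.simps eval.simps Suc.IH sum_tuples_Suc)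
qed

lemma fold_upt_induct:
  assumes "P 0 h" "\<And>i h. i < N \<Longrightarrow> P i h \<Longrightarrow> P (Suc i) (f i h)"
  shows "P N (fold f [0..<N] h)"
proof -
  have "i \<le> N \<Longrightarrow> P i (fold f [0..<i] h)" for i
    by (induction i) (use assms in auto)
  then show ?thesis by simp
qed

text \<open>Nested loops act as one loop of \<open>N ^ k\<close> rounds as soon as the body works in
  every environment. The offset \<open>i0\<close> lets an inner nest resume the count of the outer
  loop.\<close>

lemma exec_Fors_induct:
  assumes step: "\<And>i h env. i < i0 + N ^ k \<Longrightarrow> P i h \<Longrightarrow> P (Suc i) (exec N L env c h)" and "P i0 h"
  shows "P (i0 + N ^ k) (exec N L env (Fors b k c) h)"
  using assms
proof (induction k arbitrary: i0 h env b)
  case 0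
  then show ?case by simp
next
  case (Suc k)
  have "P (i0 + N * N ^ k) (exec N L env (Fors b (Suc k) c) h)"
    unfolding Fors.simps exec.simps
  proof (rule fold_upt_induct[where P = "\<lambda>j h. P (i0 + j * N ^ k) h"])
    fix j h assume j: "j < N" and P: "P (i0 + j * N ^ k) h"
    have "Suc j * N ^ k \<le> N * N ^ k" using j by (intro mult_le_mono1) simp
    then have "P (i0 + j * N ^ k + N ^ k) (exec N L (env(b := j)) (Fors (Suc b) k c) h)"
      by (intro Suc.IH Suc.prems(1) P) auto
    then show "P (i0 + Suc j * N ^ k) (exec N L (env(b := j)) (Fors (Suc b) k c) h)"
      by (simp add: ac_simps)
  qed (use Suc.prems in simp)
  then show ?case by simp
qed

text \<open>The written expression may read other arrays and the old value at its own index, but not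
  other cells of \<open>a\<close>; this makes the order of the writes irrelevant.\<close>

lemma exec_For_Wr:
  assumes "a \<noteq> Raw"
    and "\<And>j h'. j < N \<Longrightarrow> (\<And>b. b \<noteq> a \<Longrightarrow> h' b = h b) \<Longrightarrow> h' a j = h a j \<Longrightarrow>
           eval N L (env(r := j)) h' e = v j"
  shows "exec N L env (For r (Wr a (Var r) e)) h = h(a := (\<lambda>j. if j < N then v j else h a j))"
proof -
  have "fold (\<lambda>i. exec N L (env(r := i)) (Wr a (Var r) e)) [0..<N] h = h(a := (\<lambda>j. if j < N then v j else h a j))"
  proof (rule fold_upt_induct[where P = "\<lambda>i h'. h' = h(a := (\<lambda>j. if j < i then v j else h a j))"])
    fix i h' assume i: "i < N" and h': "h' = h(a := (\<lambda>j. if j < i then v j else h a j))"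
    have "eval N L (env(r := i)) h' e = v i" by (rule assms(2)[OF i]) (auto simp: h')
    then show "exec N L (env(r := i)) (Wr a (Var r) e) h' = h(a := (\<lambda>j. if j < Suc i then v j else h a j))"
      using assms(1) by (auto simp: h' clip_def fun_eq_iff less_Suc_eq)
  qed auto
  then show ?thesis by simp
qed

text \<open>x is the attribute outside the head hs.  Attribute a occurs in atom oi a at position op a, and
  px i is the position of x in atom i.\<close>

locale query =
  fixes atoms :: "nat list list" and hs :: "nat list" and x :: nat
    and oi op px :: "nat \<Rightarrow> nat"
  assumes occ: "a \<in> qattrs atoms \<Longrightarrow> oi a < length atoms \<and> op a < length (atoms ! oi a) \<and> atoms ! oi a ! op a = a"
    and px: "i < length atoms \<Longrightarrow> x \<in> set (atoms ! i) \<Longrightarrow> px i < length (atoms ! i) \<and> atoms ! i ! px i = x"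
    and hs: "set hs = qattrs atoms - {x}" and x: "x \<in> qattrs atoms"
begin

abbreviation "m \<equiv> length atoms"

definition "xatoms = filter (\<lambda>i. x \<in> set (atoms ! i)) [0..<m]"
definition "yatoms = filter (\<lambda>i. x \<notin> set (atoms ! i)) [0..<m]"

definition "size_e = Rd Nf (Cst 0)"
definition "fact_is i v = And (Mns size_e (Var v)) (Eq (Rd Inp (Rd Ptr (Var v))) (Cst i))"
definition "field v p = Rd Inp (Pls (Rd Ptr (Var v)) (Cst (Suc p)))"

text \<open>Each field is compared only with the chosen occurrence of its attribute, given by
  \<open>oi\<close> and \<open>op\<close>; agreement of any two occurrences follows.\<close>

definition "is_join b = And (Ands (map (\<lambda>i. fact_is i (b + i)) [0..<m]))
  (Ands (concat (map (\<lambda>i. map (\<lambda>p. Eq (field (b + i) p) (field (b + oi (atoms ! i ! p)) (op (atoms ! i ! p))))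
     [0..<length (atoms ! i)]) [0..<m])))"

definition "same_head b b' = Ands (map (\<lambda>a. Eq (field (b + oi a) (op a)) (field (b' + oi a) (op a))) hs)"

definition "covered b b' = Sgms b' m
  (And (And (is_join b') (same_head b b')) (Ands (map (\<lambda>i. Rd Sel (Var (b' + i))) xatoms)))"

definition "uses b A j = Plss (map (\<lambda>i. Eq (Var (b + i)) (Var j)) A)"

text \<open>Variables below \<open>m\<close> range over the counted joins and the next
  \<open>m\<close> over the join that witnesses coverage; loops use variables from
  \<open>2 * m\<close> on.\<close>

definition "degree j = Sgms 0 m (And (And (is_join 0) (Ands (map (\<lambda>i. Rd Alive (Var i)) xatoms)))
  (And (Nt (covered 0 m)) (uses 0 xatoms j)))"

definition "same_group j k = Plss (concat (map (\<lambda>i. map (\<lambda>i'.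
  And (And (fact_is i j) (fact_is i' k)) (Eq (field j (px i)) (field k (px i')))) xatoms) xatoms))"

abbreviation "vj \<equiv> 2 * m"
abbreviation "vk \<equiv> 2 * m + 1"
abbreviation "vi \<equiv> 2 * m + 2"

text \<open>The pass works in place: a vertex sees the deletions made earlier in the same pass, as
  in a fold of \<open>peel\<close>.\<close>

definition "peel_com = For vj (Wr Alive (Var vj) (And (Rd Alive (Var vj)) (Nt (Mns (Rd Thr (Cst 0)) (degree vj)))))"

text \<open>Values of x are arbitrary numbers that no loop can enumerate, so a group is addressed
  through a member fact in \<open>vk\<close>. Treating a group several times in a round is harmless,
  and an index that is no fact with x gives the empty set.\<close>

definition "group_com = Seq (For vj (Wr Alive (Var vj) (Nt (Nt (same_group vj vk)))))
  (Seq (For vi peel_com) (For vj (Wr Sel (Var vj) (Pls (Rd Sel (Var vj)) (Rd Alive (Var vj))))))"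

definition "round_com = Seq (For vk group_com) (Wr Thr (Cst 0) (Mns (Rd Thr (Cst 0)) (Cst 1)))"

text \<open>The first threshold is \<open>N ^ m\<close>, an upper bound for the number of joins,
  obtained by summing 1 over all m-tuples. The number of rounds is the same, so the threshold
  reaches 0 exactly at the end. The last loop adds the forced facts.\<close>

definition "greedy_com = Seq (For vj (Wr Sel (Var vj) (Cst 0)))
  (Seq (Wr Thr (Cst 0) (Sgms 0 m (Cst 1)))
  (Seq (Fors (2 * m + 3) m round_com)
    (For vj (Wr Sel (Var vj) (Pls (Rd Sel (Var vj)) (Sgms 0 m (And (is_join 0) (uses 0 yatoms vj))))))))"

lemma set_xatoms [simp]: "set xatoms = {i. i < m \<and> x \<in> set (atoms ! i)}"
  by (auto simp: xatoms_def)

lemma set_yatoms [simp]: "set yatoms = {i. i < m \<and> x \<notin> set (atoms ! i)}"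
  by (auto simp: yatoms_def)

lemma in_qattrs: "i < m \<Longrightarrow> a \<in> set (atoms ! i) \<Longrightarrow> a \<in> qattrs atoms"
  by (auto simp: qattrs_def intro!: bexI[of _ "atoms ! i"])

lemma nth_in_qattrs [simp]: "i < m \<Longrightarrow> p < length (atoms ! i) \<Longrightarrow> atoms ! i ! p \<in> qattrs atoms"
  by (auto simp: qattrs_def intro!: bexI[of _ "atoms ! i"])

end

locale database = query +
  fixes fs :: "fact list" and N L :: nat
  assumes wf: "wf_db atoms (set fs)" and dist: "distinct fs" and size_le: "length fs \<le> N"
begin

abbreviation "n \<equiv> length fs"

definition "val bs a = snd (fs ! (bs ! oi a)) ! op a"

text \<open>A join is represented by the list of the indices in fs of its facts, one for each atom.\<close>

definition "joins = {bs. length bs = m \<and> (\<forall>i<m. bs ! i < n \<and> fs ! (bs ! i) = (i, map (val bs) (atoms ! i)))}"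

definition "xfacts = {j. j < n \<and> x \<in> set (atoms ! fst (fs ! j))}"

definition "xpart bs = {bs ! i | i. i < m \<and> x \<in> set (atoms ! i)}"

definition "hkey bs = (\<lambda>a. if a \<in> set hs then Some (val bs a) else None)"

definition "xval j = snd (fs ! j) ! px (fst (fs ! j))"

lemma xpart_iff: "v \<in> xpart bs \<longleftrightarrow> (\<exists>i\<in>set xatoms. bs ! i = v)"
  by (auto simp: xpart_def)

lemma wf_nth: "j < n \<Longrightarrow> fst (fs ! j) < m \<and> length (snd (fs ! j)) = length (atoms ! fst (fs ! j))"
  using wf nth_mem[of j fs] by (auto simp: wf_db_def wf_fact_def)

lemma joinsD:
  assumes "bs \<in> joins" "i < m"
  shows "bs ! i < n" "fs ! (bs ! i) = (i, map (val bs) (atoms ! i))"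
  using assms by (auto simp: joins_def)

lemma joins_subset: "joins \<subseteq> tuples n m" "joins \<subseteq> tuples N m"
  using size_le by (fastforce simp: joins_def tuples_def in_set_conv_nth)+

lemma val_unique:
  assumes "\<And>i. i < m \<Longrightarrow> fs ! (bs ! i) = (i, map f (atoms ! i))" "a \<in> qattrs atoms"
  shows "val bs a = f a"
  using occ[OF assms(2)] assms(1)[of "oi a"] by (simp add: val_def)

lemma qattrs_eq: "qattrs atoms = insert x (set hs)"
  using hs x by auto

text \<open>For \<open>key_inj\<close>: equal head values and equal x-values give equal values of
  all attributes, hence equal facts in every atom, and distinctness of \<open>fs\<close> makes their
  indices equal.\<close>

sublocale H: keyed_hypergraph xfacts joins xpart hkey xval m
proof
  show "finite xfacts" by (simp add: xfacts_def)
  show "finite joins" using joins_subset(1) finite_tuples finite_subset by blast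
next
  fix bs assume bs: "bs \<in> joins"
  show "xpart bs \<subseteq> xfacts" using joinsD[OF bs] by (auto simp: xpart_def xfacts_def)
  from x obtain i where "i < m" "x \<in> set (atoms ! i)" by (metis (no_types, lifting) UN_iff in_set_conv_nth qattrs_def)
  then show "xpart bs \<noteq> {}" by (auto simp: xpart_def)
  have "xpart bs \<subseteq> (\<lambda>i. bs ! i) ` {..<m}" by (auto simp: xpart_def)
  then show "card (xpart bs) \<le> m" by (metis card_image_le card_lessThan card_mono finite_imageI finite_lessThan le_trans)
next
  have xval: "xval v = val bs x" if "bs \<in> joins" "v \<in> xpart bs" for bs v
    using that joinsD[OF that(1)] px by (auto simp: xpart_def xval_def)
  show "xval v = xval w" if "bs \<in> joins" "v \<in> xpart bs" "w \<in> xpart bs" for bs v w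
    using that xval by metis
  fix bs bs' v v'
  assume bs: "bs \<in> joins" "bs' \<in> joins" and key: "hkey bs = hkey bs'"
    and v: "v \<in> xpart bs" "v' \<in> xpart bs'" "xval v = xval v'"
  have "val bs a = val bs' a" if "a \<in> qattrs atoms" for a
  proof (cases "a = x")
    case True
    then show ?thesis using xval v bs by metis
  next
    case False
    then have "a \<in> set hs" using that hs by auto
    then show ?thesis using fun_cong[OF key, of a] by (simp add: hkey_def)
  qed
  then have "map (val bs) (atoms ! i) = map (val bs') (atoms ! i)" if "i < m" for i
    using that in_qattrs by (intro map_cong refl) blast
  then have "bs ! i = bs' ! i" if "i < m" for i
    using that joinsD[OF bs(1) that] joinsD[OF bs(2) that] dist nth_eq_iff_index_eq by metis
  then show "bs = bs'" using bs by (auto simp: joins_def intro: nth_equalityI)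
qed

section \<open>Meaning of the query expressions on a stored database\<close>

definition stored :: "heap \<Rightarrow> bool" where
  "stored h \<longleftrightarrow> h Nf 0 = n \<and> (\<forall>j<n. h Inp (h Ptr j) = fst (fs ! j) \<and>
     (\<forall>p<length (snd (fs ! j)). h Inp (h Ptr j + Suc p) = snd (fs ! j) ! p))"

lemma stored_cong: "stored h \<Longrightarrow> h' Nf = h Nf \<Longrightarrow> h' Inp = h Inp \<Longrightarrow> h' Ptr = h Ptr \<Longrightarrow> stored h'"
  by (simp add: stored_def)

lemma eval_fact_is:
  assumes "stored h"
  shows "eval N L env h (fact_is i v) = of_bool (env v < n \<and> fst (fs ! env v) = i)"
  using assms by (auto simp: fact_is_def size_e_def clip_def stored_def)

lemma eval_field:
  assumes "stored h" "env v < n" "p < length (snd (fs ! env v))"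
  shows "eval N L env h (field v p) = snd (fs ! env v) ! p"
  using assms by (auto simp: field_def clip_def stored_def)

lemma eval_is_join:
  assumes st: "stored h" and bs: "length bs = m" "\<And>i. i < m \<Longrightarrow> env (b + i) = bs ! i"
  shows "eval N L env h (is_join b) = of_bool (bs \<in> joins)"
proof -
  have *: "eval N L env h (is_join b) = of_bool ((\<forall>i<m. bs ! i < n \<and> fst (fs ! (bs ! i)) = i) \<and>
     (\<forall>i<m. \<forall>p<length (atoms ! i). eval N L env h (field (b + i) p) =
        eval N L env h (field (b + oi (atoms ! i ! p)) (op (atoms ! i ! p)))))"
    using bs eval_fact_is[OF st] by (fastforce simp: is_join_def)
  show ?thesis
  \<comment> \<open>Loops run up to \<open>N\<close>, so the variables may exceed the number of
    facts. The fields read then are arbitrary, but the first conjunct already fails.\<close>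
  proof (cases "\<forall>i<m. bs ! i < n \<and> fst (fs ! (bs ! i)) = i")
    case True
    have field: "eval N L env h (field (b + i) p) = snd (fs ! (bs ! i)) ! p" if "i < m" "p < length (atoms ! i)" for i p
      using eval_field[OF st, of env "b + i" p] that True bs(2)[OF that(1)] wf_nth[of "bs ! i"] by auto
    have "eval N L env h (field (b + oi (atoms ! i ! p)) (op (atoms ! i ! p))) = val bs (atoms ! i ! p)"
      if "i < m" "p < length (atoms ! i)" for i p
      using field[of "oi (atoms ! i ! p)" "op (atoms ! i ! p)"] occ[OF nth_in_qattrs[OF that]]
      by (simp add: val_def)
    moreover have "fs ! (bs ! i) = (i, map (val bs) (atoms ! i)) \<longleftrightarrow>
        (\<forall>p<length (atoms ! i). snd (fs ! (bs ! i)) ! p = val bs (atoms ! i ! p))" if "i < m" for i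
      using True wf_nth[of "bs ! i"] that by (auto simp: prod_eq_iff list_eq_iff_nth_eq)
    ultimately show ?thesis unfolding * using True field bs(1) by (auto simp: joins_def)
  next
    case False
    then show ?thesis unfolding * by (auto simp: joins_def)
  qed
qed

lemma eval_same_head:
  assumes st: "stored h" and "bs \<in> joins" "bs' \<in> joins"
    and "\<And>i. i < m \<Longrightarrow> env (b + i) = bs ! i" "\<And>i. i < m \<Longrightarrow> env (b' + i) = bs' ! i"
  shows "eval N L env h (same_head b b') = of_bool (hkey bs = hkey bs')"
proof -
  have *: "eval N L env h (field (c + oi a) (op a)) = val cs a"
    if "a \<in> set hs" "cs \<in> joins" "\<And>i. i < m \<Longrightarrow> env (c + i) = cs ! i" for a c cs
  proof -
    have "a \<in> qattrs atoms" using that qattrs_eq by auto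
    then have o: "oi a < m" "op a < length (atoms ! oi a)" using occ by auto
    have "eval N L env h (field (c + oi a) (op a)) = snd (fs ! env (c + oi a)) ! op a"
      by (rule eval_field[OF st]) (use o joinsD[OF that(2) o(1)] that(3)[OF o(1)] in auto)
    then show ?thesis by (simp only: val_def that(3)[OF o(1)])
  qed
  have "eval N L env h (same_head b b') = of_bool (\<forall>a\<in>set hs. val bs a = val bs' a)"
    using *[of _ bs b] *[of _ bs' b'] assms by (auto simp: same_head_def)
  also have "(\<forall>a\<in>set hs. val bs a = val bs' a) \<longleftrightarrow> hkey bs = hkey bs'"
    by (auto simp: hkey_def fun_eq_iff)
  finally show ?thesis .
qed

lemma sum_of_bool_neq_0: "finite A \<Longrightarrow> (\<Sum>a\<in>A. of_bool (P a)) \<noteq> (0::nat) \<longleftrightarrow> (\<exists>a\<in>A. P a)"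
  by auto

lemma eval_covered:
  assumes st: "stored h" and bs: "bs \<in> joins" "\<And>i. i < m \<Longrightarrow> env (b + i) = bs ! i" and b': "b + m \<le> b'"
    and S: "S = {j. j < N \<and> h Sel j \<noteq> 0}"
  shows "eval N L env h (covered b b') \<noteq> 0 \<longleftrightarrow> hkey bs \<in> H.cov S"
proof -
  have "eval N L (updl env b' bs') h (And (And (is_join b') (same_head b b')) (Ands (map (\<lambda>i. Rd Sel (Var (b' + i))) xatoms)))
      = of_bool (bs' \<in> joins \<and> hkey bs = hkey bs' \<and> xpart bs' \<subseteq> S)" if "bs' \<in> tuples N m" for bs'
  proof -
    have len: "length bs' = m" using that by (simp add: tuples_def)
    have env: "updl env b' bs' (b + i) = bs ! i" "updl env b' bs' (b' + i) = bs' ! i" if "i < m" for i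
      using that bs b' len by (auto simp: updl_def)
    have "\<And>i. i < m \<Longrightarrow> bs' ! i < N" using that by (rule tuples_nth)
    then have "(\<forall>i\<in>set xatoms. h Sel (bs' ! i) \<noteq> 0) \<longleftrightarrow> xpart bs' \<subseteq> S" by (auto simp: xpart_def S)
    moreover have "eval N L (updl env b' bs') h (Ands (map (\<lambda>i. Rd Sel (Var (b' + i))) xatoms)) =
       of_bool (\<forall>i\<in>set xatoms. h Sel (bs' ! i) \<noteq> 0)"
      using env by (auto simp: clip_def)
    ultimately show ?thesis
      using eval_is_join[OF st len, of "updl env b' bs'" b'] eval_same_head[OF st bs(1), of bs' "updl env b' bs'" b b'] env
      by auto
  qed
  then have "eval N L env h (covered b b') = (\<Sum>bs'\<in>tuples N m. of_bool (bs' \<in> joins \<and> hkey bs = hkey bs' \<and> xpart bs' \<subseteq> S))"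
    unfolding covered_def eval_Sgms by (intro sum.cong refl) auto
  then have "eval N L env h (covered b b') \<noteq> 0 \<longleftrightarrow> (\<exists>bs'\<in>tuples N m. bs' \<in> joins \<and> hkey bs = hkey bs' \<and> xpart bs' \<subseteq> S)"
    by (simp only: sum_of_bool_neq_0 finite_tuples)
  then show ?thesis using joins_subset(2) by (auto simp: H.cov_def)
qed

lemma eval_uses:
  "eval N L env h (uses b A j) \<noteq> 0 \<longleftrightarrow> (\<exists>i\<in>set A. env (b + i) = env j)"
  by (auto simp: uses_def)

lemma eval_degree:
  assumes st: "stored h" and j: "m \<le> j"
    and S: "S = {j. j < N \<and> h Sel j \<noteq> 0}" and A: "A = {j. j < N \<and> h Alive j \<noteq> 0}"
  shows "eval N L env h (degree j) = H.deg S A (env j)"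
proof -
  have "eval N L (updl env 0 bs) h (And (And (is_join 0) (Ands (map (\<lambda>i. Rd Alive (Var i)) xatoms)))
      (And (Nt (covered 0 m)) (uses 0 xatoms j))) = of_bool (bs \<in> {e \<in> H.edges S A. env j \<in> xpart e})" (is "?l = _")
    if "bs \<in> tuples N m" for bs
  proof -
    have len: "length bs = m" using that by (simp add: tuples_def)
    have env: "updl env 0 bs i = bs ! i" if "i < m" for i
      using that len by (auto simp: updl_def)
    have envj: "updl env 0 bs j = env j" using len j by (auto simp: updl_def)
    have "\<And>i. i < m \<Longrightarrow> bs ! i < N" using that by (rule tuples_nth)
    then have 1: "(\<forall>i\<in>set xatoms. h Alive (bs ! i) \<noteq> 0) \<longleftrightarrow> xpart bs \<subseteq> A" by (auto simp: xpart_def A)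
    have 2: "eval N L (updl env 0 bs) h (Ands (map (\<lambda>i. Rd Alive (Var i)) xatoms)) =
       of_bool (\<forall>i\<in>set xatoms. h Alive (bs ! i) \<noteq> 0)"
      using env by (auto simp: clip_def)
    have 3: "eval N L (updl env 0 bs) h (is_join 0) = of_bool (bs \<in> joins)"
      by (rule eval_is_join[OF st len]) (simp add: env)
    have 4: "bs \<in> joins \<Longrightarrow> eval N L (updl env 0 bs) h (covered 0 m) \<noteq> 0 \<longleftrightarrow> hkey bs \<in> H.cov S"
      by (rule eval_covered[OF st _ _ _ S]) (simp_all add: env)
    have 5: "eval N L (updl env 0 bs) h (uses 0 xatoms j) \<noteq> 0 \<longleftrightarrow> env j \<in> xpart bs"
      unfolding eval_uses envj xpart_iff using env by auto
    have "?l = of_bool (bs \<in> joins \<and> xpart bs \<subseteq> A \<and> hkey bs \<notin> H.cov S \<and> env j \<in> xpart bs)"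
      using 1 2 3 4 5 by auto
    then show ?thesis by (simp add: H.edges_def)
  qed
  then have "eval N L env h (degree j) = (\<Sum>bs\<in>tuples N m. of_bool (bs \<in> {e \<in> H.edges S A. env j \<in> xpart e}))"
    unfolding degree_def eval_Sgms by (intro sum.cong refl) blast
  also have "\<dots> = card (tuples N m \<inter> {e \<in> H.edges S A. env j \<in> xpart e})"
    by (simp add: sum.If_cases of_bool_def)
  also have "tuples N m \<inter> {e \<in> H.edges S A. env j \<in> xpart e} = {e \<in> H.edges S A. env j \<in> xpart e}"
    using joins_subset(2) by (auto simp: H.edges_def)
  finally show ?thesis by (simp add: H.deg_def)
qed

lemma eval_same_group:
  assumes st: "stored h"
  shows "eval N L env h (same_group j k) \<noteq> 0 \<longleftrightarrow> env j \<in> xfacts \<and> env k \<in> xfacts \<and> xval (env j) = xval (env k)"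
proof -
  have *: "eval N L env h (field v (px (fst (fs ! env v)))) = xval (env v)" if "env v \<in> xfacts" for v
  proof -
    have v: "env v < n" "x \<in> set (atoms ! fst (fs ! env v))" using that by (auto simp: xfacts_def)
    then show ?thesis using eval_field[of h env v, OF st v(1)] wf_nth[OF v(1)] px by (simp add: xval_def)
  qed
  have "eval N L env h (same_group j k) \<noteq> 0 \<longleftrightarrow> (\<exists>i\<in>set xatoms. \<exists>i'\<in>set xatoms.
      env j < n \<and> fst (fs ! env j) = i \<and> env k < n \<and> fst (fs ! env k) = i' \<and>
      eval N L env h (field j (px i)) = eval N L env h (field k (px i')))"
    unfolding same_group_def by (simp add: eval_fact_is[OF st]) blast
  also have "\<dots> \<longleftrightarrow> env j \<in> xfacts \<and> env k \<in> xfacts \<and>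
      eval N L env h (field j (px (fst (fs ! env j)))) = eval N L env h (field k (px (fst (fs ! env k))))"
    using wf_nth by (auto simp: xfacts_def)
  finally show ?thesis using * by auto
qed

section \<open>Correctness of the greedy commands\<close>

definition marked :: "arr \<Rightarrow> heap \<Rightarrow> nat set" where
  "marked a h = {j. j < N \<and> h a j \<noteq> 0}"

definition ypart :: "nat set" where
  "ypart = {bs ! i | bs i. bs \<in> joins \<and> i < m \<and> x \<notin> set (atoms ! i)}"

lemma xfacts_less: "j \<in> xfacts \<Longrightarrow> j < N"
  using size_le by (auto simp: xfacts_def)

lemma exec_peel:
  assumes "stored h" "S = marked Sel h"
  shows "\<exists>g. exec N L env peel_com h = h(Alive := g) \<and>
           marked Alive (h(Alive := g)) = fold (H.peel (h Thr 0) S) [0..<N] (marked Alive h)"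
  unfolding peel_com_def exec.simps(4)
proof (rule fold_upt_induct[where P = "\<lambda>i h'. \<exists>g. h' = h(Alive := g) \<and>
           marked Alive (h(Alive := g)) = fold (H.peel (h Thr 0) S) [0..<i] (marked Alive h)"])
  show "\<exists>g. h = h(Alive := g) \<and> marked Alive (h(Alive := g)) = fold (H.peel (h Thr 0) S) [0..<0] (marked Alive h)"
    by (intro exI[of _ "h Alive"]) simp
next
  fix i h' assume i: "i < N"
    and "\<exists>g. h' = h(Alive := g) \<and> marked Alive (h(Alive := g)) = fold (H.peel (h Thr 0) S) [0..<i] (marked Alive h)"
  then obtain g where h': "h' = h(Alive := g)"
    and g: "marked Alive h' = fold (H.peel (h Thr 0) S) [0..<i] (marked Alive h)" by auto
  have st: "stored h'" using assms(1) by (rule stored_cong) (simp_all add: h')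
  have S: "S = {j. j < N \<and> h' Sel j \<noteq> 0}" using assms(2) by (simp add: h' marked_def)
  let ?d = "H.deg S (marked Alive h') i"
  have "eval N L (env(vj := i)) h' (degree vj) = ?d"
    using eval_degree[of h' vj S "marked Alive h'" "env(vj := i)", OF st _ S] by (simp add: marked_def)
  then have e: "exec N L (env(vj := i)) (Wr Alive (Var vj) (And (Rd Alive (Var vj)) (Nt (Mns (Rd Thr (Cst 0)) (degree vj))))) h' =
      h'(Alive := g(i := of_bool (g i \<noteq> 0 \<and> \<not> ?d < h Thr 0)))"
    by (simp add: clip_def h' not_less)
  have "marked Alive (h'(Alive := g(i := of_bool (g i \<noteq> 0 \<and> \<not> ?d < h Thr 0)))) =
      H.peel (h Thr 0) S i (marked Alive h')"
    using i by (auto simp: H.peel_def marked_def h')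
  then show "\<exists>g. exec N L (env(vj := i)) (Wr Alive (Var vj) (And (Rd Alive (Var vj)) (Nt (Mns (Rd Thr (Cst 0)) (degree vj))))) h' = h(Alive := g) \<and>
      marked Alive (h(Alive := g)) = fold (H.peel (h Thr 0) S) [0..<Suc i] (marked Alive h)"
    unfolding e using g h' by (intro exI conjI) auto
qed

lemma exec_peels:
  assumes "stored h" "S = marked Sel h"
  shows "\<exists>g. exec N L env (For r peel_com) h = h(Alive := g) \<and>
           marked Alive (h(Alive := g)) = (fold (H.peel (h Thr 0) S) [0..<N] ^^ N) (marked Alive h)"
  unfolding exec.simps(4)
proof (rule fold_upt_induct[where P = "\<lambda>i h'. \<exists>g. h' = h(Alive := g) \<and>
           marked Alive (h(Alive := g)) = (fold (H.peel (h Thr 0) S) [0..<N] ^^ i) (marked Alive h)"])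
  show "\<exists>g. h = h(Alive := g) \<and> marked Alive (h(Alive := g)) = (fold (H.peel (h Thr 0) S) [0..<N] ^^ 0) (marked Alive h)"
    by (intro exI[of _ "h Alive"]) simp
next
  fix i h' assume "\<exists>g. h' = h(Alive := g) \<and> marked Alive (h(Alive := g)) = (fold (H.peel (h Thr 0) S) [0..<N] ^^ i) (marked Alive h)"
  then obtain g where h': "h' = h(Alive := g)"
    and g: "marked Alive h' = (fold (H.peel (h Thr 0) S) [0..<N] ^^ i) (marked Alive h)" by auto
  have st: "stored h'" using assms(1) by (rule stored_cong) (simp_all add: h')
  have S: "S = marked Sel h'" using assms(2) by (simp add: h' marked_def)
  show "\<exists>g. exec N L (env(r := i)) peel_com h' = h(Alive := g) \<and>
      marked Alive (h(Alive := g)) = (fold (H.peel (h Thr 0) S) [0..<N] ^^ Suc i) (marked Alive h)"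
    using exec_peel[OF st S, of "env(r := i)"] g by (auto simp: h')
qed

lemma exec_group:
  assumes st: "stored h" and d: "h Thr 0 = d" "1 \<le> d" and inv: "H.greedy_inv d (marked Sel h)" and k: "env vk = k"
  shows "\<exists>g g'. exec N L env group_com h = h(Alive := g, Sel := g') \<and>
     H.greedy_inv d (marked Sel (h(Sel := g'))) \<and> marked Sel h \<subseteq> marked Sel (h(Sel := g')) \<and>
     (k \<in> xfacts \<longrightarrow> H.sparse (H.grp (xval k)) d (marked Sel (h(Sel := g'))))"
proof -
  define S where "S = marked Sel h"
  define W where "W = (if k \<in> xfacts then H.grp (xval k) else {})"
  define h1 where "h1 = h(Alive := \<lambda>j. if j < N then of_bool (j \<in> W) else h Alive j)"
  have ex1: "exec N L env (For vj (Wr Alive (Var vj) (Nt (Nt (same_group vj vk))))) h = h1"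
    unfolding h1_def
  proof (rule exec_For_Wr)
    fix j h' assume h': "\<And>b. b \<noteq> Alive \<Longrightarrow> h' b = h b"
    have "stored h'" using st by (rule stored_cong) (simp_all add: h')
    then show "eval N L (env(vj := j)) h' (Nt (Nt (same_group vj vk))) = of_bool (j \<in> W)"
      using eval_same_group[of h' "env(vj := j)" vj vk] k by (auto simp: W_def H.grp_def)
  qed simp
  have Wsub: "W \<subseteq> {..<N}" using xfacts_less by (auto simp: W_def H.grp_def)
  then have "\<exists>g. h1 = h(Alive := g) \<and> marked Alive h1 = W"
    by (auto simp: marked_def h1_def)
  then obtain g1 where h1: "h1 = h(Alive := g1)" "marked Alive h1 = W" by blast
  have st1: "stored h1" using st by (rule stored_cong) (simp_all add: h1)
  have S1: "S = marked Sel h1" by (simp add: S_def h1 marked_def)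
  define C where "C = (fold (H.peel d S) [0..<N] ^^ N) W"
  obtain g2 where h2: "exec N L env (For vi peel_com) h1 = h(Alive := g2)" "marked Alive (h(Alive := g2)) = C"
    using exec_peels[OF st1 S1, of env vi] h1 d by (auto simp: C_def)
  define g' where "g' = (\<lambda>j. if j < N then h Sel j + g2 j else h Sel j)"
  have "exec N L env (For vj (Wr Sel (Var vj) (Pls (Rd Sel (Var vj)) (Rd Alive (Var vj))))) (h(Alive := g2)) =
      h(Alive := g2, Sel := g')"
    unfolding g'_def by (subst exec_For_Wr[where v = "\<lambda>j. h Sel j + g2 j"]) (auto simp: clip_def fun_eq_iff)
  then have ex: "exec N L env group_com h = h(Alive := g2, Sel := g')"
    by (simp only: group_com_def exec.simps(3) ex1 h2(1))
  have S': "marked Sel (h(Sel := g')) = S \<union> C"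
    using h2(2) by (auto simp: marked_def g'_def S_def)
  have "card W \<le> N" using card_mono[OF finite_lessThan Wsub] by simp
  then have core: "H.is_core d S W C"
    unfolding C_def using Wsub finite_subset[OF Wsub] by (intro H.is_core_peel) auto
  show ?thesis
  proof (cases "k \<in> xfacts")
    case True
    then have "H.greedy_inv d (S \<union> C)" "H.sparse (H.grp (xval k)) d (S \<union> C)"
      using H.greedy_inv_step[of d S "xval k" C] H.sparse_after_core[of d S W C] core inv d(2)
      by (auto simp: W_def S_def)
    then show ?thesis using ex S' S_def by (intro exI[of _ g2] exI[of _ g']) simp
  next
    case False
    then have "C = {}" using core by (auto simp: W_def H.is_core_def)
    then show ?thesis using ex S' S_def inv False by (intro exI[of _ g2] exI[of _ g']) simp
  qed
qed

lemma exec_round: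
  assumes st: "stored h" and d: "h Thr 0 = Suc d" and inv: "H.greedy_inv (Suc d) (marked Sel h)"
  shows "stored (exec N L env round_com h) \<and> exec N L env round_com h Thr 0 = d \<and>
    H.greedy_inv d (marked Sel (exec N L env round_com h))"
proof -
  \<comment> \<open>The groups of facts with index below \<open>i\<close> have lost their core for
    the current threshold. Once this holds for all facts, \<open>sparse_groups\<close> lowers the
    threshold by one.\<close>
  define P where "P i h' \<longleftrightarrow> stored h' \<and> h' Thr 0 = Suc d \<and> H.greedy_inv (Suc d) (marked Sel h') \<and>
    (\<forall>k\<in>xfacts. k < i \<longrightarrow> H.sparse (H.grp (xval k)) (Suc d) (marked Sel h'))" for i h'
  define h1 where "h1 = exec N L env (For vk group_com) h"
  have "P N h1"
    unfolding h1_def exec.simps(4)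
  proof (rule fold_upt_induct[where P = P])
    show "P 0 h" using assms by (simp add: P_def)
  next
    fix i h' assume i: "i < N" and P: "P i h'"
    then obtain g g' where e: "exec N L (env(vk := i)) group_com h' = h'(Alive := g, Sel := g')"
      and g': "H.greedy_inv (Suc d) (marked Sel (h'(Sel := g')))" "marked Sel h' \<subseteq> marked Sel (h'(Sel := g'))"
       "i \<in> xfacts \<longrightarrow> H.sparse (H.grp (xval i)) (Suc d) (marked Sel (h'(Sel := g')))"
      using exec_group[of h' "Suc d" "env(vk := i)" i] unfolding P_def by auto
    have "stored (h'(Alive := g, Sel := g'))"
      using P stored_cong[of h' "h'(Alive := g, Sel := g')"] by (simp add: P_def)
    moreover have "marked Sel (h'(Alive := g, Sel := g')) = marked Sel (h'(Sel := g'))" by (simp add: marked_def)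
    ultimately show "P (Suc i) (exec N L (env(vk := i)) group_com h')"
      using P g' H.sparse_mono[OF _ g'(2)] unfolding e P_def by (auto simp: less_Suc_eq)
  qed
  then have "H.sparse xfacts (Suc d) (marked Sel h1)"
    using xfacts_less by (intro H.sparse_groups) (auto simp: P_def)
  then have inv1: "H.greedy_inv d (marked Sel h1)"
    using \<open>P N h1\<close> by (auto simp: P_def H.greedy_inv_def)
  have "exec N L env round_com h = h1(Thr := (h1 Thr)(0 := d))"
    using \<open>P N h1\<close> unfolding round_com_def exec.simps(3) h1_def[symmetric] by (simp add: clip_def P_def)
  moreover have "stored (h1(Thr := (h1 Thr)(0 := d)))"
    using \<open>P N h1\<close> stored_cong[of h1 "h1(Thr := (h1 Thr)(0 := d))"] by (simp add: P_def)
  ultimately show ?thesis using inv1 by (simp add: marked_def)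
qed

lemma exec_greedy:
  assumes "stored h"
  shows "\<exists>S. H.greedy_inv 0 S \<and> stored (exec N L env greedy_com h) \<and>
           marked Sel (exec N L env greedy_com h) = S \<union> ypart"
proof -
  let ?h1 = "h(Sel := (\<lambda>j. if j < N then 0 else h Sel j))"
  have h1: "exec N L env (For vj (Wr Sel (Var vj) (Cst 0))) h = ?h1"
    by (rule exec_For_Wr) auto
  let ?h2 = "?h1(Thr := (h Thr)(0 := N ^ m))"
  have h2: "exec N L env (Wr Thr (Cst 0) (Sgms 0 m (Cst 1))) ?h1 = ?h2"
    by (simp add: clip_def card_tuples)
  define h3 where "h3 = exec N L env (Fors (2 * m + 3) m round_com) ?h2"
  \<comment> \<open>The sum of round number and threshold is constant, so the threshold is positive
    in every round and 0 after the last.\<close>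
  define P where "P i h' \<longleftrightarrow> stored h' \<and> i + h' Thr 0 = N ^ m \<and> H.greedy_inv (h' Thr 0) (marked Sel h')" for i h'
  have "card joins \<le> N ^ m"
    using card_mono[OF finite_tuples joins_subset(2)] by (simp add: card_tuples)
  then have "P 0 ?h2"
    using H.greedy_inv_init assms by (auto simp: P_def marked_def intro: stored_cong)
  moreover have "P (Suc i) (exec N L env' round_com h')" if i: "i < 0 + N ^ m" and P: "P i h'" for i h' env'
  proof -
    have "h' Thr 0 \<noteq> 0" using i P by (auto simp: P_def)
    then obtain d where d: "h' Thr 0 = Suc d" using not0_implies_Suc by blast
    show ?thesis using exec_round[of h' d env'] P d by (auto simp: P_def)
  qed
  ultimately have "P (0 + N ^ m) h3"
    unfolding h3_def by (intro exec_Fors_induct[where P = P])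
  then have h3: "stored h3" "H.greedy_inv 0 (marked Sel h3)" by (auto simp: P_def)
  let ?e = "Pls (Rd Sel (Var vj)) (Sgms 0 m (And (is_join 0) (uses 0 yatoms vj)))"
  define cnt :: "nat \<Rightarrow> nat" where
    "cnt j = (\<Sum>bs\<in>tuples N m. of_bool (bs \<in> joins \<and> (\<exists>i\<in>set yatoms. bs ! i = j)))" for j
  let ?v = "\<lambda>j. h3 Sel j + cnt j"
  have ev: "eval N L (env(vj := j)) h' ?e = ?v j"
    if "\<And>b. b \<noteq> Sel \<Longrightarrow> h' b = h3 b" "h' Sel j = h3 Sel j" for j h'
  proof -
    have st: "stored h'" using h3(1) by (rule stored_cong) (simp_all add: that)
    have "eval N L (updl (env(vj := j)) 0 bs) h' (And (is_join 0) (uses 0 yatoms vj)) =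
        of_bool (bs \<in> joins \<and> (\<exists>i\<in>set yatoms. bs ! i = j))" if "bs \<in> tuples N m" for bs
    proof -
      have len: "length bs = m" using that by (simp add: tuples_def)
      have env: "updl (env(vj := j)) 0 bs i = bs ! i" if "i < m" for i
        using that len by (auto simp: updl_def)
      have envj: "updl (env(vj := j)) 0 bs vj = j" using len by (auto simp: updl_def)
      show ?thesis
        using eval_is_join[OF st len, of "updl (env(vj := j)) 0 bs" 0] env
        unfolding eval_And eval_uses envj by auto
    qed
    then show ?thesis using that by (simp add: clip_def cnt_def)
  qed
  have h4: "exec N L env greedy_com h = h3(Sel := (\<lambda>j. if j < N then ?v j else h3 Sel j))"
    unfolding greedy_com_def exec.simps(3) h1 h2 h3_def[symmetric]
    by (rule exec_For_Wr) (use ev in auto)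
  have "cnt j \<noteq> 0 \<longleftrightarrow> j \<in> ypart" for j
    unfolding cnt_def sum_of_bool_neq_0[OF finite_tuples] using joins_subset(2) by (auto simp: ypart_def)
  then have "?v j \<noteq> 0 \<longleftrightarrow> h3 Sel j \<noteq> 0 \<or> j \<in> ypart" for j
    by (simp only: add_is_0 de_Morgan_conj)
  moreover have "j < N" if "j \<in> ypart" for j
    using that joins_subset(2) tuples_nth by (auto simp: ypart_def)
  ultimately have "marked Sel (exec N L env greedy_com h) = marked Sel h3 \<union> ypart"
    unfolding h4 by (auto simp: marked_def)
  moreover have "stored (exec N L env greedy_com h)"
    unfolding h4 using h3(1) by (rule stored_cong) simp_all
  ultimately show ?thesis using h3(2) by blast
qed

section \<open>The approximation guarantee\<close>

text \<open>This moves the problem to sets of indices: the answers on a subdatabase are the keys of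
  the joins that lie inside it.\<close>

lemma cq_eval_image:
  assumes J: "J \<subseteq> {..<n}"
  shows "cq_eval atoms (set hs) ((!) fs ` J) = hkey ` {bs \<in> joins. set bs \<subseteq> J}"
proof (intro equalityI subsetI)
  fix t assume "t \<in> cq_eval atoms (set hs) ((!) fs ` J)"
  then obtain f where t: "t = (\<lambda>a. if a \<in> set hs then Some (f a) else None)"
    and f: "\<And>i. i < m \<Longrightarrow> (i, map f (atoms ! i)) \<in> (!) fs ` J"
    by (auto simp: cq_eval_def)
  then have "\<forall>i. \<exists>j. i < m \<longrightarrow> j \<in> J \<and> fs ! j = (i, map f (atoms ! i))" by fastforce
  then obtain g where g: "\<And>i. i < m \<Longrightarrow> g i \<in> J \<and> fs ! g i = (i, map f (atoms ! i))" by metis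
  define bs where "bs = map g [0..<m]"
  have bs: "\<And>i. i < m \<Longrightarrow> fs ! (bs ! i) = (i, map f (atoms ! i))" using g by (simp add: bs_def)
  have val: "val bs a = f a" if "a \<in> qattrs atoms" for a
    using val_unique[OF bs that] by simp
  have "map f (atoms ! i) = map (val bs) (atoms ! i)" if "i < m" for i
    using that val in_qattrs by (intro map_cong refl) (metis)
  then have "bs \<in> joins" using bs g J by (auto simp: joins_def bs_def)
  moreover have "set bs \<subseteq> J" using g by (auto simp: bs_def)
  moreover have "t = hkey bs" using val qattrs_eq by (auto simp: t hkey_def)
  ultimately show "t \<in> hkey ` {bs \<in> joins. set bs \<subseteq> J}" by blast
next
  fix t assume "t \<in> hkey ` {bs \<in> joins. set bs \<subseteq> J}"
  then obtain bs where bs: "bs \<in> joins" "set bs \<subseteq> J" "t = hkey bs" by blast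
  have "(i, map (val bs) (atoms ! i)) \<in> (!) fs ` J" if "i < m" for i
  proof -
    have "bs ! i \<in> J" using bs that by (auto simp: joins_def)
    then show ?thesis using joinsD(2)[OF bs(1) that] by force
  qed
  then show "t \<in> cq_eval atoms (set hs) ((!) fs ` J)"
    unfolding cq_eval_def bs(3) hkey_def by blast
qed

lemma set_fs: "set fs = (!) fs ` {..<n}"
  by (auto simp: set_conv_nth)

lemma cq_eval_set: "cq_eval atoms (set hs) (set fs) = hkey ` joins"
proof -
  have "set bs \<subseteq> {..<n}" if "bs \<in> joins" for bs
    using that joins_subset(1) by (auto simp: tuples_def)
  then have "{bs \<in> joins. set bs \<subseteq> {..<n}} = joins" by blast
  then show ?thesis unfolding set_fs by (subst cq_eval_image) auto
qed

lemma ypart_less: "j \<in> ypart \<Longrightarrow> j < n"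
  using joinsD by (auto simp: ypart_def)

lemma ypart_disjoint: "xfacts \<inter> ypart = {}"
  using joinsD(2) by (auto simp: ypart_def xfacts_def)

lemma set_joins_subset:
  assumes "bs \<in> joins" "xpart bs \<subseteq> S"
  shows "set bs \<subseteq> S \<union> ypart"
proof
  fix v assume "v \<in> set bs"
  then obtain i where i: "i < m" "v = bs ! i" using assms(1) by (auto simp: in_set_conv_nth joins_def)
  show "v \<in> S \<union> ypart"
  proof (cases "x \<in> set (atoms ! i)")
    case True
    then have "v \<in> xpart bs" using i by (auto simp: xpart_def)
    then show ?thesis using assms(2) by blast
  next
    case False
    then show ?thesis using i assms(1) unfolding ypart_def by blast
  qed
qed

lemma feasible_cover:
  assumes J: "J \<subseteq> {..<n}" and feas: "cq_eval atoms (set hs) ((!) fs ` J) = cq_eval atoms (set hs) (set fs)"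
  shows "H.cov (J \<inter> xfacts) = hkey ` joins" "ypart \<subseteq> J"
proof -
  have keys: "hkey ` {bs \<in> joins. set bs \<subseteq> J} = hkey ` joins"
    using feas by (simp add: cq_eval_image[OF J] cq_eval_set)
  have "xpart bs \<subseteq> J \<inter> xfacts" if "bs \<in> joins" "set bs \<subseteq> J" for bs
    using H.F_subset[OF that(1)] that by (auto simp: xpart_def joins_def)
  then have "hkey ` {bs \<in> joins. set bs \<subseteq> J} \<subseteq> H.cov (J \<inter> xfacts)"
    by (auto simp: H.cov_def)
  then show "H.cov (J \<inter> xfacts) = hkey ` joins" using keys by (auto simp: H.cov_def)
  show "ypart \<subseteq> J"
  proof
    fix j assume "j \<in> ypart"
    then obtain bs i where j: "j = bs ! i" "bs \<in> joins" "i < m" "x \<notin> set (atoms ! i)"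
      by (auto simp: ypart_def)
    then have "hkey bs \<in> hkey ` {bs \<in> joins. set bs \<subseteq> J}" using keys by auto
    then obtain bs' where bs': "bs' \<in> joins" "set bs' \<subseteq> J" "hkey bs = hkey bs'" by auto
    have "val bs a = val bs' a" if "a \<in> set (atoms ! i)" for a
    proof -
      \<comment> \<open>An atom without x has only head attributes, so two joins with the same key
        use the same fact in it.\<close>
      have "a \<in> set hs" using that j in_qattrs[OF j(3) that] hs by auto
      then show ?thesis using fun_cong[OF bs'(3), of a] by (simp add: hkey_def)
    qed
    then have "map (val bs) (atoms ! i) = map (val bs') (atoms ! i)" by simp
    then have "bs ! i = bs' ! i"
      using joinsD[OF j(2,3)] joinsD[OF bs'(1) j(3)] dist nth_eq_iff_index_eq by metis
    then show "j \<in> J" using j bs' by (auto simp: joins_def)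
  qed
qed

lemma greedy_feasible:
  assumes "H.greedy_inv 0 S"
  shows "S \<union> ypart \<subseteq> {..<n}"
    "cq_eval atoms (set hs) ((!) fs ` (S \<union> ypart)) = cq_eval atoms (set hs) (set fs)"
proof -
  have "S \<subseteq> xfacts" using assms by (simp add: H.greedy_inv_def)
  moreover have "xfacts \<subseteq> {..<n}" by (auto simp: xfacts_def)
  ultimately show sub: "S \<union> ypart \<subseteq> {..<n}" using ypart_less by auto
  have "{bs \<in> joins. set bs \<subseteq> S \<union> ypart} \<supseteq> {bs \<in> joins. xpart bs \<subseteq> S}"
    using set_joins_subset by auto
  then have "H.cov S \<subseteq> hkey ` {bs \<in> joins. set bs \<subseteq> S \<union> ypart}"
    unfolding H.cov_def by (rule image_mono)
  then have "hkey ` joins \<subseteq> hkey ` {bs \<in> joins. set bs \<subseteq> S \<union> ypart}"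
    unfolding H.greedy_inv_final(1)[OF assms] .
  then show "cq_eval atoms (set hs) ((!) fs ` (S \<union> ypart)) = cq_eval atoms (set hs) (set fs)"
    by (auto simp: cq_eval_image[OF sub] cq_eval_set)
qed

text \<open>There are at most \<open>n ^ m\<close> keys, and \<open>1 + m * ln n\<close> is at most
  \<open>m * (1 + ln n)\<close> because \<open>m\<close> is positive.\<close>

lemma harmonic_keys_le:
  assumes "1 \<le> n"
  shows "harmonic (card (hkey ` joins)) \<le> real m * (1 + ln (real n))"
proof (cases "joins = {}")
  case True
  then show ?thesis using assms by (simp add: harmonic_def)
next
  case False
  have fin: "finite (hkey ` joins)" using H.finite_E by simp
  have 1: "1 \<le> card (hkey ` joins)" using False fin by (simp add: Suc_le_eq card_gt_0_iff)
  have "card (hkey ` joins) \<le> card joins" by (rule card_image_le[OF H.finite_E])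
  also have "\<dots> \<le> n ^ m" using card_mono[OF finite_tuples joins_subset(1)] by (simp add: card_tuples)
  finally have "ln (real (card (hkey ` joins))) \<le> ln (real (n ^ m))" using 1 assms by (subst ln_le_cancel_iff) (auto simp flip: of_nat_power)
  also have "\<dots> = real m * ln (real n)" using assms by (simp add: ln_realpow)
  finally have "harmonic (card (hkey ` joins)) \<le> 1 + real m * ln (real n)"
    using harmonic_le_ln[OF 1] by linarith
  moreover have "1 \<le> m" using x by (cases atoms) (auto simp: qattrs_def)
  ultimately show ?thesis by (simp add: algebra_simps)
qed

text \<open>An optimal index set \<open>J\<close> contains \<open>ypart\<close> and, disjoint from
  it, the part that covers all keys. The forced facts are paid one for one, which the factor allows
  because it is at least 1.\<close>

lemma greedy_approx:
  assumes inv: "H.greedy_inv 0 S" and n: "1 \<le> n"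
  shows "real (card (S \<union> ypart)) \<le> real (m * m) * (1 + ln (real n)) * real (swp_opt atoms (set hs) (set fs))"
proof -
  let ?F = "{D'. swp_feasible atoms (set hs) (set fs) D'}"
  have "?F \<subseteq> Pow (set fs)" by (auto simp: swp_feasible_def)
  then have "finite (card ` ?F)" by (meson finite_Pow_iff finite_imageI finite_set finite_subset)
  moreover have "set fs \<in> ?F" by (simp add: swp_feasible_def)
  ultimately have "swp_opt atoms (set hs) (set fs) \<in> card ` ?F"
    unfolding swp_opt_def by (intro Min_in) blast+
  then obtain D' where D': "D' \<subseteq> set fs" "cq_eval atoms (set hs) D' = cq_eval atoms (set hs) (set fs)"
    "card D' = swp_opt atoms (set hs) (set fs)" by (auto simp: swp_feasible_def)
  define J where "J = {j. j < n \<and> fs ! j \<in> D'}"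
  have D'J: "D' = (!) fs ` J"
  proof (intro equalityI subsetI)
    fix f assume f: "f \<in> D'"
    then have "f \<in> set fs" using D'(1) by blast
    then obtain j where "j < n" "fs ! j = f" by (metis in_set_conv_nth)
    then show "f \<in> (!) fs ` J" using f by (auto simp: J_def)
  qed (auto simp: J_def)
  have J: "J \<subseteq> {..<n}" "finite J" by (auto simp: J_def)
  have "inj_on ((!) fs) J" using inj_on_nth[OF dist] J(1) by blast
  then have cardJ: "card J = swp_opt atoms (set hs) (set fs)" using D'(3) by (simp add: D'J card_image)
  note cover = feasible_cover[OF J(1) D'(2)[unfolded D'J]]
  let ?c = "real (m * m) * (1 + ln (real n))"
  have ln: "0 \<le> ln (real n)" using n by simp
  have m: "1 \<le> m" using x by (cases atoms) (auto simp: qattrs_def)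
  have "1 * 1 \<le> ?c" using m ln by (intro mult_mono) (auto simp flip: of_nat_mult)
  then have c: "1 \<le> ?c" by simp
  have "real (card S) \<le> real m * real (card (J \<inter> xfacts)) * harmonic (card (hkey ` joins))"
    by (rule H.greedy_inv_final(2)[OF inv _ cover(1)]) simp
  also have "\<dots> \<le> real m * real (card (J \<inter> xfacts)) * (real m * (1 + ln (real n)))"
    by (intro mult_left_mono harmonic_keys_le n) auto
  also have "\<dots> = ?c * real (card (J \<inter> xfacts))" by simp
  finally have S: "real (card S) \<le> ?c * real (card (J \<inter> xfacts))" .
  have "real (card ypart) \<le> ?c * real (card ypart)" using c mult_right_mono[OF c, of "real (card ypart)"] by simp
  moreover have "real (card (S \<union> ypart)) \<le> real (card S) + real (card ypart)"
    using card_Un_le[of S ypart] by linarith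
  ultimately have "real (card (S \<union> ypart)) \<le> ?c * real (card (J \<inter> xfacts) + card ypart)"
    using S unfolding of_nat_add distrib_left by linarith
  also have "card (J \<inter> xfacts) + card ypart = card ((J \<inter> xfacts) \<union> ypart)"
    using ypart_disjoint J(2) finite_subset[OF cover(2)] by (subst card_Un_disjoint) auto
  also have "?c * real \<dots> \<le> ?c * real (card J)"
    using c card_mono[OF J(2), of "J \<inter> xfacts \<union> ypart"] cover(2) by (intro mult_left_mono) auto
  finally show ?thesis by (simp add: cardJ)
qed

end

section \<open>Reading and writing the encoding\<close>

text \<open>\<open>I\<close> contains all cells that the sequence may write. Each expression must
  have a value independent of the contents of \<open>I\<close>, so that earlier writes do not
  disturb later ones.\<close>

lemma exec_Seqs_Wr:
  assumes "distinct rs" "inj_on (\<lambda>r. clip L a (i r)) (set rs)" "(\<lambda>r. clip L a (i r)) ` set rs \<subseteq> I"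
    and "\<And>r h'. r \<in> set rs \<Longrightarrow> (\<And>b. b \<noteq> a \<Longrightarrow> h' b = h b) \<Longrightarrow> (\<And>j. j \<notin> I \<Longrightarrow> h' a j = h a j) \<Longrightarrow>
           eval N L env h' (ix r) = i r \<and> eval N L env h' (e r) = v r"
  shows "\<exists>g. exec N L env (Seqs (map (\<lambda>r. Wr a (ix r) (e r)) rs)) h = h(a := g) \<and>
           (\<forall>r\<in>set rs. g (clip L a (i r)) = v r) \<and>
           (\<forall>j. j \<notin> (\<lambda>r. clip L a (i r)) ` set rs \<longrightarrow> g j = h a j)"
  using assms
proof (induction rs arbitrary: h)
  case Nil
  show ?case by (intro exI[of _ "h a"]) (simp add: Seqs_def)
next
  case (Cons r rs)
  let ?h = "h(a := (h a)(clip L a (i r) := v r))"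
  have step: "exec N L env (Wr a (ix r) (e r)) h = ?h"
    using Cons.prems(4)[of r h] by simp
  have "\<exists>g. exec N L env (Seqs (map (\<lambda>r. Wr a (ix r) (e r)) rs)) ?h = ?h(a := g) \<and>
           (\<forall>r\<in>set rs. g (clip L a (i r)) = v r) \<and>
           (\<forall>j. j \<notin> (\<lambda>r. clip L a (i r)) ` set rs \<longrightarrow> g j = ?h a j)"
  proof (rule Cons.IH)
    fix r' h' assume r': "r' \<in> set rs" and h': "\<And>b. b \<noteq> a \<Longrightarrow> h' b = ?h b" "\<And>j. j \<notin> I \<Longrightarrow> h' a j = ?h a j"
    have "h' a j = h a j" if "j \<notin> I" for j
      using h'(2)[OF that] that Cons.prems(3) by auto
    then show "eval N L env h' (ix r') = i r' \<and> eval N L env h' (e r') = v r'"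
      using Cons.prems(4)[of r' h'] h'(1) r' by auto
  qed (use Cons.prems in auto)
  then obtain g where g: "exec N L env (Seqs (map (\<lambda>r. Wr a (ix r) (e r)) rs)) ?h = h(a := g)"
     "\<And>r. r \<in> set rs \<Longrightarrow> g (clip L a (i r)) = v r"
     "\<And>j. j \<notin> (\<lambda>r. clip L a (i r)) ` set rs \<Longrightarrow> g j = ?h a j" by auto
  have "clip L a (i r) \<notin> (\<lambda>r. clip L a (i r)) ` set rs"
    using Cons.prems(1,2) by (auto simp: inj_on_def)
  then have "g (clip L a (i r)) = v r" using g(3) by simp
  moreover have "exec N L env (Seqs (map (\<lambda>r. Wr a (ix r) (e r)) (r # rs))) h = h(a := g)"
    using g(1) step by (simp add: Seqs_def)
  ultimately show ?case using g(2,3) by (intro exI[of _ g]) auto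
qed

lemma nth_concat_sum:
  "j < length xss \<Longrightarrow> q < length (xss ! j) \<Longrightarrow>
     (\<Sum>j'<j. length (xss ! j')) + q < length (concat xss) \<and>
     concat xss ! ((\<Sum>j'<j. length (xss ! j')) + q) = xss ! j ! q"
proof (induction xss arbitrary: j)
  case (Cons xs xss)
  show ?case
  proof (cases j)
    case 0
    then show ?thesis using Cons.prems by (simp add: nth_append)
  next
    case (Suc j')
    then show ?thesis using Cons.prems Cons.IH[of j']
      by (simp add: sum.lessThan_Suc_shift nth_append add.assoc del: sum.lessThan_Suc)
  qed
qed simp

abbreviation fact_words :: "fact \<Rightarrow> nat list" where
  "fact_words f \<equiv> fst f # snd f"

lemma encode_db_eq: "encode_db fs = length fs # concat (map fact_words fs)"
  by (simp add: encode_db_def case_prod_unfold)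

context query begin

text \<open>The input cells below R have been moved to the cells 2 ^ (J + r) * n, and the bound N is
  2 ^ (J + R + 1) * n, from which the number n of facts is recovered by counting.\<close>

definition "copy_in R J = Seq (Wr Nf (Cst 0) (Sgm 0 (Nt (Nt (Mns Bnd (Dbls (J + R + 1) (Var 0)))))))
  (Seq (For 0 (Wr Inp (Var 0) (Rd Raw (Mns (Var 0) (Cst R)))))
    (Seqs (map (\<lambda>r. Wr Inp (Cst r) (Rd Raw (Mns (Dbls (J + r) size_e) (Cst R)))) [1..<R])))"

text \<open>Output cells below \<open>R\<close> are still in use as registers. Word \<open>r\<close>
  is left at cell \<open>2 ^ (J + r) * n\<close> for \<open>finish_code\<close>; the output length,
  belonging to cell 0, takes the free exponent \<open>J + R\<close>.\<close>

definition "copy_out R J = Seq (For 0 (Wr Raw (Mns (Var 0) (Cst R)) (Rd Out (Var 0))))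
  (Seqs (map (\<lambda>r. Wr Raw (Mns (Dbls (J + r) size_e) (Cst R)) (Rd Out (Cst (if r = R then 0 else r)))) [1..<Suc R]))"

text \<open>A table lookup without multiplication: an arity is the sum of that many copies of a 0/1
  test.\<close>

definition "arity_e c e = Plss (map (\<lambda>i. Plss (replicate (length (atoms ! i)) (And c (Eq e (Cst i))))) [0..<m])"

definition "parse_com = Seq (Wr Ptr (Cst 0) (Cst 1)) (For 0 (Wr Ptr (Pls (Var 0) (Cst 1))
  (Pls (Rd Ptr (Var 0)) (Pls (Cst 1) (arity_e (Cst 1) (Rd Inp (Rd Ptr (Var 0))))))))"

text \<open>A bound on the number of words of a fact, its relation symbol included.\<close>

definition "width = Suc (sum_list (map length atoms))"

text \<open>The words of every fact are written behind the output so far, but only a selected fact advances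
  the length, so the words of the others are overwritten or ignored.\<close>

definition "print_com = Seq (Wr Out (Cst 0) (Cst 1)) (Seq (Wr Out (Cst 1) (Cst 0)) (For 0
  (Seq (Seqs (map (\<lambda>p. Wr Out (Pls (Rd Out (Cst 0)) (Cst (Suc p))) (Rd Inp (Pls (Rd Ptr (Var 0)) (Cst p)))) [0..<width]))
  (Seq (Wr Out (Cst 1) (Pls (Rd Out (Cst 1)) (Nt (Nt (Rd Sel (Var 0))))))
    (Wr Out (Cst 0) (Pls (Rd Out (Cst 0))
      (Pls (Nt (Nt (Rd Sel (Var 0)))) (arity_e (Rd Sel (Var 0)) (Rd Inp (Rd Ptr (Var 0)))))))))))"

lemma eval_arity_e:
  "eval N L env h (arity_e c e) =
     (if eval N L env h c \<noteq> 0 \<and> eval N L env h e < m then length (atoms ! eval N L env h e) else 0)"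
proof -
  let ?c = "eval N L env h c \<noteq> 0" and ?e = "eval N L env h e"
  have "eval N L env h (arity_e c e) = (\<Sum>i<m. if i = ?e then (if ?c then length (atoms ! i) else 0) else 0)"
    by (auto simp: arity_e_def sum_list_replicate interv_sum_list_conv_sum_set_nat lessThan_atLeast0 comp_def
        intro!: sum.cong)
  then show ?thesis by (auto simp: sum.delta)
qed

lemma length_le_width: "i < m \<Longrightarrow> length (atoms ! i) < width"
  using member_le_sum_list[of "length (atoms ! i)" "map length atoms"] by (auto simp: width_def less_Suc_eq_le)

end

context database begin

definition "pos j = Suc (\<Sum>j'<j. length (fact_words (fs ! j')))"

lemma encode_db_nth:
  assumes "j < n" "q < length (fact_words (fs ! j))"
  shows "pos j + q < length (encode_db fs)" "encode_db fs ! (pos j + q) = fact_words (fs ! j) ! q" "1 \<le> pos j + q"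
  using nth_concat_sum[of j "map fact_words fs" q] assms by (auto simp: pos_def encode_db_eq)

definition loaded :: "heap \<Rightarrow> bool" where
  "loaded h \<longleftrightarrow> h Nf 0 = n \<and> (\<forall>a. 1 \<le> a \<and> a < length (encode_db fs) \<longrightarrow> h Inp a = encode_db fs ! a)"

lemma exec_parse:
  assumes "loaded h" shows "stored (exec N L env parse_com h)"
proof -
  let ?h1 = "h(Ptr := (h Ptr)(0 := 1))"
  let ?c = "Wr Ptr (Pls (Var 0) (Cst 1)) (Pls (Rd Ptr (Var 0)) (Pls (Cst 1) (arity_e (Cst 1) (Rd Inp (Rd Ptr (Var 0))))))"
  \<comment> \<open>The loop runs past the last fact and computes arbitrary pointers there; only
    those up to \<open>n\<close> are claimed.\<close>
  define P where "P i h' \<longleftrightarrow> (\<exists>g. h' = h(Ptr := g) \<and> (\<forall>j. j \<le> i \<and> j \<le> n \<longrightarrow> g j = pos j))" for i h'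
  have inp: "h Inp (pos j + q) = fact_words (fs ! j) ! q" if "j < n" "q < length (fact_words (fs ! j))" for j q
    using assms encode_db_nth[OF that] by (simp add: loaded_def)
  have "P N (fold (\<lambda>i. exec N L (env(0 := i)) ?c) [0..<N] ?h1)"
  proof (rule fold_upt_induct[where P = P])
    show "P 0 ?h1" by (auto simp: P_def pos_def)
  next
    fix i h' assume "i < N" and "P i h'"
    then obtain g where h': "h' = h(Ptr := g)" and g: "\<And>j. j \<le> i \<and> j \<le> n \<Longrightarrow> g j = pos j" by (auto simp: P_def)
    let ?v = "g i + Suc (if h Inp (g i) < m then length (atoms ! h Inp (g i)) else 0)"
    have ex: "exec N L (env(0 := i)) ?c h' = h(Ptr := g(Suc i := ?v))"
      by (simp add: eval_arity_e clip_def h')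
    have "?v = pos (Suc i)" if "i < n"
      using g[of i] inp[OF that, of 0] wf_nth[OF that] that by (simp add: pos_def)
    then have "\<forall>j. j \<le> Suc i \<and> j \<le> n \<longrightarrow> (g(Suc i := ?v)) j = pos j"
      using g by (auto simp: le_Suc_eq)
    then show "P (Suc i) (exec N L (env(0 := i)) ?c h')" unfolding ex P_def by blast
  qed
  then obtain g where g: "exec N L env parse_com h = h(Ptr := g)" "\<And>j. j \<le> N \<and> j \<le> n \<Longrightarrow> g j = pos j"
    by (auto simp: P_def parse_com_def clip_def)
  have "h Inp (g j) = fst (fs ! j)" if "j < n" for j
    using inp[OF that, of 0] g(2)[of j] that size_le by simp
  moreover have "h Inp (Suc (g j + p)) = snd (fs ! j) ! p" if "j < n" "p < length (snd (fs ! j))" for j p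
    using inp[OF that(1), of "Suc p"] g(2)[of j] that size_le by simp
  ultimately show ?thesis
    using assms by (auto simp: g(1) stored_def loaded_def)
qed

definition "selected i h = map ((!) fs) (filter (\<lambda>j. h Sel j \<noteq> 0) [0..<i])"

lemma exec_print:
  assumes st: "stored h" and sel: "marked Sel h \<subseteq> {..<n}"
  shows "\<exists>g. exec N L env print_com h = h(Out := g) \<and> g 0 = length (encode_db (selected N h)) \<and>
    (\<forall>q<length (encode_db (selected N h)). g (Suc q) = encode_db (selected N h) ! q)"
proof -
  let ?c1 = "Seqs (map (\<lambda>p. Wr Out (Pls (Rd Out (Cst 0)) (Cst (Suc p))) (Rd Inp (Pls (Rd Ptr (Var 0)) (Cst p)))) [0..<width])"
  let ?c2 = "Wr Out (Cst 1) (Pls (Rd Out (Cst 1)) (Nt (Nt (Rd Sel (Var 0)))))"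
  let ?c3 = "Wr Out (Cst 0) (Pls (Rd Out (Cst 0))
      (Pls (Nt (Nt (Rd Sel (Var 0)))) (arity_e (Rd Sel (Var 0)) (Rd Inp (Rd Ptr (Var 0))))))"
  let ?c = "Seq ?c1 (Seq ?c2 ?c3)"
  define body where "body i = concat (map fact_words (selected i h))" for i
  \<comment> \<open>\<open>Out\<close> is laid out like the final memory: cell 0 is the output
    length, counting also the word for the number of facts in cell 1. The next free cell is
    therefore the length plus 1.\<close>
  define Q where "Q i g \<longleftrightarrow> g 0 = Suc (length (body i)) \<and> g 1 = length (selected i h) \<and>
      (\<forall>q<length (body i). g (Suc (Suc q)) = body i ! q)" for i and g :: "nat \<Rightarrow> nat"
  let ?h1 = "h(Out := (h Out)(0 := 1, 1 := 0))"
  have "\<exists>g. fold (\<lambda>i. exec N L (env(0 := i)) ?c) [0..<N] ?h1 = h(Out := g) \<and> Q N g"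
  proof (rule fold_upt_induct[where P = "\<lambda>i h'. \<exists>g. h' = h(Out := g) \<and> Q i g"])
    show "\<exists>g. ?h1 = h(Out := g) \<and> Q 0 g"
      by (intro exI[of _ "(h Out)(0 := 1, 1 := 0)"]) (simp add: Q_def body_def selected_def)
  next
    fix i h' assume i: "i < N" and "\<exists>g. h' = h(Out := g) \<and> Q i g"
    then obtain g where h': "h' = h(Out := g)" and g: "Q i g" by blast
    have "\<exists>g1. exec N L (env(0 := i)) ?c1 h' = h'(Out := g1) \<and>
        (\<forall>p\<in>set [0..<width]. g1 (clip L Out (g 0 + Suc p)) = h Inp (h Ptr i + p)) \<and>
        (\<forall>j. j \<notin> (\<lambda>p. clip L Out (g 0 + Suc p)) ` set [0..<width] \<longrightarrow> g1 j = h' Out j)"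
    proof (rule exec_Seqs_Wr)
      fix r h'' assume h'': "\<And>b. b \<noteq> Out \<Longrightarrow> h'' b = h' b" "\<And>j. j \<notin> {1..} \<Longrightarrow> h'' Out j = h' Out j"
      show "eval N L (env(0 := i)) h'' (Pls (Rd Out (Cst 0)) (Cst (Suc r))) = g 0 + Suc r \<and>
         eval N L (env(0 := i)) h'' (Rd Inp (Pls (Rd Ptr (Var 0)) (Cst r))) = h Inp (h Ptr i + r)"
        using h'' by (simp add: clip_def h')
    qed (auto simp: inj_on_def clip_def)
    then obtain g1 where ex1: "exec N L (env(0 := i)) ?c1 h' = h(Out := g1)"
      and g1': "\<forall>p\<in>set [0..<width]. g1 (clip L Out (g 0 + Suc p)) = h Inp (h Ptr i + p)"
        "\<forall>j. j \<notin> (\<lambda>p. clip L Out (g 0 + Suc p)) ` set [0..<width] \<longrightarrow> g1 j = h' Out j"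
      unfolding h' fun_upd_upd by blast
    have g1: "g1 (g 0 + Suc p) = h Inp (h Ptr i + p)" if "p < width" for p
      using g1'(1) that by (simp add: clip_def)
    have g1_low: "g1 j = g j" if "j \<le> g 0" for j
    proof -
      have "j \<notin> (\<lambda>p. clip L Out (g 0 + Suc p)) ` set [0..<width]" using that by (auto simp: clip_def)
      then show ?thesis using g1'(2) by (simp add: h')
    qed
    have old: "g1 0 = Suc (length (body i))" "g1 (Suc 0) = length (selected i h)"
      "\<forall>q<length (body i). g1 (Suc (Suc q)) = body i ! q"
      using g g1_low by (auto simp: Q_def)
    let ?k = "of_bool (h Sel i \<noteq> 0) + (if h Sel i \<noteq> 0 \<and> h Inp (h Ptr i) < m then length (atoms ! h Inp (h Ptr i)) else 0)"
    let ?g = "g1(Suc 0 := g1 (Suc 0) + of_bool (h Sel i \<noteq> 0), 0 := g1 0 + ?k)"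
    have ex: "exec N L (env(0 := i)) ?c h' = h(Out := ?g)"
      by (simp add: ex1 eval_arity_e clip_def)
    have "Q (Suc i) ?g"
    proof (cases "h Sel i = 0")
      case True
      then have "selected (Suc i) h = selected i h" by (simp add: selected_def)
      then show ?thesis using old True by (simp add: Q_def body_def)
    next
      case False
      then have "i < n" using i sel by (auto simp: marked_def)
      then have type: "h Inp (h Ptr i) = fst (fs ! i)" and wfi: "fst (fs ! i) < m" "length (snd (fs ! i)) = length (atoms ! fst (fs ! i))"
        and words: "\<And>p. p < length (fact_words (fs ! i)) \<Longrightarrow> h Inp (h Ptr i + p) = fact_words (fs ! i) ! p"
        using st wf_nth by (auto simp: stored_def nth_Cons split: nat.split)
      have sel': "selected (Suc i) h = selected i h @ [fs ! i]" using False by (simp add: selected_def)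
      then have body': "body (Suc i) = body i @ fact_words (fs ! i)" by (simp add: body_def)
      have "g1 (Suc (Suc q)) = body (Suc i) ! q" if "q < length (body (Suc i))" for q
      proof (cases "q < length (body i)")
        case True
        then show ?thesis using old by (simp add: body' nth_append)
      next
        case False
        define p where "p = q - length (body i)"
        have q: "q = length (body i) + p" using False by (simp add: p_def)
        have p: "p < length (fact_words (fs ! i))" using that by (simp add: q body')
        have "p < width" using p length_le_width[OF wfi(1)] wfi(2) by simp
        then have "g1 (Suc (Suc q)) = fact_words (fs ! i) ! p"
          using g1[of p] g words[OF p] by (simp add: Q_def q)
        then show ?thesis by (simp add: body' q)
      qed
      then show ?thesis using False old by (simp add: Q_def sel' body' type wfi)
    qed
    then show "\<exists>g. exec N L (env(0 := i)) ?c h' = h(Out := g) \<and> Q (Suc i) g" unfolding ex by blast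
  qed
  then obtain g where "exec N L env print_com h = h(Out := g)" "Q N g"
    unfolding print_com_def by (auto simp: clip_def fun_upd_twist)
  then show ?thesis
    by (intro exI[of _ g]) (auto simp: Q_def body_def encode_db_eq nth_Cons split: nat.split)
qed

end

text \<open>\<open>R \<le> 2 ^ J\<close> puts all save addresses above the registers, and
  \<open>width < 2 ^ J\<close> makes input and output shorter than \<open>2 ^ (J + 1) * n\<close>,
  the first save address.\<close>

locale laid_out_database = database +
  fixes R J :: nat
  assumes layout: "N = 2 ^ (J + R + 1) * n" "L = N - 1 - R" "1 \<le> n" "1 \<le> R" "R \<le> 2 ^ J" "width < 2 ^ J"
begin

definition "place r = 2 ^ (J + r) * n - R"

lemma fs_nonempty [simp]: "fs \<noteq> []"
  using layout(3) by auto

lemma R_le: "R \<le> 2 ^ (J + r) * n"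
proof -
  have "R * 1 \<le> 2 ^ (J + r) * n"
    using layout(3,5) by (intro mult_le_mono) (auto intro: le_trans power_increasing)
  then show ?thesis by simp
qed

lemma R_less: "R < N"
proof -
  have "N = 2 * (2 ^ (J + R) * n)" "0 < 2 ^ (J + R) * n" by (simp_all add: layout(1))
  then show ?thesis using R_le[of R] by linarith
qed

lemma place_le: "r \<le> R \<Longrightarrow> place r \<le> L"
proof -
  assume r: "r \<le> R"
  have "2 ^ (J + r) * n \<le> 2 ^ (J + R) * n" using r by (intro mult_le_mono1 power_increasing) auto
  also have "\<dots> < N" using layout(1,3) by simp
  finally show "place r \<le> L" using layout(2) by (simp add: place_def)
qed

lemma place_inj:
  assumes "place r = place s" shows "r = s"
proof -
  have "2 ^ (J + r) * n = 2 ^ (J + s) * n"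
    using assms R_le[of r] R_le[of s] unfolding place_def by linarith
  then show ?thesis by simp
qed

lemma eval_place: "h Nf 0 = n \<Longrightarrow> eval N L env h (Mns (Dbls (J + r) size_e) (Cst R)) = place r"
  by (simp add: place_def size_e_def clip_def)

lemma length_encode_db:
  assumes "\<forall>f\<in>set gs. wf_fact atoms f"
  shows "length (encode_db gs) \<le> Suc (length gs * width)"
  using assms
proof (induction gs)
  case (Cons f gs)
  then have "length (fact_words f) \<le> width"
    using length_le_width[of "fst f"] by (auto simp: wf_fact_def)
  then show ?case using Cons by (auto simp: encode_db_eq)
qed (simp add: encode_db_eq)

lemma length_encode_less:
  assumes "set gs \<subseteq> set fs" "length gs \<le> n"
  shows "length (encode_db gs) < 2 ^ (J + 1) * n"
proof -
  have "length (encode_db gs) \<le> Suc (length gs * width)"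
    using assms(1) wf by (intro length_encode_db) (auto simp: wf_db_def)
  also have "\<dots> \<le> Suc (n * width)" using assms(2) by simp
  also have "\<dots> \<le> n * Suc width" using layout(3) by simp
  also have "\<dots> \<le> n * 2 ^ J" using layout(6) by (intro mult_le_mono2) simp
  also have "\<dots> < 2 ^ (J + 1) * n" using layout(3) by simp
  finally show ?thesis .
qed

lemma exec_copy_in:
  assumes high: "\<And>a. R \<le> a \<Longrightarrow> a < length (encode_db fs) \<Longrightarrow> h Raw (a - R) = encode_db fs ! a"
    and low: "\<And>a. 1 \<le> a \<Longrightarrow> a < R \<Longrightarrow> a < length (encode_db fs) \<Longrightarrow> h Raw (place a) = encode_db fs ! a"
  shows "loaded (exec N L env (copy_in R J) h)"
proof -
  let ?h1 = "h(Nf := (h Nf)(0 := n))"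
  have "(\<Sum>i<N. of_bool (2 ^ (J + R + 1) * i < N)) = card ({..<N} \<inter> {i. 2 ^ (J + R + 1) * i < N})"
    by (simp add: sum.If_cases of_bool_def)
  also have "{..<N} \<inter> {i. 2 ^ (J + R + 1) * i < N} = {..<n}"
  proof -
    have iff: "2 ^ (J + R + 1) * i < N \<longleftrightarrow> i < n" for i unfolding layout(1) by simp
    have "{..<N} \<inter> {i. i < n} = {..<n}" using size_le by auto
    then show ?thesis unfolding iff .
  qed
  finally have count: "(\<Sum>i<N. of_bool (2 ^ (J + R + 1) * i < N)) = n" by simp
  have 1: "exec N L env (Wr Nf (Cst 0) (Sgm 0 (Nt (Nt (Mns Bnd (Dbls (J + R + 1) (Var 0))))))) h = ?h1"
    using count by (simp add: clip_def not_le)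
  \<comment> \<open>For \<open>j < R\<close> the truncated index is 0 and the copied value is wrong;
    the following sequence of writes replaces the values at cells 1 to \<open>R - 1\<close>.\<close>
  let ?h2 = "?h1(Inp := (\<lambda>j. if j < N then h Raw (min (j - R) L) else h Inp j))"
  have 2: "exec N L env (For 0 (Wr Inp (Var 0) (Rd Raw (Mns (Var 0) (Cst R))))) ?h1 = ?h2"
    by (subst exec_For_Wr[where v = "\<lambda>j. h Raw (min (j - R) L)"]) (auto simp: clip_def fun_eq_iff)
  have "\<exists>g. exec N L env (Seqs (map (\<lambda>r. Wr Inp (Cst r) (Rd Raw (Mns (Dbls (J + r) size_e) (Cst R)))) [1..<R])) ?h2 = ?h2(Inp := g) \<and>
     (\<forall>r\<in>set [1..<R]. g (clip L Inp r) = h Raw (place r)) \<and>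
     (\<forall>j. j \<notin> (\<lambda>r. clip L Inp r) ` set [1..<R] \<longrightarrow> g j = ?h2 Inp j)"
  proof (rule exec_Seqs_Wr[where I = UNIV])
    fix r h' assume r: "r \<in> set [1..<R]" and h': "\<And>b. b \<noteq> Inp \<Longrightarrow> h' b = ?h2 b"
    have "eval N L env h' (Mns (Dbls (J + r) size_e) (Cst R)) = place r"
      by (rule eval_place) (simp add: h')
    then show "eval N L env h' (Cst r) = r \<and> eval N L env h' (Rd Raw (Mns (Dbls (J + r) size_e) (Cst R))) = h Raw (place r)"
      using place_le[of r] r h' by (simp add: clip_def min_def)
  qed (auto simp: inj_on_def clip_def)
  then obtain g where 3: "exec N L env (Seqs (map (\<lambda>r. Wr Inp (Cst r) (Rd Raw (Mns (Dbls (J + r) size_e) (Cst R)))) [1..<R])) ?h2 = ?h2(Inp := g)"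
    and g: "\<forall>r\<in>set [1..<R]. g (clip L Inp r) = h Raw (place r)"
      "\<forall>j. j \<notin> (\<lambda>r. clip L Inp r) ` set [1..<R] \<longrightarrow> g j = ?h2 Inp j" by blast
  have ex: "exec N L env (copy_in R J) h = ?h2(Inp := g)"
    unfolding copy_in_def exec.simps(3) 1 2 3 ..
  have len: "length (encode_db fs) < N"
  proof -
    have "2 ^ (J + 1) * n \<le> 2 ^ (J + R + 1) * n" by (intro mult_le_mono1 power_increasing) auto
    then show ?thesis using length_encode_less[OF order_refl order_refl] unfolding layout(1) by linarith
  qed
  have "g a = encode_db fs ! a" if a: "1 \<le> a" "a < length (encode_db fs)" for a
  proof (cases "a < R")
    case True
    then show ?thesis using g(1) a low by (simp add: clip_def)
  next
    case False
    then have "g a = ?h2 Inp a" using g(2) by (auto simp: clip_def)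
    also have "\<dots> = h Raw (a - R)" using a len layout(2) by (simp add: min_def)
    finally show ?thesis using high a False by simp
  qed
  then show ?thesis unfolding ex by (simp add: loaded_def)
qed

lemma exec_copy_out:
  assumes nf: "h Nf 0 = n"
  shows "\<exists>g. exec N L env (copy_out R J) h = h(Raw := g) \<and>
    (\<forall>a. R \<le> a \<and> a < 2 ^ (J + 1) * n \<longrightarrow> g (a - R) = h Out a) \<and>
    (\<forall>r. 1 \<le> r \<and> r < R \<longrightarrow> g (place r) = h Out r) \<and> g (place R) = h Out 0"
proof -
  have "\<exists>g. exec N L env (For 0 (Wr Raw (Mns (Var 0) (Cst R)) (Rd Out (Var 0)))) h = h(Raw := g) \<and>
     (\<forall>a. R \<le> a \<and> a < N \<longrightarrow> g (a - R) = h Out a)"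
    unfolding exec.simps(4)
  \<comment> \<open>Iterations below \<open>R\<close> all hit index 0 of \<open>Raw\<close>; the
    claim starts at \<open>a = R\<close>, whose later iteration overwrites that cell with the right
    word.\<close>
  proof (rule fold_upt_induct[where P = "\<lambda>i h'. \<exists>g. h' = h(Raw := g) \<and> (\<forall>a. R \<le> a \<and> a < i \<longrightarrow> g (a - R) = h Out a)"])
    show "\<exists>g. h = h(Raw := g) \<and> (\<forall>a. R \<le> a \<and> a < 0 \<longrightarrow> g (a - R) = h Out a)"
      by (intro exI[of _ "h Raw"]) simp
  next
    fix i h' assume i: "i < N" and "\<exists>g. h' = h(Raw := g) \<and> (\<forall>a. R \<le> a \<and> a < i \<longrightarrow> g (a - R) = h Out a)"
    then obtain g where g: "h' = h(Raw := g)" "\<And>a. R \<le> a \<and> a < i \<Longrightarrow> g (a - R) = h Out a" by blast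
    have "min (i - R) L = i - R" using i layout(2) by simp
    then have "exec N L (env(0 := i)) (Wr Raw (Mns (Var 0) (Cst R)) (Rd Out (Var 0))) h' = h(Raw := g(i - R := h Out i))"
      using g(1) by (simp add: clip_def)
    moreover have "(g(i - R := h Out i)) (a - R) = h Out a" if "R \<le> a" "a < Suc i" for a
      using g(2)[of a] that by (cases "a = i") auto
    ultimately show "\<exists>g. exec N L (env(0 := i)) (Wr Raw (Mns (Var 0) (Cst R)) (Rd Out (Var 0))) h' = h(Raw := g) \<and>
       (\<forall>a. R \<le> a \<and> a < Suc i \<longrightarrow> g (a - R) = h Out a)" by blast
  qed
  then obtain g1 where 1: "exec N L env (For 0 (Wr Raw (Mns (Var 0) (Cst R)) (Rd Out (Var 0)))) h = h(Raw := g1)"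
    and g1: "\<And>a. R \<le> a \<Longrightarrow> a < N \<Longrightarrow> g1 (a - R) = h Out a" by blast
  let ?h1 = "h(Raw := g1)"
  have clip_place: "clip L Raw (place r) = place r" if "r \<le> R" for r
    using place_le[OF that] by (simp add: clip_def)
  have "\<exists>g. exec N L env (Seqs (map (\<lambda>r. Wr Raw (Mns (Dbls (J + r) size_e) (Cst R)) (Rd Out (Cst (if r = R then 0 else r)))) [1..<Suc R])) ?h1 = ?h1(Raw := g) \<and>
     (\<forall>r\<in>set [1..<Suc R]. g (clip L Raw (place r)) = h Out (if r = R then 0 else r)) \<and>
     (\<forall>j. j \<notin> (\<lambda>r. clip L Raw (place r)) ` set [1..<Suc R] \<longrightarrow> g j = ?h1 Raw j)"
  proof (rule exec_Seqs_Wr[where I = UNIV])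
    show "inj_on (\<lambda>r. clip L Raw (place r)) (set [1..<Suc R])"
      using clip_place place_inj by (auto simp: inj_on_def)
  next
    fix r h' assume h': "\<And>b. b \<noteq> Raw \<Longrightarrow> h' b = ?h1 b"
    have "eval N L env h' (Mns (Dbls (J + r) size_e) (Cst R)) = place r"
      by (rule eval_place) (simp add: h' nf)
    then show "eval N L env h' (Mns (Dbls (J + r) size_e) (Cst R)) = place r \<and>
        eval N L env h' (Rd Out (Cst (if r = R then 0 else r))) = h Out (if r = R then 0 else r)"
      using h' by (simp add: clip_def)
  qed auto
  then obtain g where 2: "exec N L env (Seqs (map (\<lambda>r. Wr Raw (Mns (Dbls (J + r) size_e) (Cst R)) (Rd Out (Cst (if r = R then 0 else r)))) [1..<Suc R])) ?h1 = ?h1(Raw := g)"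
    and g: "\<forall>r\<in>set [1..<Suc R]. g (clip L Raw (place r)) = h Out (if r = R then 0 else r)"
     "\<forall>j. j \<notin> (\<lambda>r. clip L Raw (place r)) ` set [1..<Suc R] \<longrightarrow> g j = ?h1 Raw j" by blast
  have ex: "exec N L env (copy_out R J) h = h(Raw := g)"
    unfolding copy_out_def exec.simps(3) 1 2 by simp
  have place: "g (place r) = h Out (if r = R then 0 else r)" if "1 \<le> r" "r \<le> R" for r
    using bspec[OF g(1), of r] that clip_place[OF that(2)] by (simp del: upt_Suc)
  have "g (a - R) = h Out a" if a: "R \<le> a" "a < 2 ^ (J + 1) * n" for a
  proof -
    \<comment> \<open>The places belong to cells from \<open>2 ^ (J + 1) * n\<close> on, so
      depositing the register words there leaves the region of the output intact.\<close>
    have "a - R \<noteq> place r" if "1 \<le> r" for r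
    proof -
      have "2 ^ (J + 1) * n \<le> 2 ^ (J + r) * n" using that by (intro mult_le_mono1 power_increasing) auto
      then have "a < 2 ^ (J + r) * n" using a by linarith
      then show ?thesis using a by (simp add: place_def)
    qed
    then have "clip L Raw (place r) \<noteq> a - R" if "r \<in> set [1..<Suc R]" for r
      using clip_place[of r] that by (metis atLeastLessThan_iff less_Suc_eq_le set_upt)
    then have "a - R \<notin> (\<lambda>r. clip L Raw (place r)) ` set [1..<Suc R]"
      by (metis (no_types, lifting) imageE)
    moreover have "2 ^ (J + 1) * n \<le> N" unfolding layout(1) by (intro mult_le_mono1 power_increasing) auto
    ultimately show ?thesis using g(2) g1[of a] a by simp
  qed
  moreover have "g (place r) = h Out r" if "1 \<le> r" "r < R" for r
    using place[of r] that by simp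
  moreover have "g (place R) = h Out 0" using place[of R] layout(4) by simp
  ultimately show ?thesis using ex by blast
qed

end

section \<open>The RAM program\<close>

definition effect :: "instr list \<Rightarrow> (nat \<Rightarrow> nat) \<Rightarrow> nat \<Rightarrow> nat" where
  "effect = fold (\<lambda>i m. snd (exec_instr i (0, m)))"

lemma effect_append: "effect (xs @ ys) m = effect ys (effect xs m)"
  by (simp add: effect_def)

text \<open>The input occupies the cells needed as registers, and only cell 0, which holds the number n > 0 of
  facts, has a known role.  Doubling it repeatedly gives addresses beyond the input at which the other
  cells can be saved.\<close>

definition save_code :: "nat \<Rightarrow> instr list" where
  "save_code k = concat (map (\<lambda>r. [Add 0 0 0, Store 0 r]) [1..<k])"

definition restore_code :: "nat \<Rightarrow> instr list" where
  "restore_code k = concat (map (\<lambda>r. [Add 0 0 0, Load r 0]) [1..<k])"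

lemma effect_double: "effect (replicate k (Add 0 0 0)) m = m(0 := 2 ^ k * m 0)"
  by (induction k arbitrary: m) (auto simp: effect_def)

lemma effect_quadruple: "effect [Add 0 0 0, Add 0 0 0] m = m(0 := 4 * m 0)"
  by (auto simp: effect_def)

lemma effect_fetch: "effect [Add 0 0 0, Load 0 0] m = m(0 := if m 0 = 0 then 0 else m (m 0 + m 0))"
  by (auto simp: effect_def)

text \<open>Since \<open>k \<le> m 0\<close>, all store addresses \<open>2 ^ r * m 0\<close> are
  above the cells being saved, so every cell is still intact when its turn comes.\<close>

lemma effect_save:
  assumes "1 \<le> k" "k \<le> m 0"
  shows "effect (save_code k) m 0 = 2 ^ (k - 1) * m 0 \<and>
    (\<forall>r. 1 \<le> r \<and> r < k \<longrightarrow> effect (save_code k) m (2 ^ r * m 0) = m r) \<and>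
    (\<forall>a. 0 < a \<and> a < 2 * m 0 \<longrightarrow> effect (save_code k) m a = m a)"
  using assms
proof (induction k rule: dec_induct)
  case base
  show ?case by (simp add: save_code_def effect_def)
next
  case (step k)
  define m' where "m' = effect (save_code k) m"
  have p: "0 < m 0" and k: "k < m 0" using step.hyps step.prems by auto
  have IH: "m' 0 = 2 ^ (k - 1) * m 0" "\<And>r. 1 \<le> r \<Longrightarrow> r < k \<Longrightarrow> m' (2 ^ r * m 0) = m r"
    "\<And>a. 0 < a \<Longrightarrow> a < 2 * m 0 \<Longrightarrow> m' a = m a"
    using step.IH step.prems by (auto simp: m'_def)
  have dbl: "m' 0 + m' 0 = 2 ^ k * m 0"
    using step.hyps by (cases k) (auto simp: IH(1))
  have "save_code (Suc k) = save_code k @ [Add 0 0 0, Store 0 k]"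
    using step.hyps by (simp add: save_code_def)
  then have eff: "effect (save_code (Suc k)) m = m'(0 := 2 ^ k * m 0, 2 ^ k * m 0 := m k)"
    using IH(3)[of k] k step.hyps by (simp add: effect_append m'_def[symmetric]) (simp add: effect_def dbl)
  have ge: "2 * m 0 \<le> 2 ^ r * m 0" if "1 \<le> r" for r
    using power_increasing[OF that, of "2::nat"] by simp
  show ?case
    unfolding eff
  proof (intro conjI allI impI)
    fix r assume r: "1 \<le> r \<and> r < Suc k"
    have "2 ^ r * m 0 \<noteq> 2 ^ k * m 0" if "r \<noteq> k" using that p by simp
    then show "(m'(0 := 2 ^ k * m 0, 2 ^ k * m 0 := m k)) (2 ^ r * m 0) = m r"
      using r p IH(2)[of r] by (cases "r = k") auto
  next
    fix a assume "0 < a \<and> a < 2 * m 0"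
    then show "(m'(0 := 2 ^ k * m 0, 2 ^ k * m 0 := m k)) a = m a"
      using ge[of k] step.hyps IH(3)[of a] by auto
  qed (use p in auto)
qed

text \<open>The sources lie at or above \<open>m 0\<close>, hence above the cells already
  overwritten.\<close>

lemma effect_restore:
  assumes "1 \<le> k" "k \<le> m 0"
  shows "effect (restore_code k) m 0 = 2 ^ (k - 1) * m 0 \<and>
    (\<forall>r. 1 \<le> r \<and> r < k \<longrightarrow> effect (restore_code k) m r = m (2 ^ r * m 0)) \<and>
    (\<forall>a\<ge>k. effect (restore_code k) m a = m a)"
  using assms
proof (induction k rule: dec_induct)
  case base
  show ?case by (simp add: restore_code_def effect_def)
next
  case (step k)
  define m' where "m' = effect (restore_code k) m"
  have p: "0 < m 0" and k: "k < m 0" using step.hyps step.prems by auto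
  have IH: "m' 0 = 2 ^ (k - 1) * m 0" "\<And>r. 1 \<le> r \<Longrightarrow> r < k \<Longrightarrow> m' r = m (2 ^ r * m 0)"
    "\<And>a. k \<le> a \<Longrightarrow> m' a = m a"
    using step.IH step.prems by (auto simp: m'_def)
  have dbl: "m' 0 + m' 0 = 2 ^ k * m 0"
    using step.hyps by (cases k) (auto simp: IH(1))
  have "m 0 \<le> 2 ^ k * m 0" by simp
  then have "k \<le> 2 ^ k * m 0" using k by linarith
  moreover have "restore_code (Suc k) = restore_code k @ [Add 0 0 0, Load k 0]"
    using step.hyps by (simp add: restore_code_def)
  ultimately have eff: "effect (restore_code (Suc k)) m = m'(0 := 2 ^ k * m 0, k := m (2 ^ k * m 0))"
    using IH(3)[of "2 ^ k * m 0"] p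
    by (simp add: effect_append m'_def[symmetric]) (simp add: effect_def dbl)
  show ?case
    unfolding eff using step.hyps IH(2,3) by (auto simp: less_Suc_eq)
qed

lemma runs_effect:
  assumes "code_at prog pc is" "\<forall>i\<in>set is. straight i"
  shows "runs prog (pc, m) (pc + length is, effect is m) (length is)"
  using runs_straight[OF assms] by (simp add: effect_def)

context query begin

definition "main_com R J = Seq (copy_in R J) (Seq parse_com (Seq greedy_com (Seq print_com (copy_out R J))))"

text \<open>The doublings number \<open>J\<close>, then \<open>R - 1\<close> while saving, then 2,
  which gives \<open>2 ^ (J + R + 1) * n\<close>. The last two leave room below \<open>N\<close> for
  the extra slot with exponent \<open>J + R\<close>.\<close>

definition "start_code R J = replicate J (Add 0 0 0) @ save_code R @ [Add 0 0 0, Add 0 0 0]"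

text \<open>Expects \<open>2 ^ J * n\<close> in cell \<open>t\<close>. The last load replaces cell
  0, which has served as the moving address, by the output length.\<close>

definition "finish_code t R = [LoadC (t + 1) 0, Add 0 t (t + 1)] @ restore_code R @ [Add 0 0 0, Load 0 0]"

definition "main_pc R J = Suc (length (start_code R J))"
definition "finish_pc R J = main_pc R J + clen (main_com R J)"
definition "halt_pc t R J = finish_pc R J + elen (Dbls J size_e) + length (finish_code t R)"

text \<open>An empty database is caught by the first jump, as doubling 0 gives no addresses. Its
  answer is the single word 0: cell 0 becomes 1 and cell 1 is still 0.\<close>

definition "program t R J = [Jz 0 (Suc (halt_pc t R J))] @ start_code R J @
  ccode R t (main_pc R J) (main_com R J) @ ecode R t (finish_pc R J) (Dbls J size_e) @
  finish_code t R @ [Halt, LoadC 0 1, Halt]"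

definition "cost t R J N = length (program t R J) + ccost N (main_com R J) + ecost N (Dbls J size_e)"

end

lemma straight_simps:
  "i \<in> set (save_code k) \<Longrightarrow> straight i" "i \<in> set (restore_code k) \<Longrightarrow> straight i"
  by (auto simp: save_code_def restore_code_def split: if_splits)

context laid_out_database begin

lemma effect_start_code:
  assumes s: "s 0 = n" and inp: "\<And>a. 1 \<le> a \<Longrightarrow> a < length (encode_db fs) \<Longrightarrow> s a = encode_db fs ! a"
  defines "m' \<equiv> effect (start_code R J) s"
  shows "m' 0 = N" "R \<le> a \<Longrightarrow> a < length (encode_db fs) \<Longrightarrow> m' a = encode_db fs ! a"
    "1 \<le> r \<Longrightarrow> r < R \<Longrightarrow> r < length (encode_db fs) \<Longrightarrow> m' (2 ^ (J + r) * n) = encode_db fs ! r"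
proof -
  define m1 where "m1 = s(0 := 2 ^ J * n)"
  have "R \<le> m1 0" using R_le[of 0] by (simp add: m1_def)
  note save = effect_save[of R m1, OF layout(4) this]
  have m': "m' = (effect (save_code R) m1)(0 := 4 * effect (save_code R) m1 0)"
    by (simp add: m'_def start_code_def effect_append effect_double effect_quadruple s m1_def)
  have pos: "0 < 2 ^ J * n" by simp
  show "m' 0 = N"
  proof -
    have "4 * 2 ^ (R - 1) = (2::nat) ^ (R + 1)" using layout(4) by (cases R) auto
    then show ?thesis using save by (simp add: m' m1_def layout(1) power_add)
  qed
  have low: "m' a = s a" if "0 < a" "a < 2 * (2 ^ J * n)" for a
    using save that by (simp add: m' m1_def)
  have len: "length (encode_db fs) < 2 * (2 ^ J * n)"
    using length_encode_less[OF order_refl order_refl] by simp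
  show "m' a = encode_db fs ! a" if "R \<le> a" "a < length (encode_db fs)"
    using low[of a] inp[of a] that len layout(4) by simp
  show "m' (2 ^ (J + r) * n) = encode_db fs ! r" if "1 \<le> r" "r < R" "r < length (encode_db fs)"
  proof -
    have "effect (save_code R) m1 (2 ^ r * m1 0) = m1 r" using save that by blast
    moreover have "2 ^ r * m1 0 = 2 ^ (J + r) * n" by (simp add: m1_def power_add)
    moreover have "m1 r = encode_db fs ! r" using inp[of r] that by (simp add: m1_def)
    ultimately show ?thesis by (simp add: m')
  qed
qed

lemma effect_finish_code:
  assumes "s t = 2 ^ J * n" "t + 1 < R" "0 < t"
  defines "m' \<equiv> effect (finish_code t R) s"
  shows "m' 0 = s (2 ^ (J + R) * n)" "1 \<le> r \<Longrightarrow> r < R \<Longrightarrow> m' r = s (2 ^ (J + r) * n)" "R \<le> a \<Longrightarrow> m' a = s a"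
proof -
  define m1 where "m1 = s(t + 1 := 0, 0 := 2 ^ J * n)"
  have m1_0: "m1 0 = 2 ^ J * n" by (simp add: m1_def)
  have "R \<le> m1 0" using R_le[of 0] by (simp add: m1_def)
  note restore = effect_restore[of R m1, OF layout(4) this]
  let ?m2 = "effect (restore_code R) m1"
  have dbl: "?m2 0 + ?m2 0 = 2 ^ (J + R) * n"
  proof -
    have "?m2 0 = 2 ^ (R - 1) * (2 ^ J * n)" using restore by (simp add: m1_0)
    then show ?thesis using layout(4) by (cases R) (auto simp: power_add)
  qed
  have high: "m1 (2 ^ (J + r) * n) = s (2 ^ (J + r) * n)" for r
    using R_le[of r] assms(2) by (simp add: m1_def)
  have R: "R \<le> 2 ^ (J + R) * n" by (rule R_le)
  have "?m2 (2 ^ (J + R) * n) = m1 (2 ^ (J + R) * n)" using restore R by blast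
  then have m2: "?m2 (2 ^ (J + R) * n) = s (2 ^ (J + R) * n)" by (simp add: high)
  have "effect [LoadC (t + 1) 0, Add 0 t (t + 1)] s = m1"
    using assms by (simp add: effect_def m1_def)
  then have m': "m' = ?m2(0 := s (2 ^ (J + R) * n))"
    using m2 dbl unfolding m'_def finish_code_def effect_append effect_fetch by auto
  show "m' 0 = s (2 ^ (J + R) * n)" by (simp add: m')
  show "m' r = s (2 ^ (J + r) * n)" if "1 \<le> r" "r < R"
  proof -
    have "?m2 r = m1 (2 ^ r * m1 0)" using restore that by blast
    also have "2 ^ r * m1 0 = 2 ^ (J + r) * n" by (simp add: m1_0 power_add)
    finally show ?thesis using that by (simp add: m' high)
  qed
  show "m' a = s a" if "R \<le> a"
  proof -
    have "?m2 a = m1 a" using restore that by blast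
    then show ?thesis using that assms(2) layout(4) by (simp add: m' m1_def)
  qed
qed

lemma program_correct:
  assumes fits: "cvars (main_com R J) \<le> nv" "nv + 1 + ctemps (main_com R J) \<le> R" "nv + 4 \<le> R"
  defines "t \<equiv> nv + 1"
  shows "\<exists>gs. ram_computes_within (program t R J) (encode_db fs) (cost t R J N) (encode_db gs) \<and>
    set gs \<subseteq> set fs \<and> cq_eval atoms (set hs) (set gs) = cq_eval atoms (set hs) (set fs) \<and>
    real (card (set gs)) \<le> real (m * m) * (1 + ln (real n)) * real (swp_opt atoms (set hs) (set fs))"
proof -
  let ?prog = "program t R J"
  have codes: "code_at ?prog 1 (start_code R J)"
    "code_at ?prog (main_pc R J) (ccode R t (main_pc R J) (main_com R J))"
    "code_at ?prog (finish_pc R J) (ecode R t (finish_pc R J) (Dbls J size_e))"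
    "code_at ?prog (finish_pc R J + elen (Dbls J size_e)) (finish_code t R)"
    "code_at ?prog (halt_pc t R J) [Halt]"
    using code_at_infix[of "[]" ?prog "[]"]
    by (simp_all add: program_def main_pc_def finish_pc_def halt_pc_def)
  define m0 where "m0 = snd (ram_init (encode_db fs))"
  have init: "ram_init (encode_db fs) = (0, m0)" by (simp add: m0_def ram_init_def)
  have m0: "m0 0 = n" "\<And>a. 1 \<le> a \<Longrightarrow> a < length (encode_db fs) \<Longrightarrow> m0 a = encode_db fs ! a"
    by (simp_all add: m0_def ram_init_def encode_db_eq)
  have r0: "runs ?prog (0, m0) (1, m0) 1"
    using runs_step[of 0 ?prog m0 "(1, m0)" 0] m0 by (simp add: program_def)
  define m1 where "m1 = effect (start_code R J) m0"
  have r1: "runs ?prog (1, m0) (main_pc R J, m1) (length (start_code R J))"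
  proof -
    have "\<forall>i\<in>set (start_code R J). straight i" unfolding start_code_def by (auto simp: straight_simps)
    from runs_effect[OF codes(1) this, of m0] show ?thesis by (simp add: m1_def main_pc_def)
  qed
  have started: "m1 0 = N" "\<And>a. R \<le> a \<Longrightarrow> a < length (encode_db fs) \<Longrightarrow> m1 a = encode_db fs ! a"
    "\<And>r. 1 \<le> r \<Longrightarrow> r < R \<Longrightarrow> r < length (encode_db fs) \<Longrightarrow> m1 (2 ^ (J + r) * n) = encode_db fs ! r"
    using effect_start_code[of m0] m0 unfolding m1_def by blast+
  \<comment> \<open>The initial heap is whatever the memory contains, so no array has to be cleared
    for the representation to hold.\<close>
  define h0 where "h0 = (\<lambda>a i. m1 (adr R N a i))"
  define env where "env = (\<lambda>r. m1 (Suc r))"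
  have rep0: "rep R N nv env h0 m1" by (simp add: rep_def h0_def env_def started(1))
  have t: "nv < t" by (simp add: t_def)
  obtain m2 where r2: "runs ?prog (main_pc R J, m1) (finish_pc R J, m2) (ccost N (main_com R J))"
    and rep2: "rep R N nv env (exec N L env (main_com R J) h0) m2"
    using ccode_correct[OF codes(2) rep0 fits(1) t _ R_less] fits(2) layout(2) by (auto simp: t_def finish_pc_def)
  have ld: "loaded (exec N L env (copy_in R J) h0)"
  proof (rule exec_copy_in)
    show "h0 Raw (a - R) = encode_db fs ! a" if "R \<le> a" "a < length (encode_db fs)" for a
      using started(2)[OF that] that by (simp add: h0_def adr_def)
    show "h0 Raw (place a) = encode_db fs ! a" if "1 \<le> a" "a < R" "a < length (encode_db fs)" for a
      using started(3)[OF that] R_le[of a] by (simp add: h0_def adr_def place_def)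
  qed
  define h2 where "h2 = exec N L env parse_com (exec N L env (copy_in R J) h0)"
  have st: "stored h2" unfolding h2_def by (rule exec_parse[OF ld])
  define h3 where "h3 = exec N L env greedy_com h2"
  obtain S where S: "H.greedy_inv 0 S" and st3: "stored h3" and sel: "marked Sel h3 = S \<union> ypart"
    unfolding h3_def using exec_greedy[OF st] by blast
  define gs where "gs = selected N h3"
  have set_gs: "set gs = (!) fs ` (S \<union> ypart)"
    unfolding sel[symmetric] by (auto simp: gs_def selected_def marked_def)
  have sub: "marked Sel h3 \<subseteq> {..<n}" using greedy_feasible(1)[OF S] sel by simp
  obtain g where print: "exec N L env print_com h3 = h3(Out := g)" and g0: "g 0 = length (encode_db gs)"
    and g: "\<And>q. q < length (encode_db gs) \<Longrightarrow> g (Suc q) = encode_db gs ! q"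
    using exec_print[OF st3 sub, of env] by (auto simp: gs_def)
  have nf: "(h3(Out := g)) Nf 0 = n" using st3 by (simp add: stored_def)
  obtain g' where out: "exec N L env (main_com R J) h0 = h3(Out := g, Raw := g')"
    and g': "\<And>a. R \<le> a \<Longrightarrow> a < 2 ^ (J + 1) * n \<Longrightarrow> g' (a - R) = g a"
      "\<And>r. 1 \<le> r \<Longrightarrow> r < R \<Longrightarrow> g' (place r) = g r" "g' (place R) = g 0"
    using exec_copy_out[of "h3(Out := g)" env, OF nf] print
    unfolding main_com_def exec.simps(3) h2_def[symmetric] h3_def[symmetric] by auto
  have "evars (Dbls J size_e) \<le> nv" "t + etemps (Dbls J size_e) \<le> R"
  proof -
    have "evars (Dbls J size_e) = 0" "etemps (Dbls J size_e) = 3"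
      unfolding Dbls_def by (induction J) (auto simp: size_e_def)
    then show "evars (Dbls J size_e) \<le> nv" "t + etemps (Dbls J size_e) \<le> R" using fits(3) by (simp_all add: t_def)
  qed
  then obtain m3 where r3: "runs ?prog (finish_pc R J, m2) (finish_pc R J + elen (Dbls J size_e), m3) (ecost N (Dbls J size_e))"
    and m3: "m3 t = 2 ^ J * n" "agree t R m2 m3"
    using ecode_correct[OF codes(3) rep2 _ t _ R_less] nf unfolding out by (auto simp: size_e_def clip_def)
  define m4 where "m4 = effect (finish_code t R) m3"
  have r4: "runs ?prog (finish_pc R J + elen (Dbls J size_e), m3) (halt_pc t R J, m4) (length (finish_code t R))"
  proof -
    have "\<forall>i\<in>set (finish_code t R). straight i" unfolding finish_code_def by (auto simp: straight_simps)
    from runs_effect[OF codes(4) this, of m3] show ?thesis by (simp add: m4_def halt_pc_def)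
  qed
  have fin: "m4 0 = m3 (2 ^ (J + R) * n)" "\<And>r. 1 \<le> r \<Longrightarrow> r < R \<Longrightarrow> m4 r = m3 (2 ^ (J + r) * n)"
    "\<And>a. R \<le> a \<Longrightarrow> m4 a = m3 a"
    using effect_finish_code[of m3 t, OF m3(1)] fits(3) by (auto simp: m4_def t_def)
  have raw: "m3 (R + i) = g' i" if "i \<le> L" for i
  proof -
    have "m2 (adr R N Raw i) = (h3(Out := g, Raw := g')) Raw i"
      using rep2 that layout(2) unfolding out rep_def by blast
    then show ?thesis using m3(2) by (simp add: adr_def agree_def)
  qed
  have place: "m3 (2 ^ (J + r) * n) = g' (place r)" if "r \<le> R" for r
    using raw[OF place_le[OF that]] R_le[of r] by (simp add: place_def)
  have "length gs = card (marked Sel h3)"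
  proof -
    have "marked Sel h3 = set (filter (\<lambda>j. h3 Sel j \<noteq> 0) [0..<N])" by (auto simp: marked_def)
    then show ?thesis unfolding gs_def selected_def by (simp add: distinct_card del: set_filter)
  qed
  then have "length gs \<le> n" using card_mono[OF finite_lessThan sub] by simp
  moreover have gs_sub: "set gs \<subseteq> set fs" using set_gs sub sel unfolding set_fs by auto
  ultimately have len: "length (encode_db gs) < 2 ^ (J + 1) * n" by (intro length_encode_less)
  have "m4 a = g a" if a: "1 \<le> a" "a < 2 ^ (J + 1) * n" for a
  proof (cases "a < R")
    case True
    then show ?thesis using fin(2)[of a] place[of a] g'(2) a by simp
  next
    case False
    have "2 ^ (J + 1) * n \<le> N" unfolding layout(1) by (intro mult_le_mono1 power_increasing) auto
    then have "a - R \<le> L" using a layout(2) by linarith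
    then show ?thesis using False fin(3)[of a] raw[of "a - R"] g'(1)[of a] a by simp
  qed
  then have "m4 (Suc q) = encode_db gs ! q" if "q < length (encode_db gs)" for q
    using g[OF that] that len by simp
  moreover have "m4 0 = length (encode_db gs)" using fin(1) place[of R] g'(3) g0 by simp
  ultimately have out_words: "ram_output m4 = encode_db gs"
    by (intro nth_equalityI) (auto simp: ram_output_def)
  have "runs ?prog (ram_init (encode_db fs)) (halt_pc t R J, m4) (cost t R J N)"
    unfolding init
    by (rule runs_trans[OF r0 runs_trans[OF r1 runs_trans[OF r2 runs_trans[OF r3 r4 order_refl] order_refl] order_refl]])
      (simp add: cost_def program_def)
  then have "ram_computes_within ?prog (encode_db fs) (cost t R J N) (encode_db gs)"
    using codes(5) out_words unfolding runs_def ram_computes_within_def by (auto simp: ram_halted_def)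
  moreover have "cq_eval atoms (set hs) (set gs) = cq_eval atoms (set hs) (set fs)"
    unfolding set_gs by (rule greedy_feasible(2)[OF S])
  moreover have "card (set gs) \<le> card (S \<union> ypart)"
    unfolding set_gs using sub sel by (intro card_image_le) (auto intro: finite_subset[of _ "{..<n}"])
  then have "real (card (set gs)) \<le> real (m * m) * (1 + ln (real n)) * real (swp_opt atoms (set hs) (set fs))"
    using greedy_approx[OF S layout(3)] by linarith
  ultimately show ?thesis using gs_sub by blast
qed

end

section \<open>Choice of the layout and the final bound\<close>

lemma temps_Seqs: "\<forall>c\<in>set cs. ctemps c \<le> k \<Longrightarrow> ctemps (Seqs cs) \<le> k"
  by (induction cs) (auto simp: Seqs_def)

lemma vars_Seqs: "\<forall>c\<in>set cs. cvars c \<le> k \<Longrightarrow> cvars (Seqs cs) \<le> k"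
  by (induction cs) (auto simp: Seqs_def)

lemma vars_temps_Dbls [simp]: "evars (Dbls k e) = evars e" "etemps (Dbls k e) = etemps e"
  unfolding Dbls_def by (induction k) auto

context query begin

lemma copy_in_bounds: "ctemps (copy_in R J) \<le> 11" "cvars (copy_in R J) \<le> 1"
  unfolding copy_in_def
  by (auto simp: Nt_def size_e_def intro!: temps_Seqs vars_Seqs)

lemma copy_out_bounds: "ctemps (copy_out R J) \<le> 11" "cvars (copy_out R J) \<le> 1"
  unfolding copy_out_def
  by (auto simp: size_e_def intro!: temps_Seqs vars_Seqs)

text \<open>The program depends on \<open>R\<close> and \<open>J\<close>, which must in turn be
  large enough for the program. The circle breaks because only the two copying phases depend on
  them, and these need at most 11 temporaries and one variable for any layout.\<close>

lemma exists_layout: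
  "\<exists>nv R J. cvars (main_com R J) \<le> nv \<and> nv + 1 + ctemps (main_com R J) \<le> R \<and> nv + 4 \<le> R \<and>
     1 \<le> R \<and> R \<le> 2 ^ J \<and> width < 2 ^ J"
proof -
  define body where "body = Seq parse_com (Seq greedy_com print_com)"
  define nv where "nv = Suc (cvars body)"
  define R where "R = nv + 12 + ctemps body"
  define J where "J = R + width"
  have "J < 2 ^ J" by (rule less_exp)
  then have "R \<le> 2 ^ J" "width < 2 ^ J" unfolding J_def by linarith+
  moreover have "cvars (main_com R J) \<le> nv" "nv + 1 + ctemps (main_com R J) \<le> R"
  proof -
    have "cvars parse_com \<le> cvars body" "cvars greedy_com \<le> cvars body" "cvars print_com \<le> cvars body"
      "ctemps parse_com \<le> ctemps body" "ctemps greedy_com \<le> ctemps body" "ctemps print_com \<le> ctemps body"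
      by (simp_all add: body_def)
    then show "cvars (main_com R J) \<le> nv" "nv + 1 + ctemps (main_com R J) \<le> R"
      using copy_in_bounds[of R J] copy_out_bounds[of R J] by (simp_all add: main_com_def nv_def R_def)
  qed
  ultimately show ?thesis by (intro exI[of _ nv] exI[of _ R] exI[of _ J]) (auto simp: R_def)
qed

lemma poly_bounded_cost: "poly_bounded (cost t R J)"
  unfolding cost_def by (intro poly_bounded_add poly_bounded_const poly_bounded_ccost poly_bounded_ecost)

lemma program_empty: "ram_computes_within (program t R J) (encode_db []) 2 (encode_db [])"
proof -
  let ?prog = "program t R J" and ?m = "snd (ram_init (encode_db []))"
  have len: "halt_pc t R J + 2 < length ?prog"
    by (simp add: program_def halt_pc_def finish_pc_def main_pc_def)
  have codes: "code_at ?prog (halt_pc t R J) [Halt, LoadC 0 1, Halt]"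
    using code_at_infix[of "[]" ?prog "[]"]
    by (simp add: program_def main_pc_def finish_pc_def halt_pc_def)
  have m: "?m = (\<lambda>_. 0)" by (auto simp: ram_init_def encode_db_def)
  have init: "ram_init (encode_db []) = (0, \<lambda>_. 0)" unfolding m[symmetric] by (simp add: ram_init_def)
  have "?prog ! 0 = Jz 0 (Suc (halt_pc t R J))" "0 < length ?prog" by (simp_all add: program_def)
  then have "(ram_step ?prog ^^ 2) (ram_init (encode_db [])) = (Suc (Suc (halt_pc t R J)), (\<lambda>_. 0)(0 := 1))"
    using codes by (simp add: init eval_nat_numeral ram_step_def)
  then show ?thesis
    using codes unfolding ram_computes_within_def
    by (intro exI[of _ 2]) (auto simp: ram_halted_def ram_output_def encode_db_def)
qed

theorem swp_approximable:
  "\<exists>prog k c0 c. \<forall>fs. wf_db atoms (set fs) \<and> distinct fs \<longrightarrow>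
      (\<exists>fs'. ram_computes_within prog (encode_db fs) (c0 * (length fs + 1) ^ k) (encode_db fs')
          \<and> set fs' \<subseteq> set fs
          \<and> cq_eval atoms (set hs) (set fs') = cq_eval atoms (set hs) (set fs)
          \<and> real (card (set fs')) \<le> c * (1 + ln (real (length fs))) * real (swp_opt atoms (set hs) (set fs)))"
proof -
  obtain nv R J where fits: "cvars (main_com R J) \<le> nv" "nv + 1 + ctemps (main_com R J) \<le> R" "nv + 4 \<le> R"
    and layout: "1 \<le> R" "R \<le> 2 ^ J" "width < 2 ^ J" using exists_layout by blast
  let ?prog = "program (nv + 1) R J"
  obtain K k where K: "\<And>N. cost (nv + 1) R J N \<le> K * (N + 1) ^ k"
    using poly_bounded_cost unfolding poly_bounded_def by blast
  define e where "e = J + R + 1"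
  have mono: "ram_computes_within ?prog xs b ys" if "ram_computes_within ?prog xs a ys" "a \<le> b" for xs ys a b
    using that le_trans unfolding ram_computes_within_def by blast
  \<comment> \<open>\<open>N + 1\<close> is at most \<open>2 ^ e * (length fs + 1)\<close>, which
    produces the first summand; the second pays for the two steps on the empty database.\<close>
  define c0 where "c0 = K * 2 ^ (e * k) + 2"
  show ?thesis
  proof ((rule exI)+, intro allI impI)
    fix fs :: "fact list" assume fs: "wf_db atoms (set fs) \<and> distinct fs"
    show "\<exists>fs'. ram_computes_within ?prog (encode_db fs) (c0 * (length fs + 1) ^ k) (encode_db fs')
          \<and> set fs' \<subseteq> set fs
          \<and> cq_eval atoms (set hs) (set fs') = cq_eval atoms (set hs) (set fs)
          \<and> real (card (set fs')) \<le> real (length atoms * length atoms) * (1 + ln (real (length fs))) * real (swp_opt atoms (set hs) (set fs))"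
    proof (cases "fs = []")
      case True
      have "ram_computes_within ?prog (encode_db []) (c0 * (length fs + 1) ^ k) (encode_db [])"
        by (rule mono[OF program_empty]) (simp add: c0_def True)
      then show ?thesis using True by (intro exI[of _ "[]"]) simp
    next
      case False
      define N where "N = 2 ^ e * length fs"
      have "laid_out_database atoms hs x oi op px fs N (N - 1 - R) R J"
      proof unfold_locales
        show "1 \<le> length fs" using False by (cases fs) auto
      qed (use fs layout in \<open>auto simp: N_def e_def\<close>)
      then interpret laid_out_database atoms hs x oi op px fs N "N - 1 - R" R J .
      have "cost (nv + 1) R J N \<le> K * (N + 1) ^ k" by (rule K)
      also have "\<dots> \<le> K * (2 ^ e * (length fs + 1)) ^ k"
        by (intro mult_le_mono2 power_mono) (auto simp: N_def)
      also have "\<dots> = K * 2 ^ (e * k) * (length fs + 1) ^ k"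
        by (simp only: power_mult_distrib power_mult mult.assoc)
      also have "\<dots> \<le> c0 * (length fs + 1) ^ k" by (intro mult_le_mono1) (simp add: c0_def)
      finally have "cost (nv + 1) R J N \<le> c0 * (length fs + 1) ^ k" .
      then show ?thesis using program_correct[OF fits] mono by blast
    qed
  qed
qed

end

theorem theorem33:
  fixes atoms :: "nat list list" and head :: "nat set"
  assumes "\<forall>A \<in> set atoms. distinct A"
    and "head \<subseteq> qattrs atoms"
    and "connected_cq atoms"
    and "card (qattrs atoms - head) = 1"
  shows "\<exists>(prog :: instr list) (k :: nat) (c0 :: nat) (c :: real).
    \<forall>fs. wf_db atoms (set fs) \<and> distinct fs \<longrightarrow>
      (\<exists>fs'. ram_computes_within prog (encode_db fs) (c0 * (length fs + 1) ^ k) (encode_db fs')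
          \<and> set fs' \<subseteq> set fs
          \<and> cq_eval atoms head (set fs') = cq_eval atoms head (set fs)
          \<and> real (card (set fs')) \<le> c * (1 + ln (real (length fs))) * real (swp_opt atoms head (set fs)))"
proof -
  obtain x where x: "qattrs atoms - head = {x}" using assms(4) by (auto simp: card_1_singleton_iff)
  have "finite head" using assms(2) by (rule finite_subset) (simp add: qattrs_def)
  then obtain hs where head_eq: "set hs = head" using finite_list by blast
  \<comment> \<open>The chosen occurrences depend on the query alone, so they are constants of the
    program, fixed before the database.\<close>
  have "\<forall>a. \<exists>i p. a \<in> qattrs atoms \<longrightarrow> i < length atoms \<and> p < length (atoms ! i) \<and> atoms ! i ! p = a"
    by (auto simp: qattrs_def in_set_conv_nth) blast
  then obtain oi op where occ: "\<And>a. a \<in> qattrs atoms \<Longrightarrow>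
      oi a < length atoms \<and> op a < length (atoms ! oi a) \<and> atoms ! oi a ! op a = a" by metis
  have "\<forall>i. \<exists>p. x \<in> set (atoms ! i) \<longrightarrow> p < length (atoms ! i) \<and> atoms ! i ! p = x"
    by (auto simp: in_set_conv_nth)
  then obtain px where px: "\<And>i. x \<in> set (atoms ! i) \<Longrightarrow> px i < length (atoms ! i) \<and> atoms ! i ! px i = x" by metis
  interpret query atoms hs x oi op px
    by unfold_locales (use occ px head_eq x assms(2) in auto)
  show ?thesis using swp_approximable unfolding head_eq .
qed

end
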